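(* Let $L$ be a transverse link with braid diagram $D$, and let $L_0$ be the transverse link whose braid diagram $D_0$ is obtained from $D$ by replacing one positive crossing with its 0-smoothing. Then there is a homomorphism $p: Kh'(L)\to Kh'(L_0)$ such that $p(\psi(L))=\pm\psi(L_0)$.
   Context: Odd Khovanov complex. $R$ is the coefficient ring ($\mathbb Z$ or a field). Let $D$ be an oriented link diagram with crossing set $\mathcal X$. Each crossing has a 0- and a 1-smoothing (standard Khovanov convention: the orientation-respecting smoothing is the 0-smoothing at a positive crossing and the 1-smoothing at a negative crossing). For $\alpha:\mathcal X\to\{0,1\}$, smoothing each $x$ by its $\alpha(x)$-smoothing gives disjoint planar circles $a_1,\dots,a_k$; put $V_\alpha=R\langle v_1,\dots,v_k\rangle$ ($v_i$ corresponds to $a_i$). Choose at each crossing an arrow joining the two arcs of its 0-smoothing; rotating it $90^\circ$ clockwise gives an arrow joining the two arcs of the 1-smoothing. For an edge $e:\alpha_0\to\alpha_1$ of the cube (one value changes from 0 to 1) define $F_e:\Lambda^*V_{\alpha_0}\to\Lambda^*V_{\alpha_1}$: if two circles merge, $F_e$ is the algebra map identifying their generators; if a circle $a$ splits into $a_0,a_1$, with the arrow in the 1-smoothing pointing from $a_0$ to $a_1$, then $F_e(\omega)=(v_0-v_1)\wedge\omega$, where in $\omega$ the generator of $a$ is replaced by $v_0$ (equivalently $v_1$). A 2-dimensional face of the cube is of type A (resp. C) if, over $\mathbb Z$, its two compositions of maps $F_e$ are nonzero and anticommute (resp. commute). In the remaining faces both compositions vanish; there the initial resolution has one circle carrying one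 arrow inside and one arrow outside with interleaved endpoints; going counterclockwise from the tail of the inner arrow, the face is of type X if the next endpoint is the tail of the outer arrow and of type Y if it is its head. A sign assignment is $\varepsilon$: edges $\to\{\pm1\}$ such that each face of type A or X has an even number, and each face of type C or Y an odd number, of edges with $\varepsilon=-1$. $C(D)=\bigoplus_\alpha\Lambda^*V_\alpha$ with differential $d=\sum_e\varepsilon(e)F_e$; up to isomorphism it does not depend on the choices. Its homology is the odd Khovanov homology $Kh'(L)$ of the link $L$ of $D$. Transverse links. Transverse links (in the standard contact $\mathbb R^3$) are represented by braid diagrams, i.e. closures of braid words; two braid diagrams represent the same transverse link iff they are related by finitely many braid group relations, conjugations, and positive stabilizations/destabilizations. Replacing a positive crossing of a braid diagram by its 0-smoothing deletes the corresponding letter $\sigma_i$ from the braid word. The class $\psi$. For a braid diagram $D$ on $b$ strands of a transverse link $L$ let $\alpha'$ be the resolution with the 0-smoothing at every positive and the 1-smoothing at every negative crossing, so that the resolution consists of $b$ parallel circles. Set $\psi(D)=v_1\wedge\cdots\wedge v_b\in\Lambda^bV_{\alpha'}\subset C(D)$. It is a cycle; its class in $Kh'(L)$ is well defined up to sign and, up to isomorphism of $Kh'$, independent of the braid diagram of $L$; it is denoted $\psi(L)$. *)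

theory Defs
  imports
    "HOL-Algebra.Coset"
    "HOL-Library.Function_Algebras"
    "HOL-Library.Product_Lexorder"
begin

section \<open>Coefficients\<close>

text \<open>The coefficient ring is \<open>\<int>\<close> (first disjunct, up to the canonical isomorphism) or a field.\<close>

definition coefficient_ring :: "'r::comm_ring_1 itself \<Rightarrow> bool" where
  "coefficient_ring _ \<longleftrightarrow> bij (of_int :: int \<Rightarrow> 'r) \<or> (\<forall>x::'r. x \<noteq> 0 \<longrightarrow> x dvd 1)"

lemma coefficient_ring_int: "coefficient_ring TYPE(int)"
  unfolding coefficient_ring_def by (auto intro: bijI')

lemma coefficient_ring_field: "coefficient_ring TYPE('k::field)"
  unfolding coefficient_ring_def by (simp add: dvd_field_iff)


section \<open>Exterior algebras of based free modules\<close>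

text \<open>
  For a finite set \<open>G\<close> of linearly ordered generators, an element of
  \<open>\<Lambda>\<^sup>* R\<langle>v\<^sub>g | g \<in> G\<rangle>\<close> is given by its coefficients with respect to the basis
  \<open>v\<^sub>S = v\<^bsub>g1\<^esub> \<and> \<dots> \<and> v\<^bsub>gk\<^esub>\<close>, where \<open>S = {g1 < \<dots> < gk} \<subseteq> G\<close>.
\<close>

type_synonym ('g, 'r) ext = "'g set \<Rightarrow> 'r"

definition ext_alg :: "'g set \<Rightarrow> ('g, 'r::zero) ext set" where
  "ext_alg G = {\<omega>. \<forall>S. \<omega> S \<noteq> 0 \<longrightarrow> S \<subseteq> G}"

definition ext_basis :: "'g set \<Rightarrow> ('g, 'r::comm_ring_1) ext" where
  "ext_basis S = (\<lambda>T. if T = S then 1 else 0)"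

abbreviation ext_gen :: "'g \<Rightarrow> ('g, 'r::comm_ring_1) ext" where
  "ext_gen g \<equiv> ext_basis {g}"

text \<open>For disjoint \<open>S\<close>, \<open>T\<close> one has \<open>v\<^sub>S \<and> v\<^sub>T = shuffle_sign S T \<cdot> v\<^bsub>S \<union> T\<^esub>\<close>.\<close>

definition shuffle_sign :: "'g::linorder set \<Rightarrow> 'g set \<Rightarrow> 'r::comm_ring_1" where
  "shuffle_sign S T = (- 1) ^ card {(s, t). s \<in> S \<and> t \<in> T \<and> t < s}"

definition wedge :: "('g::linorder, 'r::comm_ring_1) ext \<Rightarrow> ('g, 'r) ext \<Rightarrow> ('g, 'r) ext"
    (infixr "\<and>\<^sub>e" 70) where
  "(\<omega> \<and>\<^sub>e \<eta>) = (\<lambda>U. \<Sum>S\<in>Pow U. shuffle_sign S (U - S) * \<omega> S * \<eta> (U - S))"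

definition wedge_list :: "'g::linorder list \<Rightarrow> ('g, 'r::comm_ring_1) ext" where
  "wedge_list gs = foldr (\<lambda>g \<omega>. ext_gen g \<and>\<^sub>e \<omega>) gs (ext_basis {})"

text \<open>The algebra homomorphism on \<open>\<Lambda>\<^sup>* R\<langle>v\<^sub>g | g \<in> G\<rangle>\<close> with \<open>v\<^sub>g \<mapsto> v\<^bsub>f g\<^esub>\<close>.\<close>

definition ext_map :: "'g::linorder set \<Rightarrow> ('g \<Rightarrow> 'g) \<Rightarrow> ('g, 'r::comm_ring_1) ext \<Rightarrow> ('g, 'r) ext" where
  "ext_map G f \<omega> = (\<lambda>U. \<Sum>S\<in>Pow G. \<omega> S * wedge_list (map f (sorted_list_of_set S)) U)"


section \<open>Braid diagrams and their resolutions\<close>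

text \<open>
  \<open>PosGen i\<close> is \<open>\<sigma>\<^sub>i\<close> (a positive crossing between strands \<open>i\<close> and \<open>i + 1\<close>), \<open>NegGen i\<close> its
  inverse (a negative crossing). The diagram of a word \<open>w\<close> on \<open>b\<close> strands is the closed braid,
  drawn as follows: the strands are numbered \<open>1, \<dots>, b\<close> from left to right and run upwards;
  the letters \<open>w ! 0, w ! 1, \<dots>\<close> are placed from bottom to top; the closing strands go around
  an axis to the left of the braid, so that horizontal rays to the right starting between the
  bottom and the top of the braid do not meet them. Crossings are named by their position in
  \<open>w\<close>.
\<close>

datatype braid_gen = PosGen (strand: nat) | NegGen (strand: nat)

type_synonym braid_word = "braid_gen list"

definition is_braid_word :: "nat \<Rightarrow> braid_word \<Rightarrow> bool" where
  "is_braid_word b w \<longleftrightarrow> 1 \<le> b \<and> (\<forall>g\<in>set w. 1 \<le> strand g \<and> strand g < b)"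

abbreviation crossings :: "braid_word \<Rightarrow> nat set" where
  "crossings w \<equiv> {..<length w}"

abbreviation positive :: "braid_word \<Rightarrow> nat \<Rightarrow> bool" where
  "positive w x \<equiv> is_PosGen (w ! x)"

text \<open>
  \<open>(t, j)\<close> is the vertical segment of strand \<open>j\<close> at height \<open>t\<close>; crossing \<open>x\<close> lies between the
  heights \<open>x\<close> and \<open>x + 1\<close>, and the closing strands join \<open>(length w, j)\<close> to \<open>(0, j)\<close>.
\<close>

type_synonym segment = "nat \<times> nat"

definition segments :: "nat \<Rightarrow> braid_word \<Rightarrow> segment set" where
  "segments b w = {0..length w} \<times> {1..b}"

text \<open>
  A vertex \<open>\<alpha>\<close> of the cube is represented by the set of crossings with \<open>\<alpha> x = 1\<close>.
  The smoothing of a crossing of an upward oriented braid that respects the orientation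
  consists of two vertical arcs, the other one of a cap and a cup.
\<close>

type_synonym vertex = "nat set"

definition vertical :: "braid_word \<Rightarrow> vertex \<Rightarrow> nat \<Rightarrow> bool" where
  "vertical w \<alpha> x \<longleftrightarrow> (positive w x \<longleftrightarrow> x \<notin> \<alpha>)"

definition at_crossing :: "braid_word \<Rightarrow> nat \<Rightarrow> nat \<Rightarrow> bool" where
  "at_crossing w x j \<longleftrightarrow> j = strand (w ! x) \<or> j = Suc (strand (w ! x))"

definition other_strand :: "braid_word \<Rightarrow> nat \<Rightarrow> nat \<Rightarrow> nat" where
  "other_strand w x j = (if j = strand (w ! x) then Suc j else strand (w ! x))"

text \<open>The segments to which the upper and the lower end of a segment are joined.\<close>

fun above :: "braid_word \<Rightarrow> vertex \<Rightarrow> segment \<Rightarrow> segment" where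
  "above w \<alpha> (t, j) =
     (if t = length w then (0, j)
      else if at_crossing w t j \<and> \<not> vertical w \<alpha> t then (t, other_strand w t j)
      else (Suc t, j))"

fun below :: "braid_word \<Rightarrow> vertex \<Rightarrow> segment \<Rightarrow> segment" where
  "below w \<alpha> (t, j) =
     (if t = 0 then (length w, j)
      else if at_crossing w (t - 1) j \<and> \<not> vertical w \<alpha> (t - 1) then (t, other_strand w (t - 1) j)
      else (t - 1, j))"

definition joined :: "nat \<Rightarrow> braid_word \<Rightarrow> vertex \<Rightarrow> (segment \<times> segment) set" where
  "joined b w \<alpha> = {(s, s'). s \<in> segments b w \<and> (s' = above w \<alpha> s \<or> s' = below w \<alpha> s)}"

definition circle :: "nat \<Rightarrow> braid_word \<Rightarrow> vertex \<Rightarrow> segment \<Rightarrow> segment set" where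
  "circle b w \<alpha> s = {s'. (s, s') \<in> (joined b w \<alpha>)\<^sup>*}"

text \<open>
  The circles are labelled, and thereby linearly ordered, by their least segment with respect to
  the lexicographic order: \<open>gen b w \<alpha> s\<close> labels the generator of \<open>V\<^sub>\<alpha>\<close> corresponding to the circle
  through \<open>s\<close>.
\<close>

definition gen :: "nat \<Rightarrow> braid_word \<Rightarrow> vertex \<Rightarrow> segment \<Rightarrow> segment" where
  "gen b w \<alpha> s = Min (circle b w \<alpha> s)"

definition gens :: "nat \<Rightarrow> braid_word \<Rightarrow> vertex \<Rightarrow> segment set" where
  "gens b w \<alpha> = gen b w \<alpha> ` segments b w"


section \<open>Arrows\<close>

text \<open>
  A direction names the direction in which an arrow points and also the position of an arc
  relative to its crossing: the vertical smoothing has arcs \<open>West\<close> and \<open>East\<close>, the other one has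
  arcs \<open>South\<close> (the cap below) and \<open>North\<close> (the cup above). The arrow of direction \<open>d\<close> goes from
  the arc \<open>opposite d\<close> to the arc \<open>d\<close>.
\<close>

datatype direction = North | East | South | West

fun clockwise :: "direction \<Rightarrow> direction" where
  "clockwise North = East"
| "clockwise East = South"
| "clockwise South = West"
| "clockwise West = North"

definition opposite :: "direction \<Rightarrow> direction" where
  "opposite d = clockwise (clockwise d)"

text \<open>\<open>A x\<close> is the direction of the arrow joining the two arcs of the 0-smoothing of \<open>x\<close>.\<close>

definition arrow_choice :: "braid_word \<Rightarrow> (nat \<Rightarrow> direction) \<Rightarrow> bool" where
  "arrow_choice w A \<longleftrightarrow>
     (\<forall>x\<in>crossings w. A x \<in> (if positive w x then {East, West} else {North, South}))"

text \<open>
  An arc of a smoothing of a crossing \<open>x\<close> consists of two segment ends; the ends of a segment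
  \<open>s\<close> are \<open>(s, True)\<close> (upper end) and \<open>(s, False)\<close> (lower end).
\<close>

fun arc :: "braid_word \<Rightarrow> nat \<Rightarrow> direction \<Rightarrow> (segment \<times> bool) set" where
  "arc w x West = {((x, strand (w ! x)), True), ((Suc x, strand (w ! x)), False)}"
| "arc w x East = {((x, Suc (strand (w ! x))), True), ((Suc x, Suc (strand (w ! x))), False)}"
| "arc w x South = {((x, strand (w ! x)), True), ((x, Suc (strand (w ! x))), True)}"
| "arc w x North = {((Suc x, strand (w ! x)), False), ((Suc x, Suc (strand (w ! x))), False)}"

text \<open>The generator of the circle of \<open>\<alpha>\<close> containing the given arc of the smoothing of \<open>x\<close>.\<close>

definition arc_gen :: "nat \<Rightarrow> braid_word \<Rightarrow> vertex \<Rightarrow> nat \<Rightarrow> direction \<Rightarrow> segment" where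
  "arc_gen b w \<alpha> x d = (THE g. \<forall>(s, e)\<in>arc w x d. gen b w \<alpha> s = g)"


section \<open>Edge maps\<close>

text \<open>
  The map \<open>F\<^sub>e\<close> of the edge \<open>e\<close> from \<open>\<alpha>\<close> to \<open>insert x \<alpha>\<close>. A label in \<open>gens b w \<alpha>\<close> is itself a
  segment of its circle, so on circles not meeting the crossing, and on the two circles of a
  merge, \<open>gen b w (insert x \<alpha>)\<close> sends the label of the old circle to the label of the new one.
\<close>

definition edge_map :: "nat \<Rightarrow> braid_word \<Rightarrow> (nat \<Rightarrow> direction) \<Rightarrow> vertex \<Rightarrow> nat
    \<Rightarrow> (segment, 'r::comm_ring_1) ext \<Rightarrow> (segment, 'r) ext" where
  "edge_map b w A \<alpha> x \<omega> =
     (let \<beta> = insert x \<alpha>;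
          a = arc_gen b w \<alpha> x (opposite (A x));
          a' = arc_gen b w \<alpha> x (A x);
          d = clockwise (A x);
          a\<^sub>0 = arc_gen b w \<beta> x (opposite d);
          a\<^sub>1 = arc_gen b w \<beta> x d
      in if a \<noteq> a'
         then ext_map (gens b w \<alpha>) (gen b w \<beta>) \<omega>
         else (ext_gen a\<^sub>0 - ext_gen a\<^sub>1) \<and>\<^sub>e ext_map (gens b w \<alpha>) ((gen b w \<beta>)(a := a\<^sub>0)) \<omega>)"


section \<open>Types of faces\<close>

text \<open>
  Counterclockwise orientation of a circle of a resolution. By the even-odd rule, the point just
  to the left of a segment \<open>(t, j)\<close> of a circle lies inside the circle iff the ray to the right
  meets the circle in an odd number of points, i.e. in an even number of points beyond \<open>(t, j)\<close>.
  In this case the interior is to the left of \<open>(t, j)\<close> and the counterclockwise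
  orientation runs upwards along \<open>(t, j)\<close>; otherwise it runs downwards.
\<close>

fun ccw_up :: "nat \<Rightarrow> braid_word \<Rightarrow> vertex \<Rightarrow> segment \<Rightarrow> bool" where
  "ccw_up b w \<alpha> (t, j) = even (card {j'. j < j' \<and> j' \<le> b \<and> (t, j') \<in> circle b w \<alpha> (t, j)})"

definition ccw_next :: "nat \<Rightarrow> braid_word \<Rightarrow> vertex \<Rightarrow> segment \<Rightarrow> segment" where
  "ccw_next b w \<alpha> s = (if ccw_up b w \<alpha> s then above w \<alpha> s else below w \<alpha> s)"

text \<open>
  The position of an arc on its circle is recorded by the segment from which the
  counterclockwise traversal enters the arc, i.e. which it leaves through the end lying on the
  arc.
\<close>

definition arc_pos :: "nat \<Rightarrow> braid_word \<Rightarrow> vertex \<Rightarrow> nat \<Rightarrow> direction \<Rightarrow> segment" where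
  "arc_pos b w \<alpha> x d = (THE s. (s, ccw_up b w \<alpha> s) \<in> arc w x d)"

text \<open>
  The arrow at a crossing \<open>x\<close> (in its 0-smoothing) lies inside the circle through its tail:
  even-odd rule for the ray to the right starting at the middle of the arrow. The ray
  meets the \<open>East\<close> arc of a vertical smoothing, but passes between the cap and the cup of the
  other one; further to the right it meets the segments \<open>(x, j)\<close>.
\<close>

definition arrow_inside :: "nat \<Rightarrow> braid_word \<Rightarrow> (nat \<Rightarrow> direction) \<Rightarrow> vertex \<Rightarrow> nat \<Rightarrow> bool" where
  "arrow_inside b w A \<alpha> x \<longleftrightarrow>
     odd (card {j. (if vertical w \<alpha> x then strand (w ! x) < j else Suc (strand (w ! x)) < j)
                   \<and> j \<le> b \<and> (x, j) \<in> circle b w \<alpha> (arc_gen b w \<alpha> x (opposite (A x)))})"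

text \<open>
  Among the endpoints of the arrows at \<open>z\<close> and \<open>z'\<close>, the first one met when going
  counterclockwise from the tail of the arrow at \<open>z\<close> is the endpoint of the arrow at \<open>z'\<close> on
  the arc \<open>d\<close>.
\<close>

definition next_endpoint :: "nat \<Rightarrow> braid_word \<Rightarrow> (nat \<Rightarrow> direction) \<Rightarrow> vertex \<Rightarrow> nat \<Rightarrow> nat
    \<Rightarrow> direction \<Rightarrow> bool" where
  "next_endpoint b w A \<alpha> z z' d \<longleftrightarrow>
     (let start = arc_pos b w \<alpha> z (opposite (A z));
          ends = {arc_pos b w \<alpha> y e | y e. y \<in> {z, z'} \<and> e \<in> {A y, opposite (A y)}}
      in \<exists>k>0. (ccw_next b w \<alpha> ^^ k) start = arc_pos b w \<alpha> z' d
             \<and> (\<forall>m. 0 < m \<and> m < k \<longrightarrow> (ccw_next b w \<alpha> ^^ m) start \<notin> ends))"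

definition is_face :: "braid_word \<Rightarrow> vertex \<Rightarrow> nat \<Rightarrow> nat \<Rightarrow> bool" where
  "is_face w \<alpha> x y \<longleftrightarrow>
     \<alpha> \<subseteq> crossings w \<and> x \<in> crossings w - \<alpha> \<and> y \<in> crossings w - \<alpha> \<and> x \<noteq> y"

text \<open>The composition along the face spanned by \<open>x\<close> and \<open>y\<close>, first \<open>x\<close> and then \<open>y\<close>, over \<open>\<int>\<close>.\<close>

definition face_comp :: "nat \<Rightarrow> braid_word \<Rightarrow> (nat \<Rightarrow> direction) \<Rightarrow> vertex \<Rightarrow> nat \<Rightarrow> nat
    \<Rightarrow> (segment, int) ext \<Rightarrow> (segment, int) ext" where
  "face_comp b w A \<alpha> x y \<omega> = edge_map b w A (insert x \<alpha>) y (edge_map b w A \<alpha> x \<omega>)"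

definition comp_vanishes :: "nat \<Rightarrow> braid_word \<Rightarrow> (nat \<Rightarrow> direction) \<Rightarrow> vertex \<Rightarrow> nat \<Rightarrow> nat
    \<Rightarrow> bool" where
  "comp_vanishes b w A \<alpha> x y \<longleftrightarrow> (\<forall>\<omega>\<in>ext_alg (gens b w \<alpha>). face_comp b w A \<alpha> x y \<omega> = 0)"

definition type_A :: "nat \<Rightarrow> braid_word \<Rightarrow> (nat \<Rightarrow> direction) \<Rightarrow> vertex \<Rightarrow> nat \<Rightarrow> nat \<Rightarrow> bool" where
  "type_A b w A \<alpha> x y \<longleftrightarrow> \<not> comp_vanishes b w A \<alpha> x y \<and> \<not> comp_vanishes b w A \<alpha> y x \<and>
     (\<forall>\<omega>\<in>ext_alg (gens b w \<alpha>). face_comp b w A \<alpha> x y \<omega> = - face_comp b w A \<alpha> y x \<omega>)"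

definition type_C :: "nat \<Rightarrow> braid_word \<Rightarrow> (nat \<Rightarrow> direction) \<Rightarrow> vertex \<Rightarrow> nat \<Rightarrow> nat \<Rightarrow> bool" where
  "type_C b w A \<alpha> x y \<longleftrightarrow> \<not> comp_vanishes b w A \<alpha> x y \<and> \<not> comp_vanishes b w A \<alpha> y x \<and>
     (\<forall>\<omega>\<in>ext_alg (gens b w \<alpha>). face_comp b w A \<alpha> x y \<omega> = face_comp b w A \<alpha> y x \<omega>)"

definition type_X :: "nat \<Rightarrow> braid_word \<Rightarrow> (nat \<Rightarrow> direction) \<Rightarrow> vertex \<Rightarrow> nat \<Rightarrow> nat \<Rightarrow> bool" where
  "type_X b w A \<alpha> x y \<longleftrightarrow> comp_vanishes b w A \<alpha> x y \<and> comp_vanishes b w A \<alpha> y x \<and>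
     (\<exists>(z, z') \<in> {(x, y), (y, x)}. arrow_inside b w A \<alpha> z \<and> \<not> arrow_inside b w A \<alpha> z' \<and>
        next_endpoint b w A \<alpha> z z' (opposite (A z')))"

definition type_Y :: "nat \<Rightarrow> braid_word \<Rightarrow> (nat \<Rightarrow> direction) \<Rightarrow> vertex \<Rightarrow> nat \<Rightarrow> nat \<Rightarrow> bool" where
  "type_Y b w A \<alpha> x y \<longleftrightarrow> comp_vanishes b w A \<alpha> x y \<and> comp_vanishes b w A \<alpha> y x \<and>
     (\<exists>(z, z') \<in> {(x, y), (y, x)}. arrow_inside b w A \<alpha> z \<and> \<not> arrow_inside b w A \<alpha> z' \<and>
        next_endpoint b w A \<alpha> z z' (A z'))"

text \<open>The pair \<open>(\<alpha>, x)\<close> with \<open>x \<notin> \<alpha>\<close> represents the edge from \<open>\<alpha>\<close> to \<open>insert x \<alpha>\<close>.\<close>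

definition face_edges :: "vertex \<Rightarrow> nat \<Rightarrow> nat \<Rightarrow> (vertex \<times> nat) set" where
  "face_edges \<alpha> x y = {(\<alpha>, x), (\<alpha>, y), (insert x \<alpha>, y), (insert y \<alpha>, x)}"

definition sign_assignment :: "nat \<Rightarrow> braid_word \<Rightarrow> (nat \<Rightarrow> direction) \<Rightarrow> (vertex \<times> nat \<Rightarrow> int)
    \<Rightarrow> bool" where
  "sign_assignment b w A \<epsilon> \<longleftrightarrow>
     (\<forall>\<alpha> x. \<alpha> \<subseteq> crossings w \<and> x \<in> crossings w - \<alpha> \<longrightarrow> \<epsilon> (\<alpha>, x) \<in> {1, - 1}) \<and>
     (\<forall>\<alpha> x y. is_face w \<alpha> x y \<longrightarrow>
        (type_A b w A \<alpha> x y \<or> type_X b w A \<alpha> x y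
           \<longrightarrow> even (card {e \<in> face_edges \<alpha> x y. \<epsilon> e = - 1})) \<and>
        (type_C b w A \<alpha> x y \<or> type_Y b w A \<alpha> x y
           \<longrightarrow> odd (card {e \<in> face_edges \<alpha> x y. \<epsilon> e = - 1})))"


section \<open>The odd Khovanov complex and its homology\<close>

text \<open>
  A chain \<open>c\<close> has the component \<open>c \<alpha>\<close> in \<open>\<Lambda>\<^sup>* V\<^sub>\<alpha>\<close>. All the data below depend on the diagram, i.e. on
  \<open>b\<close> and \<open>w\<close>, the arrows \<open>A\<close> and the sign assignment \<open>\<epsilon>\<close>.
\<close>

type_synonym 'r chain = "vertex \<Rightarrow> (segment, 'r) ext"

definition chains :: "nat \<Rightarrow> braid_word \<Rightarrow> 'r::comm_ring_1 chain set" where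
  "chains b w = {c. \<forall>\<alpha>. c \<alpha> \<in> (if \<alpha> \<subseteq> crossings w then ext_alg (gens b w \<alpha>) else {0})}"

definition differential :: "nat \<Rightarrow> braid_word \<Rightarrow> (nat \<Rightarrow> direction) \<Rightarrow> (vertex \<times> nat \<Rightarrow> int)
    \<Rightarrow> 'r::comm_ring_1 chain \<Rightarrow> 'r chain" where
  "differential b w A \<epsilon> c = (\<lambda>\<beta> S.
     if \<beta> \<subseteq> crossings w
     then \<Sum>x\<in>\<beta>. of_int (\<epsilon> (\<beta> - {x}, x)) * edge_map b w A (\<beta> - {x}) x (c (\<beta> - {x})) S
     else 0)"

definition cycles :: "nat \<Rightarrow> braid_word \<Rightarrow> (nat \<Rightarrow> direction) \<Rightarrow> (vertex \<times> nat \<Rightarrow> int)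
    \<Rightarrow> 'r::comm_ring_1 chain monoid" where
  "cycles b w A \<epsilon> =
     \<lparr>carrier = {c \<in> chains b w. differential b w A \<epsilon> c = 0}, mult = (+), one = 0\<rparr>"

definition boundaries :: "nat \<Rightarrow> braid_word \<Rightarrow> (nat \<Rightarrow> direction) \<Rightarrow> (vertex \<times> nat \<Rightarrow> int)
    \<Rightarrow> 'r::comm_ring_1 chain set" where
  "boundaries b w A \<epsilon> = differential b w A \<epsilon> ` chains b w"

definition odd_Kh :: "nat \<Rightarrow> braid_word \<Rightarrow> (nat \<Rightarrow> direction) \<Rightarrow> (vertex \<times> nat \<Rightarrow> int)
    \<Rightarrow> 'r::comm_ring_1 chain set monoid" where
  "odd_Kh b w A \<epsilon> = cycles b w A \<epsilon> Mod boundaries b w A \<epsilon>"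

definition homology_class :: "nat \<Rightarrow> braid_word \<Rightarrow> (nat \<Rightarrow> direction) \<Rightarrow> (vertex \<times> nat \<Rightarrow> int)
    \<Rightarrow> 'r::comm_ring_1 chain \<Rightarrow> 'r chain set" where
  "homology_class b w A \<epsilon> c = boundaries b w A \<epsilon> #>\<^bsub>cycles b w A \<epsilon>\<^esub> c"

text \<open>The \<open>R\<close>-module structure of homology: \<open>r \<cdot> [c] = [r \<cdot> c]\<close>.\<close>

definition Kh_smult :: "nat \<Rightarrow> braid_word \<Rightarrow> (nat \<Rightarrow> direction) \<Rightarrow> (vertex \<times> nat \<Rightarrow> int)
    \<Rightarrow> 'r::comm_ring_1 \<Rightarrow> 'r chain set \<Rightarrow> 'r chain set" where
  "Kh_smult b w A \<epsilon> r X = (\<Union>c\<in>X. homology_class b w A \<epsilon> (\<lambda>\<alpha> S. r * c \<alpha> S))"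

definition Kh_module_hom :: "nat \<Rightarrow> braid_word \<Rightarrow> (nat \<Rightarrow> direction) \<Rightarrow> (vertex \<times> nat \<Rightarrow> int)
    \<Rightarrow> nat \<Rightarrow> braid_word \<Rightarrow> (nat \<Rightarrow> direction) \<Rightarrow> (vertex \<times> nat \<Rightarrow> int)
    \<Rightarrow> ('r::comm_ring_1 chain set \<Rightarrow> 'r chain set) \<Rightarrow> bool" where
  "Kh_module_hom b w A \<epsilon> b' w' A' \<epsilon>' p \<longleftrightarrow>
     p \<in> hom (odd_Kh b w A \<epsilon>) (odd_Kh b' w' A' \<epsilon>') \<and>
     (\<forall>r. \<forall>X\<in>carrier (odd_Kh b w A \<epsilon>).
        p (Kh_smult b w A \<epsilon> r X) = Kh_smult b' w' A' \<epsilon>' r (p X))"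


section \<open>The transverse class\<close>

text \<open>
  The resolution with the 0-smoothing at the positive and the 1-smoothing at the negative
  crossings; all its smoothings are vertical, and its \<open>j\<close>-th circle passes through \<open>(0, j)\<close>.
\<close>

definition braid_vertex :: "braid_word \<Rightarrow> vertex" where
  "braid_vertex w = {x \<in> crossings w. \<not> positive w x}"

definition psi_chain :: "nat \<Rightarrow> braid_word \<Rightarrow> 'r::comm_ring_1 chain" where
  "psi_chain b w =
     (\<lambda>\<alpha>. if \<alpha> = braid_vertex w
           then wedge_list (map (\<lambda>j. gen b w (braid_vertex w) (0, j)) [1..<Suc b])
           else 0)"

definition psi :: "nat \<Rightarrow> braid_word \<Rightarrow> (nat \<Rightarrow> direction) \<Rightarrow> (vertex \<times> nat \<Rightarrow> int)
    \<Rightarrow> 'r::comm_ring_1 chain set" where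
  "psi b w A \<epsilon> = homology_class b w A \<epsilon> (psi_chain b w)"

end

theory Submission
  imports Defs "HOL-Combinatorics.Permutations"
begin

text \<open>
  The vertices of the cube of the first diagram at which the chosen positive crossing is 0-smoothed
  span a quotient complex, whose resolutions are those of the second diagram, so projecting and
  relabelling the circles is a chain map up to signs. To correct the signs, one shows that every
  face of the cube is of type A, C, X or Y and that reversing an arrow changes the type of a face
  exactly as it changes the product of the signs of its edge maps. The quotient of the two sign
  assignments, multiplied by the signs of the reversed edge maps, is then a 1-cocycle on the cube,
  hence a coboundary, and multiplying by a 0-cochain gives a chain map; normalizing the cochain at
  the braid-like resolution makes it send \<open>\<psi>\<close> to \<open>\<psi>\<close>.
\<close>

text \<open>The arrows and the sign assignments of the two diagrams are given independently of each
  other, so the restriction of one sign assignment to the smaller cube has to be compared with an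
  arbitrary one. For a face with nonzero composites the required parity can be read off from the
  edge maps. For the faces of type X and Y both composites vanish, and the parity is decided by
  planar geometry: which arrow lies inside the circle and in which cyclic order the ends occur. This
  is the obstacle. It is met by a criterion for the parity of a face that refers only to which
  segments share a circle, to parities of points on horizontal rays and to orientations. All of
  these survive the identification of the two heights adjacent to the deleted crossing, and their
  dependence on an arrow can be computed. The projection itself is harmless: edges of the cube only
  raise coordinates, so a vertex with the crossing 0-smoothed receives nothing from a vertex with
  the crossing 1-smoothed, and the braid-like resolution survives because the crossing is
  positive.\<close>

section \<open>Exterior multiplication by generators\<close>

text \<open>In the sum defining the product only the summand \<open>S = {g}\<close> survives, and
  its shuffle sign counts the elements of \<open>U\<close> below \<open>g\<close>. The finiteness
  condition reflects that a sum over the infinite set \<open>Pow U\<close> is 0 by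
  convention.\<close>

lemma ext_gen_wedge_apply:
  fixes \<omega> :: "('g::linorder, 'r::comm_ring_1) ext"
  shows "(ext_gen g \<and>\<^sub>e \<omega>) U =
     (if finite U \<and> g \<in> U then (- 1) ^ card {t \<in> U. t < g} * \<omega> (U - {g}) else 0)"
proof (cases "finite U")
  case False
  then show ?thesis
    by (simp add: wedge_def sum.infinite)
next
  case True
  have "(ext_gen g \<and>\<^sub>e \<omega>) U =
      (\<Sum>S\<in>Pow U. if S = {g} then shuffle_sign S (U - S) * \<omega> (U - S) else 0)"
    unfolding wedge_def ext_basis_def by (intro sum.cong) auto
  also have "\<dots> = (if g \<in> U then shuffle_sign {g} (U - {g}) * \<omega> (U - {g}) else 0)"
    using True by (simp add: sum.delta')
  also have "{(s, t). s \<in> {g} \<and> t \<in> U - {g} \<and> t < s} = Pair g ` {t \<in> U. t < g}"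
    by auto
  then have "shuffle_sign {g} (U - {g}) = ((- 1) ^ card {t \<in> U. t < g} :: 'r)"
    unfolding shuffle_sign_def by (simp add: card_image inj_on_def)
  finally show ?thesis
    using True by simp
qed

text \<open>For \<open>g < h\<close>, taking \<open>g\<close> out of \<open>U\<close> first lowers
  the number of elements below \<open>h\<close> by one, while taking \<open>h\<close> out first
  leaves the number below \<open>g\<close> unchanged; this is the sign.\<close>

lemma gen_wedge_anticommute:
  fixes \<omega> :: "('g::linorder, 'r::comm_ring_1) ext"
  shows "(ext_gen g \<and>\<^sub>e ext_gen h \<and>\<^sub>e \<omega>) = - (ext_gen h \<and>\<^sub>e ext_gen g \<and>\<^sub>e \<omega>)"
proof (rule ext)
  have aux: "(ext_gen g \<and>\<^sub>e ext_gen h \<and>\<^sub>e \<omega>) U = - (ext_gen h \<and>\<^sub>e ext_gen g \<and>\<^sub>e \<omega>) U"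
    if gh: "g < h" and U: "finite U" "g \<in> U" "h \<in> U" for g h U
  proof -
    have "{t \<in> U. t < h} = insert g {t \<in> U - {g}. t < h}"
      using gh U by auto
    then have "card {t \<in> U. t < h} = Suc (card {t \<in> U - {g}. t < h})"
      using U by simp
    moreover have "{t \<in> U - {h}. t < g} = {t \<in> U. t < g}"
      using gh by auto
    moreover have "U - {g} - {h} = U - {h} - {g}"
      by auto
    ultimately show ?thesis
      using gh U by (simp add: ext_gen_wedge_apply)
  qed
  show "(ext_gen g \<and>\<^sub>e ext_gen h \<and>\<^sub>e \<omega>) U = (- (ext_gen h \<and>\<^sub>e ext_gen g \<and>\<^sub>e \<omega>)) U" for U
  proof (cases "finite U \<and> g \<in> U \<and> h \<in> U \<and> g \<noteq> h")
    case True
    then show ?thesis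
      using aux[of g h U] aux[of h g U] by (cases g h rule: linorder_cases) auto
  next
    case False
    then show ?thesis
      by (auto simp: ext_gen_wedge_apply)
  qed
qed

lemma gen_wedge_self: "(ext_gen g \<and>\<^sub>e ext_gen g \<and>\<^sub>e \<omega>) = 0"
  by (rule ext) (simp add: ext_gen_wedge_apply)

lemma wedge_zero_right [simp]: "(\<eta> \<and>\<^sub>e 0) = 0"
  by (rule ext) (simp add: wedge_def)

lemma wedge_add_right: "(\<zeta> \<and>\<^sub>e (\<omega> + \<eta>)) = (\<zeta> \<and>\<^sub>e \<omega>) + (\<zeta> \<and>\<^sub>e \<eta>)"
  by (rule ext) (simp add: wedge_def sum.distrib algebra_simps)

lemma wedge_minus_right: "(\<zeta> \<and>\<^sub>e (- \<omega>)) = - (\<zeta> \<and>\<^sub>e \<omega>)"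
  by (rule ext) (simp add: wedge_def sum_negf)

lemma wedge_diff_right: "(\<zeta> \<and>\<^sub>e (\<omega> - \<eta>)) = (\<zeta> \<and>\<^sub>e \<omega>) - (\<zeta> \<and>\<^sub>e \<eta>)"
  by (rule ext) (simp add: wedge_def sum_subtractf algebra_simps)

lemma wedge_diff_left: "((\<omega> - \<eta>) \<and>\<^sub>e \<zeta>) = (\<omega> \<and>\<^sub>e \<zeta>) - (\<eta> \<and>\<^sub>e \<zeta>)"
  by (rule ext) (simp add: wedge_def sum_subtractf algebra_simps)

lemma wedge_scale_right: "(\<zeta> \<and>\<^sub>e (\<lambda>U. r * \<omega> U)) = (\<lambda>U. r * (\<zeta> \<and>\<^sub>e \<omega>) U)"
  by (rule ext) (simp add: wedge_def sum_distrib_left mult.left_commute)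

lemma wedge_sum_right: "(\<zeta> \<and>\<^sub>e (\<lambda>U. \<Sum>i\<in>I. \<omega> i U)) = (\<lambda>U. \<Sum>i\<in>I. (\<zeta> \<and>\<^sub>e \<omega> i) U)"
proof (induction I rule: infinite_finite_induct)
  case (insert i I)
  have eq: "(\<lambda>U. \<Sum>i\<in>insert i I. \<omega> i U) = \<omega> i + (\<lambda>U. \<Sum>i\<in>I. \<omega> i U)"
    using insert by (simp add: fun_eq_iff)
  show ?case
    using insert unfolding eq wedge_add_right by (simp add: fun_eq_iff)
qed (auto simp flip: zero_fun_def)

lemma wedge_list_Nil [simp]: "wedge_list [] = ext_basis {}"
  by (simp add: wedge_list_def)

lemma wedge_list_Cons [simp]: "wedge_list (g # gs) = (ext_gen g \<and>\<^sub>e wedge_list gs)"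
  by (simp add: wedge_list_def)

lemma gen_wedge_list_mem: "g \<in> set gs \<Longrightarrow> (ext_gen g \<and>\<^sub>e wedge_list gs) = 0"
proof (induction gs)
  case (Cons h gs)
  show ?case
  proof (cases "g = h")
    case False
    then show ?thesis
      using Cons gen_wedge_anticommute[of g h "wedge_list gs"]
      by (metis minus_zero set_ConsD wedge_list_Cons wedge_zero_right)
  qed (simp add: gen_wedge_self)
qed simp

text \<open>Moving \<open>f g\<close> to its place costs one sign for each smaller argument passed.
  As \<open>f\<close> is arbitrary, the images may be unsorted or repeated; only the arguments are
  sorted.\<close>

lemma wedge_list_insort:
  fixes f :: "'g::linorder \<Rightarrow> 'h::linorder"
  assumes "sorted l" "g \<notin> set l"
  shows "(wedge_list (map f (insort g l)) :: ('h, 'r::comm_ring_1) ext) =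
    (\<lambda>U. (- 1) ^ card {t \<in> set l. t < g} * (ext_gen (f g) \<and>\<^sub>e wedge_list (map f l)) U)"
  using assms
proof (induction l)
  case (Cons h l)
  show ?case
  proof (cases "g < h")
    case True
    then have "{t \<in> set (h # l). t < g} = {}"
      using Cons.prems by auto
    then show ?thesis
      using True by (simp only:) (simp add: less_imp_le)
  next
    case False
    then have gh: "h < g" "\<not> g \<le> h"
      using Cons.prems by auto
    show ?thesis
    proof (cases "h \<in> set l")
      \<comment> \<open>A repeated entry is passed more than once but counted once by
        \<open>card\<close>; here both sides are 0.\<close>
      case True
      then have z: "(ext_gen (f h) \<and>\<^sub>e wedge_list (map f l)) = (0 :: ('h, 'r) ext)"
          "(ext_gen (f h) \<and>\<^sub>e wedge_list (map f (insort g l))) = (0 :: ('h, 'r) ext)"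
        by (auto intro!: gen_wedge_list_mem simp: set_insort_key)
      then show ?thesis
        by (intro ext) (simp add: gh z wedge_zero_right[unfolded zero_fun_def])
    next
      case False
      have "{t \<in> set (h # l). t < g} = insert h {t \<in> set l. t < g}"
        using gh by auto
      then have "card {t \<in> set (h # l). t < g} = Suc (card {t \<in> set l. t < g})"
        using False by simp
      moreover have "wedge_list (map f (insort g l)) = (\<lambda>U. (- 1) ^ card {t \<in> set l. t < g} *
          (ext_gen (f g) \<and>\<^sub>e wedge_list (map f l)) U :: 'r)"
        using Cons by simp
      ultimately show ?thesis
        using gh
        by (intro ext) (simp add: wedge_scale_right gen_wedge_anticommute[of "f h" "f g"])
    qed
  qed
qed simp

section \<open>Algebra maps induced by maps of generators\<close>

text \<open>Split \<open>Pow G\<close> according to whether a set contains \<open>g\<close>. On the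
  left only the sets containing \<open>g\<close> contribute, and the sign of the coefficient cancels
  the sign of sorting \<open>g\<close> into place; on the right these sets drop out because
  \<open>f g\<close> would occur twice.\<close>

lemma ext_map_gen_wedge:
  fixes \<omega> :: "('g::linorder, 'r::comm_ring_1) ext"
  assumes G: "finite G" and g: "g \<in> G"
  shows "ext_map G f (ext_gen g \<and>\<^sub>e \<omega>) = (ext_gen (f g) \<and>\<^sub>e ext_map G f \<omega>)"
proof (rule ext)
  fix U
  define m where "m S = (wedge_list (map f (sorted_list_of_set S)) :: ('g, 'r) ext)" for S
  have fin: "finite S" if "S \<in> Pow G" for S
    using that G finite_subset by auto
  have ins: "(- 1) ^ card {t \<in> insert g T. t < g} * m (insert g T) U = (ext_gen (f g) \<and>\<^sub>e m T) U"
    if "T \<in> Pow (G - {g})" for T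
  proof -
    have T: "finite T" "g \<notin> T"
      using that G finite_subset by auto
    have "{t \<in> insert g T. t < g} = {t \<in> T. t < g}"
      by auto
    then show ?thesis
      using T by (simp add: m_def wedge_list_insort)
  qed
  have PG: "Pow G = Pow (G - {g}) \<union> insert g ` Pow (G - {g})"
    using g Pow_insert[of g "G - {g}"] by (simp add: insert_absorb)
  have dis: "Pow (G - {g}) \<inter> insert g ` Pow (G - {g}) = {}"
    by auto
  have inj: "inj_on (insert g) (Pow (G - {g}))"
    by (auto simp: inj_on_def)
  have sum_split: "(\<Sum>S\<in>Pow G. k S) = (\<Sum>T\<in>Pow (G - {g}). k T) + (\<Sum>T\<in>Pow (G - {g}). k (insert g T))"
    for k :: "'g set \<Rightarrow> 'r"
    unfolding PG using G dis inj by (subst sum.union_disjoint) (auto simp: sum.reindex)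
  have "ext_map G f (ext_gen g \<and>\<^sub>e \<omega>) U = (\<Sum>S\<in>Pow G. (ext_gen g \<and>\<^sub>e \<omega>) S * m S U)"
    by (simp add: ext_map_def m_def)
  also have "\<dots> = (\<Sum>T\<in>Pow (G - {g}). (ext_gen g \<and>\<^sub>e \<omega>) (insert g T) * m (insert g T) U)"
    unfolding sum_split by (auto intro!: sum.neutral simp: ext_gen_wedge_apply)
  also have "\<dots> = (\<Sum>T\<in>Pow (G - {g}). \<omega> T * (ext_gen (f g) \<and>\<^sub>e m T) U)"
  proof (intro sum.cong refl)
    fix T assume T: "T \<in> Pow (G - {g})"
    then have "T - {g} = T" by auto
    with T have "(ext_gen g \<and>\<^sub>e \<omega>) (insert g T) * m (insert g T) U =
        \<omega> T * ((- 1) ^ card {t \<in> insert g T. t < g} * m (insert g T) U)"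
      using T fin[of T] by (subst ext_gen_wedge_apply) auto
    also have "\<dots> = \<omega> T * (ext_gen (f g) \<and>\<^sub>e m T) U"
      by (simp only: ins[OF T])
    finally show "(ext_gen g \<and>\<^sub>e \<omega>) (insert g T) * m (insert g T) U =
        \<omega> T * (ext_gen (f g) \<and>\<^sub>e m T) U" .
  qed
  also have "\<dots> = (\<Sum>S\<in>Pow G. \<omega> S * (ext_gen (f g) \<and>\<^sub>e m S) U)"
  proof -
    have "(ext_gen (f g) \<and>\<^sub>e m (insert g T)) = 0" if "T \<in> Pow (G - {g})" for T
    proof -
      have "finite (insert g T)"
        using that G by (auto intro: finite_subset)
      then show ?thesis
        unfolding m_def by (intro gen_wedge_list_mem) (simp only: set_map set_sorted_list_of_set, blast)
    qed
    then show ?thesis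
      unfolding sum_split by simp
  qed
  also have "\<dots> = (ext_gen (f g) \<and>\<^sub>e ext_map G f \<omega>) U"
    unfolding ext_map_def wedge_sum_right wedge_scale_right m_def ..
  finally show "ext_map G f (ext_gen g \<and>\<^sub>e \<omega>) U = (ext_gen (f g) \<and>\<^sub>e ext_map G f \<omega>) U" .
qed

lemma ext_map_add: "ext_map G f (\<omega> + \<eta>) = ext_map G f \<omega> + ext_map G f \<eta>"
  by (rule ext) (simp add: ext_map_def sum.distrib algebra_simps)

lemma ext_map_diff: "ext_map G f (\<omega> - \<eta>) = ext_map G f \<omega> - ext_map G f \<eta>"
  by (rule ext) (simp add: ext_map_def sum_subtractf algebra_simps)

lemma ext_map_scale: "ext_map G f (\<lambda>U. r * \<omega> U) = (\<lambda>U. r * ext_map G f \<omega> U)"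
  by (rule ext) (simp add: ext_map_def sum_distrib_left mult.assoc)

lemma ext_map_one:
  assumes "finite G"
  shows "ext_map G f (ext_basis {}) = ext_basis {}"
proof (rule ext)
  fix U
  have "ext_map G f (ext_basis {}) U = (\<Sum>S\<in>Pow G. if S = {} then ext_basis {} U else 0)"
    by (auto simp: ext_map_def ext_basis_def intro!: sum.cong)
  then show "ext_map G f (ext_basis {}) U = ext_basis {} U"
    using assms by (simp add: sum.delta)
qed

lemma ext_map_wedge_list:
  "finite G \<Longrightarrow> set gs \<subseteq> G \<Longrightarrow> ext_map G f (wedge_list gs) = wedge_list (map f gs)"
  by (induction gs) (auto simp: ext_map_one ext_map_gen_wedge)

lemma ext_map_cong:
  assumes "finite G" "\<And>g. g \<in> G \<Longrightarrow> f g = f' g"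
  shows "ext_map G f \<omega> = ext_map G f' \<omega>"
proof -
  have "map f (sorted_list_of_set S) = map f' (sorted_list_of_set S)" if "S \<in> Pow G" for S
    using assms that rev_finite_subset[of G S] by auto
  then show ?thesis
    unfolding ext_map_def by (intro ext sum.cong refl) (simp only:)
qed

text \<open>After exchanging the two sums, the second map is applied to products
  \<open>wedge_list (map f ...)\<close>, on which it acts letter by letter even if the letters are
  unsorted or repeated.\<close>

lemma ext_map_comp:
  fixes \<omega> :: "('g::linorder, 'r::comm_ring_1) ext"
  assumes G: "finite G" and G': "finite G'" and f: "f ` G \<subseteq> G'"
  shows "ext_map G' f' (ext_map G f \<omega>) = ext_map G (f' \<circ> f) \<omega>"
proof (rule ext)
  fix U
  let ?m = "\<lambda>S. wedge_list (map f (sorted_list_of_set S)) :: ('g, 'r) ext"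
  have "ext_map G' f' (ext_map G f \<omega>) U =
      (\<Sum>T\<in>Pow G'. \<Sum>S\<in>Pow G. \<omega> S * ?m S T * wedge_list (map f' (sorted_list_of_set T)) U)"
    by (simp add: ext_map_def sum_distrib_right)
  also have "\<dots> = (\<Sum>S\<in>Pow G. \<omega> S * ext_map G' f' (?m S) U)"
    by (subst sum.swap) (simp add: ext_map_def sum_distrib_left mult.assoc)
  also have "\<dots> = ext_map G (f' \<circ> f) \<omega> U"
    unfolding ext_map_def[of G]
  proof (intro sum.cong refl)
    fix S assume S: "S \<in> Pow G"
    then have "set (sorted_list_of_set S) = S"
      using G rev_finite_subset[of G S] by simp
    then have "ext_map G' f' (?m S) = wedge_list (map f' (map f (sorted_list_of_set S)))"
      using S f by (intro ext_map_wedge_list[OF G']) auto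
    then show "\<omega> S * ext_map G' f' (?m S) U =
        \<omega> S * wedge_list (map (f' \<circ> f) (sorted_list_of_set S)) U"
      by simp
  qed
  finally show "ext_map G' f' (ext_map G f \<omega>) U = ext_map G (f' \<circ> f) \<omega> U" .
qed

section \<open>Multiplication by a difference of generators\<close>

definition gen_diff :: "'g::linorder \<Rightarrow> 'g \<Rightarrow> ('g, 'r::comm_ring_1) ext \<Rightarrow> ('g, 'r) ext" where
  "gen_diff u v \<omega> = (ext_gen u \<and>\<^sub>e \<omega>) - (ext_gen v \<and>\<^sub>e \<omega>)"

lemma gen_diff_anticommute: "gen_diff u v (ext_gen g \<and>\<^sub>e \<omega>) = - (ext_gen g \<and>\<^sub>e gen_diff u v \<omega>)"
  unfolding gen_diff_def
  using gen_wedge_anticommute[of u g \<omega>] gen_wedge_anticommute[of v g \<omega>]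
  by (simp add: wedge_diff_right)

text \<open>The difference of the generators \<open>u\<close> and \<open>v\<close> has square zero,
  so multiplication by it makes them interchangeable. This is the freedom in choosing which half of
  a split circle receives the old generator.\<close>

lemma gen_diff_identify: "gen_diff u v (ext_gen u \<and>\<^sub>e \<omega>) = gen_diff u v (ext_gen v \<and>\<^sub>e \<omega>)"
  unfolding gen_diff_def
  using gen_wedge_anticommute[of u v \<omega>] by (simp add: gen_wedge_self)

lemma gen_diff_linear:
  "gen_diff u v (\<lambda>U. r * \<omega> U) = (\<lambda>U. r * gen_diff u v \<omega> U)"
  "gen_diff u v (\<omega> + \<eta>) = gen_diff u v \<omega> + gen_diff u v \<eta>"
  "gen_diff u v (\<omega> - \<eta>) = gen_diff u v \<omega> - gen_diff u v \<eta>"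
  "gen_diff u v (- \<omega>) = - gen_diff u v \<omega>"
  by (simp_all add: gen_diff_def wedge_scale_right wedge_add_right wedge_diff_right wedge_minus_right
      fun_eq_iff algebra_simps)

lemma gen_diff_sum: "gen_diff u v (\<lambda>U. \<Sum>i\<in>I. \<omega> i U) = (\<lambda>U. \<Sum>i\<in>I. gen_diff u v (\<omega> i) U)"
  by (simp add: gen_diff_def wedge_sum_right sum_subtractf fun_eq_iff)

lemma gen_diff_same [simp]: "gen_diff u u \<omega> = 0"
  by (simp add: gen_diff_def)

lemma gen_diff_swap: "gen_diff u v \<omega> = - gen_diff v u \<omega>"
  by (simp add: gen_diff_def)

lemma gen_diff_gen_diff: "gen_diff u v (gen_diff u' v' \<omega>) = - gen_diff u' v' (gen_diff u v \<omega>)"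
  by (simp add: gen_diff_def[of u' v'] gen_diff_linear gen_diff_anticommute)

lemma ext_map_gen_diff:
  "finite G \<Longrightarrow> u \<in> G \<Longrightarrow> v \<in> G \<Longrightarrow>
   ext_map G f (gen_diff u v \<omega>) = gen_diff (f u) (f v) (ext_map G f \<omega>)"
  by (simp add: gen_diff_def ext_map_diff ext_map_gen_wedge)

text \<open>Serves two successive splittings: the second difference absorbs an ambiguity in the
  images of the two circles created by the first.\<close>

lemma gen_diff_cong:
  assumes "u' = u \<or> {u', u} \<subseteq> {a, c}" "v' = v \<or> {v', v} \<subseteq> {a, c}"
  shows "gen_diff a c (gen_diff u' v' \<omega>) = gen_diff a c (gen_diff u v \<omega>)"
proof -
  have "gen_diff a c (ext_gen g' \<and>\<^sub>e \<omega>) = gen_diff a c (ext_gen g \<and>\<^sub>e \<omega>)"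
    if "g' = g \<or> {g', g} \<subseteq> {a, c}" for g g'
    using that gen_diff_identify[of a c \<omega>] by auto
  then show ?thesis
    using assms by (simp add: gen_diff_def[of u'] gen_diff_def[of u] gen_diff_linear)
qed

text \<open>\<open>K\<close> is what multiplication by a generator becomes after \<open>Z\<close>
  has been moved past it, including the sign. Thus \<open>Z\<close> can be carried down the product
  and the letters exchanged one at a time.\<close>

lemma operator_wedge_list_cong:
  assumes "\<And>g \<eta>. Z (ext_gen g \<and>\<^sub>e \<eta>) = K g (Z \<eta>)"
    and "\<And>g \<eta>. g \<in> set l \<Longrightarrow> Z (ext_gen (f g) \<and>\<^sub>e \<eta>) = Z (ext_gen (f' g) \<and>\<^sub>e \<eta>)"
  shows "Z (wedge_list (map f l)) = Z (wedge_list (map f' l))"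
  using assms(2)
proof (induction l)
  case (Cons g l)
  have "Z (wedge_list (map f (g # l))) = Z (ext_gen (f' g) \<and>\<^sub>e wedge_list (map f l))"
    using Cons.prems[of g] by simp
  also have "\<dots> = Z (wedge_list (map f' (g # l)))"
    using Cons assms(1) by simp
  finally show ?case .
qed simp

text \<open>The two composites along a face may send a generator to different halves of a circle
  that splits; \<open>u\<close> and \<open>v\<close> stand for these halves.\<close>

lemma gen_diff_ext_map_cong:
  fixes \<omega> :: "('a::linorder, 'b::comm_ring_1) ext"
  assumes G: "finite G"
    and f: "\<And>g. g \<in> G \<Longrightarrow> f g = f' g \<or> {f g, f' g} \<subseteq> {u, v}"
  shows "gen_diff u v (ext_map G f \<omega>) = gen_diff u v (ext_map G f' \<omega>)"
proof -
  have "gen_diff u v (wedge_list (map f (sorted_list_of_set S)) :: ('a, 'b) ext) =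
      gen_diff u v (wedge_list (map f' (sorted_list_of_set S)))" if "S \<in> Pow G" for S
  proof (rule operator_wedge_list_cong)
    show "gen_diff u v (ext_gen g \<and>\<^sub>e \<eta>) = - (ext_gen g \<and>\<^sub>e gen_diff u v \<eta>)" for g and \<eta> :: "('a, 'b) ext"
      by (rule gen_diff_anticommute)
    show "gen_diff u v (ext_gen (f g) \<and>\<^sub>e \<eta>) = gen_diff u v (ext_gen (f' g) \<and>\<^sub>e \<eta>)"
      if "g \<in> set (sorted_list_of_set S)" for g and \<eta> :: "('a, 'b) ext"
    proof -
      have "g \<in> G"
        using that \<open>S \<in> Pow G\<close> G rev_finite_subset[of G S] by auto
      then show ?thesis
        using f[of g] gen_diff_identify[of u v \<eta>] by auto
    qed
  qed
  then have "(\<lambda>U. \<Sum>S\<in>Pow G. \<omega> S * gen_diff u v (wedge_list (map f (sorted_list_of_set S))) U) =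
      (\<lambda>U. \<Sum>S\<in>Pow G. \<omega> S * gen_diff u v (wedge_list (map f' (sorted_list_of_set S))) U)"
    by (intro ext sum.cong refl) (simp only:)
  then show ?thesis
    by (simp add: ext_map_def gen_diff_sum gen_diff_linear)
qed

text \<open>Two splittings identify two pairs of generators, and the pairs may share a generator;
  hence images are compared through the reflexive transitive closure.\<close>

lemma gen_diff_gen_diff_ext_map_cong:
  fixes \<omega> :: "('a::linorder, 'b::comm_ring_1) ext"
  assumes G: "finite G"
    and f: "\<And>g. g \<in> G \<Longrightarrow> (f g, f' g) \<in> ({u, v} \<times> {u, v} \<union> {u', v'} \<times> {u', v'})\<^sup>*"
  shows "gen_diff u v (gen_diff u' v' (ext_map G f \<omega>)) = gen_diff u v (gen_diff u' v' (ext_map G f' \<omega>))"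
proof -
  define Z where "Z \<omega> = gen_diff u v (gen_diff u' v' \<omega>)" for \<omega> :: "('a, 'b) ext"
  have Z: "Z (ext_gen g \<and>\<^sub>e \<eta>) = ext_gen g \<and>\<^sub>e Z \<eta>" for g \<eta>
    by (simp add: Z_def gen_diff_anticommute gen_diff_linear wedge_minus_right)
  have id1: "Z (ext_gen g \<and>\<^sub>e \<eta>) = Z (ext_gen h \<and>\<^sub>e \<eta>)"
    if "(g, h) \<in> {u, v} \<times> {u, v} \<union> {u', v'} \<times> {u', v'}" for g h \<eta>
  proof -
    have E: "gen_diff a c (ext_gen g \<and>\<^sub>e \<theta>) = gen_diff a c (ext_gen h \<and>\<^sub>e \<theta>)"
      if "g \<in> {a, c}" "h \<in> {a, c}" for a c and \<theta> :: "('a, 'b) ext"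
      using that gen_diff_identify[of a c \<theta>] by auto
    from that consider "g \<in> {u, v}" "h \<in> {u, v}" | "g \<in> {u', v'}" "h \<in> {u', v'}"
      by auto
    then show ?thesis
    proof cases
      case 1
      then show ?thesis
        using E[of u v "gen_diff u' v' \<eta>"]
        by (simp only: Z_def gen_diff_anticommute[of u' v'] gen_diff_linear)
    next
      case 2
      then show ?thesis
        using E[of u' v' \<eta>] by (simp only: Z_def)
    qed
  qed
  have id: "Z (ext_gen g \<and>\<^sub>e \<eta>) = Z (ext_gen h \<and>\<^sub>e \<eta>)"
    if "(g, h) \<in> ({u, v} \<times> {u, v} \<union> {u', v'} \<times> {u', v'})\<^sup>*" for g h \<eta>
    using that by (induction rule: rtrancl_induct) (use id1 in \<open>auto\<close>)
  have "Z (wedge_list (map f (sorted_list_of_set S))) =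
      Z (wedge_list (map f' (sorted_list_of_set S)))" if "S \<in> Pow G" for S
  proof (rule operator_wedge_list_cong)
    show "Z (ext_gen g \<and>\<^sub>e \<eta>) = ext_gen g \<and>\<^sub>e Z \<eta>" for g \<eta>
      by (rule Z)
    show "Z (ext_gen (f g) \<and>\<^sub>e \<eta>) = Z (ext_gen (f' g) \<and>\<^sub>e \<eta>)" if "g \<in> set (sorted_list_of_set S)" for g \<eta>
    proof -
      have "g \<in> G"
        using that \<open>S \<in> Pow G\<close> G rev_finite_subset[of G S] by auto
      then show ?thesis
        using f[of g] id by auto
    qed
  qed
  then have "(\<lambda>U. \<Sum>S\<in>Pow G. \<omega> S * Z (wedge_list (map f (sorted_list_of_set S))) U) =
      (\<lambda>U. \<Sum>S\<in>Pow G. \<omega> S * Z (wedge_list (map f' (sorted_list_of_set S))) U)"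
    by (intro ext sum.cong refl) (simp only:)
  then show ?thesis
    by (simp add: Z_def ext_map_def gen_diff_sum gen_diff_linear)
qed

lemma minus_one_power_mult_eq_0 [simp]: "(- 1) ^ k * x = 0 \<longleftrightarrow> x = (0 :: 'r::comm_ring_1)"
  by (cases "even k") auto

lemma minus_one_power_neq_0 [simp]: "(- 1) ^ k \<noteq> (0 :: 'r::comm_ring_1)"
  by (cases "even k") auto

lemma gen_diff_one_nonzero: "u \<noteq> v \<Longrightarrow> gen_diff u v (ext_basis {}) \<noteq> (0 :: ('g::linorder, 'r::comm_ring_1) ext)"
proof
  assume "u \<noteq> v" and "gen_diff u v (ext_basis {}) = (0 :: ('g, 'r) ext)"
  then have "gen_diff u v (ext_basis {}) {u} = (0 :: 'r)"
    by simp
  then show False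
    using \<open>u \<noteq> v\<close> by (simp add: gen_diff_def ext_gen_wedge_apply ext_basis_def[of "{}"] split: if_splits)
qed

text \<open>Exchanging the members of either pair changes the element only by a sign, so one may
  arrange that \<open>u'\<close> lies outside \<open>{u, v}\<close>. The coefficient at
  \<open>{u, u'}\<close> is then a sign.\<close>

lemma gen_diff_gen_diff_one_nonzero:
  assumes "u \<noteq> v" "u' \<noteq> v'" "{u, v} \<noteq> {u', v'}"
  shows "gen_diff u v (gen_diff u' v' (ext_basis {})) \<noteq> (0 :: ('g::linorder, 'r::comm_ring_1) ext)"
proof -
  have *: "gen_diff u v (gen_diff u' v' (ext_basis {})) \<noteq> (0 :: ('g, 'r) ext)"
    if "u \<noteq> v" "u' \<noteq> v'" "u' \<notin> {u, v}" "v' \<noteq> u" for u v u' v' :: 'g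
  proof
    assume "gen_diff u v (gen_diff u' v' (ext_basis {})) = (0 :: ('g, 'r) ext)"
    then have "gen_diff u v (gen_diff u' v' (ext_basis {})) {u, u'} = (0 :: 'r)"
      by simp
    moreover have "{u, u'} - {u} = {u'}" using that by auto
    ultimately show False
      using that by (simp add: gen_diff_def ext_gen_wedge_apply ext_basis_def[of "{}"] split: if_splits)
  qed
  have "gen_diff u v (gen_diff u' v' \<eta>) = 0 \<longleftrightarrow> gen_diff v u (gen_diff u' v' \<eta>) = 0"
    "gen_diff u v (gen_diff u' v' \<eta>) = 0 \<longleftrightarrow> gen_diff u v (gen_diff v' u' \<eta>) = 0"
    "gen_diff u v (gen_diff u' v' \<eta>) = 0 \<longleftrightarrow> gen_diff v u (gen_diff v' u' \<eta>) = 0"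
    for \<eta> :: "('g, 'r) ext"
    using gen_diff_swap[of u v "gen_diff u' v' \<eta>"] gen_diff_swap[of u' v' \<eta>] gen_diff_swap[of u v "gen_diff v' u' \<eta>"]
    by (auto simp: gen_diff_linear)
  then show ?thesis
    using assms *[of u v u' v'] *[of v u u' v'] *[of u v v' u'] *[of v u v' u'] by blast
qed

section \<open>Orbits of a permutation composed with a transposition\<close>

text \<open>Only forward iterates occur. For a permutation of a finite set they already make up the
  whole cycle, which is why the relation becomes symmetric below.\<close>

definition orbit_rel :: "('a \<Rightarrow> 'a) \<Rightarrow> 'a \<Rightarrow> 'a \<Rightarrow> bool" where
  "orbit_rel f s t \<longleftrightarrow> (\<exists>n. (f ^^ n) s = t)"

lemma orbit_rel_refl [simp]: "orbit_rel f s s"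
  unfolding orbit_rel_def by (intro exI[of _ 0]) simp

lemma orbit_rel_step: "orbit_rel f s (f s)"
  unfolding orbit_rel_def by (intro exI[of _ 1]) simp

lemma orbit_rel_trans: "orbit_rel f s t \<Longrightarrow> orbit_rel f t u \<Longrightarrow> orbit_rel f s u"
  unfolding orbit_rel_def by (metis funpow_add o_apply)

lemma orbit_rel_induct [consumes 1, case_names refl step]:
  assumes "orbit_rel f s t" "P s" "\<And>t. orbit_rel f s t \<Longrightarrow> P t \<Longrightarrow> P (f t)"
  shows "P t"
proof -
  have "P ((f ^^ n) s)" for n
    by (induction n) (use assms(2,3) in \<open>auto simp: orbit_rel_def\<close>)
  then show ?thesis
    using assms(1) by (auto simp: orbit_rel_def)
qed

locale finite_permutation =
  fixes S :: "'a set" and f :: "'a \<Rightarrow> 'a"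
  assumes finite_S: "finite S" and permutes: "f permutes S"
begin

lemma returns: "\<exists>n>0. (f ^^ n) s = s"
proof (cases "s \<in> S")
  case True
  then have "(f ^^ n) s \<in> S" for n
    using permutes by (induction n) (auto simp: permutes_in_image)
  then have "finite {y. \<exists>n. y = (f ^^ n) s}"
    using finite_S by (auto intro: finite_subset[of _ S])
  then show ?thesis
    using funpow_inj_finite[OF permutes_inj[OF permutes]] by metis
next
  case False
  then show ?thesis
    using permutes by (intro exI[of _ 1]) (simp add: permutes_not_in)
qed

lemma orbit_rel_sym: "orbit_rel f s t \<Longrightarrow> orbit_rel f t s"
proof (induction rule: orbit_rel_induct)
  case (step t)
  have "orbit_rel f (f t) t"
  proof -
    obtain n where "n > 0" "(f ^^ n) t = t"
      using returns by blast
    then have "(f ^^ (n - 1)) (f t) = t"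
      by (metis One_nat_def Suc_pred funpow_simps_right(2) o_apply)
    then show ?thesis
      by (auto simp: orbit_rel_def)
  qed
  then show ?case
    using step orbit_rel_trans by metis
qed simp

lemma orbit_rel_in: "orbit_rel f s t \<Longrightarrow> s \<in> S \<longleftrightarrow> t \<in> S"
  by (induction rule: orbit_rel_induct) (use permutes in \<open>auto simp: permutes_in_image\<close>)

lemma inverse: "finite_permutation S (inv_into UNIV f)"
  using finite_S permutes permutes_inv by unfold_locales auto

lemma orbit_rel_inv_imp: "orbit_rel (inv_into UNIV f) s t \<Longrightarrow> orbit_rel f t s"
proof (induction rule: orbit_rel_induct)
  case (step t)
  have "orbit_rel f (inv_into UNIV f t) t"
    using orbit_rel_step[of f "inv_into UNIV f t"] permutes by (simp add: permutes_inverses)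
  then show ?case
    using step.IH by (rule orbit_rel_trans)
qed simp

lemma orbit_rel_inv: "orbit_rel (inv_into UNIV f) s t \<longleftrightarrow> orbit_rel f t s"
proof -
  interpret i: finite_permutation S "inv_into UNIV f" by (rule inverse)
  have "inv_into UNIV (inv_into UNIV f) = f"
    using permutes by (simp add: permutes_inv_inv)
  then show ?thesis
    using orbit_rel_inv_imp[of s t] i.orbit_rel_inv_imp[of t s] by auto
qed

lemma transpose_permutation:
  assumes "p \<in> S" "q \<in> S"
  shows "finite_permutation S (f \<circ> transpose p q)"
  using assms finite_S permutes
  by unfold_locales (auto intro: permutes_compose permutes_swap_id)

text \<open>The composite \<open>F\<close> sends \<open>p\<close> to \<open>f q\<close> and then
  follows \<open>f\<close> until it arrives at \<open>p\<close>. So the \<open>F\<close>-cycle of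
  \<open>p\<close> is the \<open>f\<close>-path that leaves \<open>q\<close> and ends at
  \<open>p\<close>, and it does not return to \<open>q\<close>.\<close>

lemma splits:
  assumes "p \<noteq> q" "orbit_rel f p q"
  shows "\<not> orbit_rel (f \<circ> transpose p q) p q"
proof
  define F where "F = f \<circ> transpose p q"
  have F: "F x = f (transpose p q x)" for x
    by (simp add: F_def)
  assume "orbit_rel (f \<circ> transpose p q) p q"
  then have "orbit_rel F p q"
    by (simp only: F_def)
  have ex: "\<exists>n. (f ^^ n) q = p"
    using orbit_rel_sym[OF assms(2)] unfolding orbit_rel_def .
  define m where "m = (LEAST n. (f ^^ n) q = p)"
  have m: "(f ^^ m) q = p" and least: "\<And>n. n < m \<Longrightarrow> (f ^^ n) q \<noteq> p"
    unfolding m_def using LeastI_ex[OF ex] not_less_Least by blast+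
  have noq: "(f ^^ n) q \<noteq> q" if "0 < n" "n \<le> m" for n
  proof
    assume "(f ^^ n) q = q"
    then have "(f ^^ (m - n)) q = p"
      using m that by (metis funpow_add le_add_diff_inverse2 o_apply)
    then show False
      using least[of "m - n"] that by simp
  qed
  have "m > 0"
    using m assms(1) by (cases m) auto
  have eq: "(F ^^ n) p = (f ^^ n) q" if "0 < n" "n \<le> m" for n
    using that
  proof (induction n)
    case (Suc n)
    show ?case
    proof (cases "n = 0")
      case False
      then have "(f ^^ n) q \<notin> {p, q}"
        using Suc.prems least[of n] noq[of n] by auto
      then show ?thesis
        using Suc False by (simp add: F transpose_def)
    qed (simp add: F)
  qed simp
  have "(F ^^ k) p \<in> (\<lambda>n. (f ^^ n) q) ` {1..m}" for k
  proof (induction k)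
    case 0
    then show ?case
      using m \<open>m > 0\<close> by (auto intro!: image_eqI[of _ _ m])
  next
    case (Suc k)
    then obtain n where n: "n \<in> {1..m}" "(F ^^ k) p = (f ^^ n) q"
      by auto
    then have *: "(F ^^ Suc k) p = F ((f ^^ n) q)"
      by simp
    show ?case
    proof (cases "n = m")
      case True
      then have "(F ^^ Suc k) p = (f ^^ 1) q"
        using m * by (simp add: F)
      then show ?thesis
        using \<open>m > 0\<close> by (intro image_eqI[of _ _ 1]) simp_all
    next
      case False
      then have "(f ^^ n) q \<notin> {p, q}"
        using n noq[of n] least[of n] by auto
      then have "(F ^^ Suc k) p = (f ^^ Suc n) q"
        using * by (simp add: F transpose_def)
      moreover have "Suc n \<in> {1..m}"
        using n False by simp
      ultimately show ?thesis
        by (intro image_eqI[of _ _ "Suc n"])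
    qed
  qed
  moreover obtain k where "(F ^^ k) p = q"
    using \<open>orbit_rel F p q\<close> unfolding orbit_rel_def by blast
  ultimately obtain n where "n \<in> {1..m}" "q = (f ^^ n) q"
    by (metis (no_types, lifting) imageE)
  then show False
    using noq[of n] by simp
qed

text \<open>From \<open>p\<close> the composite jumps to \<open>f q\<close> and runs along the cycle
  of \<open>q\<close>, where it never meets \<open>p\<close>. It reaches \<open>q\<close> after
  \<open>m\<close> steps, the length of that cycle.\<close>

lemma merges:
  assumes "p \<noteq> q" "\<not> orbit_rel f p q"
  shows "orbit_rel (f \<circ> transpose p q) p q"
proof -
  define F where "F = f \<circ> transpose p q"
  have F: "F x = f (transpose p q x)" for x
    by (simp add: F_def)
  obtain m0 where "m0 > 0" "(f ^^ m0) q = q"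
    using returns by blast
  then have ex: "\<exists>n. n > 0 \<and> (f ^^ n) q = q"
    by blast
  define m where "m = (LEAST n. n > 0 \<and> (f ^^ n) q = q)"
  have m: "m > 0" "(f ^^ m) q = q" and least: "\<And>n. 0 < n \<Longrightarrow> n < m \<Longrightarrow> (f ^^ n) q \<noteq> q"
    unfolding m_def using LeastI_ex[OF ex] not_less_Least by blast+
  have nop: "(f ^^ n) q \<noteq> p" for n
    using assms(2) orbit_rel_sym by (metis orbit_rel_def)
  have "(F ^^ n) p = (f ^^ n) q" if "0 < n" "n \<le> m" for n
    using that
  proof (induction n)
    case (Suc n)
    show ?case
    proof (cases "n = 0")
      case False
      then have "(f ^^ n) q \<notin> {p, q}"
        using Suc.prems least[of n] nop[of n] by auto
      then show ?thesis
        using Suc False by (simp add: F transpose_def)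
    qed (simp add: F)
  qed simp
  then show ?thesis
    using m unfolding orbit_rel_def F_def[symmetric] by (intro exI[of _ m]) simp
qed

lemma orbit_rel_transpose_iff:
  "p \<noteq> q \<Longrightarrow> orbit_rel (f \<circ> transpose p q) p q \<longleftrightarrow> \<not> orbit_rel f p q"
  using splits merges by blast

text \<open>An \<open>f\<close>-step from \<open>t\<close> is a step of the composite from
  \<open>transpose p q t\<close>, and this point is in the same orbit of the composite as
  \<open>t\<close> because \<open>p\<close> and \<open>q\<close> are.\<close>

lemma orbit_rel_transpose_imp:
  assumes "p \<in> S" "q \<in> S" "orbit_rel (f \<circ> transpose p q) p q" "orbit_rel f s t"
  shows "orbit_rel (f \<circ> transpose p q) s t"
  using assms(4)
proof (induction rule: orbit_rel_induct)
  case (step t)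
  let ?f = "f \<circ> transpose p q"
  interpret t: finite_permutation S ?f
    using transpose_permutation assms by blast
  have "orbit_rel ?f t (f t)"
  proof -
    have "orbit_rel ?f t (transpose p q t)"
      using assms(3) t.orbit_rel_sym by (auto simp: transpose_def)
    moreover have "orbit_rel ?f (transpose p q t) (f t)"
      using orbit_rel_step[of ?f "transpose p q t"] by simp
    ultimately show ?thesis
      using orbit_rel_trans by metis
  qed
  then show ?case
    using step orbit_rel_trans by metis
qed simp

lemma orbit_rel_merge:
  assumes "p \<in> S" "q \<in> S" "orbit_rel (f \<circ> transpose p q) p q"
  shows "orbit_rel (f \<circ> transpose p q) s t \<longleftrightarrow> orbit_rel f s t \<or>
    (orbit_rel f s p \<or> orbit_rel f s q) \<and> (orbit_rel f p t \<or> orbit_rel f q t)"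
    (is "orbit_rel ?f s t \<longleftrightarrow> ?J s t")
proof
  interpret t: finite_permutation S ?f
    using transpose_permutation assms by blast
  show "?J s t" if "orbit_rel ?f s t"
    using that
  proof (induction rule: orbit_rel_induct)
    case (step t)
    consider "t = p" | "t = q" | "t \<noteq> p" "t \<noteq> q"
      by blast
    then show ?case
    proof cases
      case 1
      then show ?thesis
        using step.IH orbit_rel_step[of f q] by auto
    next
      case 2
      then show ?thesis
        using step.IH orbit_rel_step[of f p] by auto
    next
      case 3
      then have "orbit_rel f t (?f t)"
        using orbit_rel_step[of f t] by (simp add: transpose_def)
      then show ?thesis
        using step.IH orbit_rel_trans[of f _ t "?f t"] by blast
    qed
  qed simp
  show "orbit_rel ?f s t" if "?J s t"
  proof -
    have imp: "orbit_rel ?f s t" if "orbit_rel f s t" for s t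
      using that by (rule orbit_rel_transpose_imp[OF assms])
    have to_p: "orbit_rel ?f s p" if "orbit_rel f s p \<or> orbit_rel f s q"
      using that imp[of s p] imp[of s q] orbit_rel_trans[OF _ t.orbit_rel_sym[OF assms(3)], of s] by blast
    have from_p: "orbit_rel ?f p t" if "orbit_rel f p t \<or> orbit_rel f q t"
      using that imp[of p t] imp[of q t] orbit_rel_trans[OF assms(3), of t] by blast
    show ?thesis
      using that imp[of s t] to_p from_p orbit_rel_trans[of ?f s p t] by blast
  qed
qed

text \<open>Composing with the transposition of the ends \<open>t\<close> and \<open>h\<close> of an
  arrow closes up the \<open>f\<close>-path from \<open>t\<close> to \<open>h\<close> into the cycle
  of \<open>h\<close>, because \<open>h\<close> is now sent to \<open>f t\<close>. So
  \<open>u\<close>, which lies on that cycle, is met before \<open>h\<close>, while \<open>e\<close>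
  is not on this path. In this way the cyclic order of arrow ends is read off from the circles after
  a surgery.\<close>

lemma next_visit:
  assumes "t \<in> S" "h \<in> S" "orbit_rel (f \<circ> transpose t h) h u" "u \<noteq> h"
    and "\<not> orbit_rel (f \<circ> transpose t h) h t" "\<not> orbit_rel (f \<circ> transpose t h) h e"
  shows "\<exists>k>0. (f ^^ k) t = u \<and> (\<forall>m. 0 < m \<and> m < k \<longrightarrow> (f ^^ m) t \<notin> {t, h, u, e})"
proof -
  define F where "F = f \<circ> transpose t h"
  have F: "F x = f (transpose t h x)" for x
    by (simp add: F_def)
  note assms = assms[folded F_def]
  have ex: "\<exists>n. (F ^^ n) h = u"
    using assms(3) by (simp add: orbit_rel_def)
  define k where "k = (LEAST n. (F ^^ n) h = u)"
  have k: "(F ^^ k) h = u" and least: "\<And>n. n < k \<Longrightarrow> (F ^^ n) h \<noteq> u"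
    unfolding k_def using LeastI_ex[OF ex] not_less_Least by blast+
  have noh: "(F ^^ n) h \<noteq> h" if "0 < n" "n \<le> k" for n
  proof
    assume "(F ^^ n) h = h"
    then have "(F ^^ (k - n)) h = u"
      using k that by (metis funpow_add le_add_diff_inverse2 o_apply)
    then show False
      using least[of "k - n"] that by simp
  qed
  have no: "(F ^^ n) h \<noteq> t" "(F ^^ n) h \<noteq> e" for n
    using assms(5,6) by (auto simp: orbit_rel_def)
  have "k > 0"
    using k assms(4) by (cases k) auto
  have eq: "(f ^^ n) t = (F ^^ n) h" if "0 < n" "n \<le> k" for n
    using that
  proof (induction n)
    case (Suc n)
    show ?case
    proof (cases "n = 0")
      case False
      then have "(F ^^ n) h \<notin> {t, h}"
        using Suc.prems noh[of n] no[of n] by auto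
      then have "(F ^^ Suc n) h = f ((F ^^ n) h)"
        by (simp add: F transpose_def)
      then show ?thesis
        using Suc False by simp
    qed (simp add: F)
  qed simp
  show ?thesis
    using \<open>k > 0\<close> k eq noh no least by (intro exI[of _ k]) auto
qed

text \<open>The counterpart for the inverse permutation, with every point replaced by its image:
  traversed backwards, an arc is entered at its other end. Transposing \<open>f t\<close> and
  \<open>f h\<close> before the inverse of \<open>f\<close> gives the inverse of
  \<open>f \<circ> transpose t h\<close>, so the circles after the surgery are the same.\<close>

lemma previous_visit:
  assumes "t \<in> S" "h \<in> S" "orbit_rel (f \<circ> transpose t h) t u" "u \<noteq> t" "e \<noteq> h"
    and "\<not> orbit_rel (f \<circ> transpose t h) t h" "\<not> orbit_rel (f \<circ> transpose t h) t e"
  shows "\<exists>k>0. (inv_into UNIV f ^^ k) (f t) = f u \<and>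
    (\<forall>m. 0 < m \<and> m < k \<longrightarrow> (inv_into UNIV f ^^ m) (f t) \<notin> {f t, f h, f u, f e})"
proof -
  let ?f = "f \<circ> transpose t h"
  interpret t: finite_permutation S ?f
    using transpose_permutation assms by blast
  interpret i: finite_permutation S "inv_into UNIV f" by (rule inverse)
  have inv: "inv_into UNIV f \<circ> transpose (f t) (f h) = inv_into UNIV ?f"
  proof -
    have b: "bij f" using permutes permutes_bij by blast
    have "inv_into UNIV ?f = transpose t h \<circ> inv_into UNIV f"
      using b by (simp add: o_inv_distrib bij_transpose)
    also have "\<dots> = inv_into UNIV f \<circ> transpose (f t) (f h)"
    proof (rule ext)
      fix s
      obtain r where "s = f r"
        using b by (metis bij_pointE)
      then show "(transpose t h \<circ> inv_into UNIV f) s = (inv_into UNIV f \<circ> transpose (f t) (f h)) s"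
        using b by (simp add: transpose_def bij_is_inj inj_eq)
    qed
    finally show ?thesis ..
  qed
  have f: "f t = ?f h" "f h = ?f t" "f u = ?f u" "f e = ?f e"
    using assms by (auto simp: transpose_def)
  have conj: "orbit_rel ?f (?f s) (?f r) \<longleftrightarrow> orbit_rel ?f s r" for s r
    using orbit_rel_trans[of ?f] orbit_rel_step[of ?f s] orbit_rel_step[of ?f r]
      t.orbit_rel_sym[OF orbit_rel_step, of s] t.orbit_rel_sym[OF orbit_rel_step, of r] by blast
  have inj: "f u \<noteq> f h" 
    using assms permutes_inj[OF permutes] by (metis inj_eq)
  have S: "f t \<in> S" "f h \<in> S"
    using assms permutes by (auto simp: permutes_in_image)
  have 1: "orbit_rel (inv_into UNIV f \<circ> transpose (f t) (f h)) (f h) (f r) \<longleftrightarrow> orbit_rel ?f t r'"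
    if "f r = ?f r'" for r r'
  proof -
    have "orbit_rel (inv_into UNIV f \<circ> transpose (f t) (f h)) (f h) (f r) \<longleftrightarrow> orbit_rel ?f (f r) (f h)"
      by (subst inv) (rule t.orbit_rel_inv)
    also have "\<dots> \<longleftrightarrow> orbit_rel ?f r' t"
      by (subst that, subst f(2)) (rule conj)
    also have "\<dots> \<longleftrightarrow> orbit_rel ?f t r'"
      using t.orbit_rel_sym by (intro iffI)
    finally show ?thesis .
  qed
  show ?thesis
  proof (rule i.next_visit[OF S])
    show "orbit_rel (inv_into UNIV f \<circ> transpose (f t) (f h)) (f h) (f u)"
      using 1[OF f(3)] assms by simp
    show "f u \<noteq> f h" by (rule inj)
    show "\<not> orbit_rel (inv_into UNIV f \<circ> transpose (f t) (f h)) (f h) (f t)"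
      using 1[OF f(1)] assms by simp
    show "\<not> orbit_rel (inv_into UNIV f \<circ> transpose (f t) (f h)) (f h) (f e)"
      using 1[OF f(4)] assms by simp
  qed
qed

end

section \<open>Resolutions of closed braids as permutations\<close>

text \<open>
  Orienting the odd strands upwards and the even ones downwards is compatible with both smoothings
  of every crossing, so it orients all circles of all resolutions simultaneously: every resolution
  becomes a permutation of the segments, whose orbits are the circles, and changing the smoothing of
  a crossing composes this permutation with a transposition.
\<close>

definition nxt :: "nat \<Rightarrow> braid_word \<Rightarrow> vertex \<Rightarrow> segment \<Rightarrow> segment" where
  "nxt b w \<alpha> s = (if s \<in> segments b w then if odd (snd s) then above w \<alpha> s else below w \<alpha> s else s)"

definition prv :: "nat \<Rightarrow> braid_word \<Rightarrow> vertex \<Rightarrow> segment \<Rightarrow> segment" where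
  "prv b w \<alpha> s = (if s \<in> segments b w then if odd (snd s) then below w \<alpha> s else above w \<alpha> s else s)"

text \<open>Neighbouring strands have opposite parity. Under the orientation by parity the odd one
  runs up into the crossing from below and the even one runs down into it from above, whichever of
  them is on the left.\<close>

definition lower_in :: "braid_word \<Rightarrow> nat \<Rightarrow> segment" where
  "lower_in w x = (x, if odd (strand (w ! x)) then strand (w ! x) else Suc (strand (w ! x)))"

definition upper_in :: "braid_word \<Rightarrow> nat \<Rightarrow> segment" where
  "upper_in w x = (Suc x, if odd (strand (w ! x)) then Suc (strand (w ! x)) else strand (w ! x))"

text \<open>
  The segment through which this orientation enters the given arc. Both smoothings of a crossing
  are entered from the same two segments.
\<close>

definition arc_in :: "braid_word \<Rightarrow> nat \<Rightarrow> direction \<Rightarrow> segment" where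
  "arc_in w x d =
     (if d = South \<or> d = (if odd (strand (w ! x)) then West else East) then lower_in w x else upper_in w x)"

text \<open>\<open>tail0\<close> and \<open>head0\<close> mark the arcs joined by the arrow of the
  0-smoothing, \<open>tail1\<close> and \<open>head1\<close> those joined by the rotated arrow of
  the 1-smoothing. Each is one of the same two segments.\<close>

abbreviation tail0 :: "braid_word \<Rightarrow> (nat \<Rightarrow> direction) \<Rightarrow> nat \<Rightarrow> segment" where
  "tail0 w A x \<equiv> arc_in w x (opposite (A x))"

abbreviation head0 :: "braid_word \<Rightarrow> (nat \<Rightarrow> direction) \<Rightarrow> nat \<Rightarrow> segment" where
  "head0 w A x \<equiv> arc_in w x (A x)"

abbreviation tail1 :: "braid_word \<Rightarrow> (nat \<Rightarrow> direction) \<Rightarrow> nat \<Rightarrow> segment" where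
  "tail1 w A x \<equiv> arc_in w x (opposite (clockwise (A x)))"

abbreviation head1 :: "braid_word \<Rightarrow> (nat \<Rightarrow> direction) \<Rightarrow> nat \<Rightarrow> segment" where
  "head1 w A x \<equiv> arc_in w x (clockwise (A x))"

definition arc_dirs :: "braid_word \<Rightarrow> vertex \<Rightarrow> nat \<Rightarrow> direction set" where
  "arc_dirs w \<alpha> x = (if vertical w \<alpha> x then {East, West} else {North, South})"

lemma opposite_simps [simp]:
  "opposite North = South" "opposite South = North" "opposite East = West" "opposite West = East"
  by (simp_all add: opposite_def)

lemma opposite_opposite [simp]: "opposite (opposite d) = d"
  by (cases d) auto

lemma clockwise_opposite [simp]: "clockwise (opposite d) = opposite (clockwise d)"
  by (cases d) auto

lemma opposite_neq [simp]: "opposite d \<noteq> d" "d \<noteq> opposite d"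
  by (cases d; simp)+

lemma lower_upper_neq [simp]: "lower_in w x \<noteq> upper_in w x" "upper_in w x \<noteq> lower_in w x"
  by (simp_all add: lower_in_def upper_in_def)

lemma arc_in_set: "{arc_in w x (opposite d), arc_in w x d} = {lower_in w x, upper_in w x}"
  by (cases d) (auto simp: arc_in_def)

lemma arc_in_cases: "arc_in w x d = lower_in w x \<or> arc_in w x d = upper_in w x"
  by (simp add: arc_in_def)

lemma points_simps [simp]:
  "fst (lower_in w x) = x" "fst (upper_in w x) = Suc x"
  "odd (snd (lower_in w x))" "even (snd (upper_in w x))"
  by (simp_all add: lower_in_def upper_in_def)

lemma points_neq:
  assumes "x \<noteq> y"
  shows "{lower_in w x, upper_in w x} \<inter> {lower_in w y, upper_in w y} = {}"
proof -
  have 1: "lower_in w x \<noteq> upper_in w y" for x y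
    using points_simps(3)[of w x] points_simps(4)[of w y] by (metis (full_types))
  have 2: "lower_in w x \<noteq> lower_in w y" "upper_in w x \<noteq> upper_in w y"
    using assms by (auto dest: arg_cong[of _ _ fst])
  show ?thesis
    by (simp add: 1 1[symmetric] 2)
qed

lemma arrow_choice_cases:
  assumes "arrow_choice w A" "arrow_choice w A'" "x \<in> crossings w"
  shows "A' x = A x \<or> A' x = opposite (A x)"
proof -
  have "A x \<in> (if positive w x then {East, West} else {North, South})"
    "A' x \<in> (if positive w x then {East, West} else {North, South})"
    using assms unfolding arrow_choice_def by blast+
  then show ?thesis
    by (auto split: if_splits)
qed

lemma arrow_choice_arc_dirs:
  assumes "arrow_choice w A" "x \<in> crossings w"
  shows "x \<notin> \<alpha> \<Longrightarrow> A x \<in> arc_dirs w \<alpha> x" "x \<in> \<alpha> \<Longrightarrow> clockwise (A x) \<in> arc_dirs w \<alpha> x"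
proof -
  have "A x \<in> (if positive w x then {East, West} else {North, South})"
    using assms unfolding arrow_choice_def by blast
  then show "x \<notin> \<alpha> \<Longrightarrow> A x \<in> arc_dirs w \<alpha> x" "x \<in> \<alpha> \<Longrightarrow> clockwise (A x) \<in> arc_dirs w \<alpha> x"
    by (auto simp: arc_dirs_def vertical_def split: if_splits)
qed

lemma arc_dirs_opposite: "d \<in> arc_dirs w \<alpha> x \<Longrightarrow> opposite d \<in> arc_dirs w \<alpha> x"
  by (auto simp: arc_dirs_def split: if_splits)

lemma at_crossing_other [simp]: "at_crossing w x j \<Longrightarrow> at_crossing w x (other_strand w x j)"
  by (auto simp: at_crossing_def other_strand_def)

lemma other_other_strand [simp]: "at_crossing w x j \<Longrightarrow> other_strand w x (other_strand w x j) = j"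
  by (auto simp: at_crossing_def other_strand_def)

lemma even_other_strand [simp]: "at_crossing w x j \<Longrightarrow> even (other_strand w x j) \<longleftrightarrow> odd j"
  by (auto simp: at_crossing_def other_strand_def)

locale braid_diagram =
  fixes b :: nat and w :: braid_word
  assumes braid: "is_braid_word b w"
begin

lemma strand_bounds: "x < length w \<Longrightarrow> 1 \<le> strand (w ! x)" "x < length w \<Longrightarrow> strand (w ! x) < b"
  using braid by (auto simp: is_braid_word_def)

abbreviation S :: "segment set" where "S \<equiv> segments b w"

abbreviation label :: "vertex \<Rightarrow> segment \<Rightarrow> segment" where "label \<equiv> gen b w"

lemma finite_segments: "finite S"
  by (simp add: segments_def)

lemma other_strand_range:
  "x < length w \<Longrightarrow> at_crossing w x j \<Longrightarrow> Suc 0 \<le> other_strand w x j \<and> other_strand w x j \<le> b"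
  using strand_bounds[of x] by (auto simp: at_crossing_def other_strand_def)

lemma above_in: "s \<in> S \<Longrightarrow> above w \<alpha> s \<in> S"
proof -
  assume "s \<in> S"
  then obtain t j where s: "s = (t, j)" "t \<le> length w" "1 \<le> j" "j \<le> b"
    by (cases s) (simp add: segments_def)
  then show ?thesis
    using other_strand_range[of t j] by (simp add: segments_def)
qed

lemma below_in: "s \<in> S \<Longrightarrow> below w \<alpha> s \<in> S"
proof -
  assume "s \<in> S"
  then obtain t j where s: "s = (t, j)" "t \<le> length w" "1 \<le> j" "j \<le> b"
    by (cases s) (simp add: segments_def)
  then show ?thesis
    using other_strand_range[of "t - 1" j] by (cases t) (simp_all add: segments_def)
qed

lemma nxt_in: "s \<in> S \<Longrightarrow> nxt b w \<alpha> s \<in> S"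
  using above_in below_in by (simp add: nxt_def)

lemma prv_in: "s \<in> S \<Longrightarrow> prv b w \<alpha> s \<in> S"
  using above_in below_in by (simp add: prv_def)

text \<open>At a turn the strand changes to its neighbour and so changes its parity: the orientation
  turns around together with the curve, which is what makes \<open>prv\<close> undo
  \<open>nxt\<close>.\<close>

lemma prv_nxt:
  assumes "s \<in> S"
  shows "prv b w \<alpha> (nxt b w \<alpha> s) = s"
proof -
  have n: "nxt b w \<alpha> s = (if odd (snd s) then above w \<alpha> s else below w \<alpha> s)"
    using assms by (simp add: nxt_def)
  have p: "prv b w \<alpha> (nxt b w \<alpha> s) = (if odd (snd (nxt b w \<alpha> s)) then below w \<alpha> (nxt b w \<alpha> s) else above w \<alpha> (nxt b w \<alpha> s))"
    using nxt_in[OF assms] by (simp add: prv_def)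
  obtain t j where s: "s = (t, j)" "t \<le> length w"
    using assms by (cases s) (auto simp: segments_def)
  show ?thesis
    unfolding p unfolding n using s by (cases "odd j") (auto simp: Suc_le_eq)
qed

lemma nxt_prv:
  assumes "s \<in> S"
  shows "nxt b w \<alpha> (prv b w \<alpha> s) = s"
proof -
  have n: "prv b w \<alpha> s = (if odd (snd s) then below w \<alpha> s else above w \<alpha> s)"
    using assms by (simp add: prv_def)
  have p: "nxt b w \<alpha> (prv b w \<alpha> s) = (if odd (snd (prv b w \<alpha> s)) then above w \<alpha> (prv b w \<alpha> s) else below w \<alpha> (prv b w \<alpha> s))"
    using prv_in[OF assms] by (simp add: nxt_def)
  obtain t j where s: "s = (t, j)" "t \<le> length w"
    using assms by (cases s) (auto simp: segments_def)
  show ?thesis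
    unfolding p unfolding n using s by (cases "odd j") (auto simp: Suc_le_eq)
qed

lemma perm: "finite_permutation S (nxt b w \<alpha>)"
proof
  have "bij_betw (nxt b w \<alpha>) S S"
    using nxt_in prv_in prv_nxt nxt_prv by (intro bij_betw_byWitness[where f' = "prv b w \<alpha>"]) auto
  then show "nxt b w \<alpha> permutes S"
    by (rule bij_imp_permutes) (simp add: nxt_def)
qed (rule finite_segments)

lemma inv_nxt: "inv_into UNIV (nxt b w \<alpha>) = prv b w \<alpha>"
proof (rule inv_unique_comp)
  show "nxt b w \<alpha> \<circ> prv b w \<alpha> = id" "prv b w \<alpha> \<circ> nxt b w \<alpha> = id"
  proof -
    have "nxt b w \<alpha> (prv b w \<alpha> s) = s" "prv b w \<alpha> (nxt b w \<alpha> s) = s" for s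
      using nxt_prv[of s \<alpha>] prv_nxt[of s \<alpha>] by (auto simp: nxt_def prv_def)
    then show "nxt b w \<alpha> \<circ> prv b w \<alpha> = id" "prv b w \<alpha> \<circ> nxt b w \<alpha> = id"
      by (simp_all add: fun_eq_iff)
  qed
qed

lemma points_in: "x < length w \<Longrightarrow> lower_in w x \<in> S" "x < length w \<Longrightarrow> upper_in w x \<in> S"
    "x < length w \<Longrightarrow> arc_in w x d \<in> S"
  using strand_bounds[of x] by (auto simp: lower_in_def upper_in_def arc_in_def segments_def)

lemma nxt_lower_upper:
  assumes "x < length w"
  shows "nxt b w \<alpha> (lower_in w x) =
      (if vertical w \<alpha> x then (Suc x, snd (lower_in w x)) else (x, snd (upper_in w x)))"
    and "nxt b w \<alpha> (upper_in w x) =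
      (if vertical w \<alpha> x then (x, snd (upper_in w x)) else (Suc x, snd (lower_in w x)))"
proof -
  note pts = points_in(1,2)[OF assms]
  let ?i = "strand (w ! x)"
  have *: "odd (snd (lower_in w x))" "even (snd (upper_in w x))"
    "at_crossing w x (snd (lower_in w x))" "at_crossing w x (snd (upper_in w x))"
    "other_strand w x (snd (lower_in w x)) = snd (upper_in w x)"
    "other_strand w x (snd (upper_in w x)) = snd (lower_in w x)"
    by (simp_all add: lower_in_def upper_in_def at_crossing_def other_strand_def)
  obtain j k where jk: "lower_in w x = (x, j)" "upper_in w x = (Suc x, k)"
    by (simp add: lower_in_def upper_in_def)
  show "nxt b w \<alpha> (lower_in w x) =
      (if vertical w \<alpha> x then (Suc x, snd (lower_in w x)) else (x, snd (upper_in w x)))"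
    "nxt b w \<alpha> (upper_in w x) =
      (if vertical w \<alpha> x then (x, snd (upper_in w x)) else (Suc x, snd (lower_in w x)))"
    using * pts assms unfolding nxt_def jk by simp_all
qed

text \<open>Only \<open>lower_in\<close> and \<open>upper_in\<close> lead into the crossing. The two
  smoothings have the same two exits and pair them with these entrances in the two possible
  ways.\<close>

lemma nxt_insert:
  assumes "x < length w" "x \<notin> \<alpha>"
  shows "nxt b w (insert x \<alpha>) = nxt b w \<alpha> \<circ> transpose (lower_in w x) (upper_in w x)"
proof (rule ext)
  fix s :: segment
  obtain t j where s: "s = (t, j)" by (cases s)
  have *: "vertical w (insert x \<alpha>) t = (if t = x then \<not> vertical w \<alpha> t else vertical w \<alpha> t)" for t
    using assms by (auto simp: vertical_def)
  consider "s = lower_in w x" | "s = upper_in w x" | "s \<noteq> lower_in w x" "s \<noteq> upper_in w x"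
    by blast
  then show "nxt b w (insert x \<alpha>) s = (nxt b w \<alpha> \<circ> transpose (lower_in w x) (upper_in w x)) s"
  proof cases
    case 1
    then show ?thesis
      using nxt_lower_upper[OF assms(1)] * by simp
  next
    case 2
    then show ?thesis
      using nxt_lower_upper[OF assms(1)] * by simp
  next
    case 3
    have up: "at_crossing w t j \<and> odd j \<longrightarrow> t \<noteq> x"
      using 3(1) by (auto simp: s lower_in_def at_crossing_def)
    have down: "at_crossing w (t - 1) j \<and> even j \<and> t \<noteq> 0 \<longrightarrow> t - 1 \<noteq> x"
      using 3(2) by (auto simp: s upper_in_def at_crossing_def)
    have "above w (insert x \<alpha>) s = above w \<alpha> s" if "odd j"
      using up that by (auto simp: s *)
    moreover have "below w (insert x \<alpha>) s = below w \<alpha> s" if "even j"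
      using down that by (auto simp: s *)
    ultimately have "nxt b w (insert x \<alpha>) s = nxt b w \<alpha> s"
      by (simp add: nxt_def s)
    then show ?thesis
      using 3 by (simp add: transpose_def)
  qed
qed

lemma joined_iff: "(s, s') \<in> joined b w \<alpha> \<longleftrightarrow> s \<in> S \<and> (s' = nxt b w \<alpha> s \<or> s' = prv b w \<alpha> s)"
  by (auto simp: joined_def nxt_def prv_def)

text \<open>\<open>joined\<close> allows both directions along \<open>nxt\<close>; backward steps
  are harmless because the orbits are cycles.\<close>

lemma circle_eq:
  assumes "s \<in> S"
  shows "circle b w \<alpha> s = {t. orbit_rel (nxt b w \<alpha>) s t}"
proof -
  interpret f: finite_permutation S "nxt b w \<alpha>" by (rule perm)
  have "t \<in> S \<and> orbit_rel (nxt b w \<alpha>) s t" if "(s, t) \<in> (joined b w \<alpha>)\<^sup>*" for t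
    using that
  proof (induction rule: rtrancl_induct)
    case (step t u)
    have "orbit_rel (nxt b w \<alpha>) t u"
    proof -
      consider "u = nxt b w \<alpha> t" | "u = prv b w \<alpha> t"
        using step by (auto simp: joined_iff)
      then show ?thesis
      proof cases
        case 2
        then have "nxt b w \<alpha> u = t"
          using step by (simp add: nxt_prv)
        then show ?thesis
          using f.orbit_rel_sym[OF orbit_rel_step, of u] by simp
      qed (simp add: orbit_rel_step)
    qed
    then show ?case
      using step nxt_in[of t \<alpha>] prv_in[of t \<alpha>] orbit_rel_trans[of "nxt b w \<alpha>" s t u] by (auto simp: joined_iff)
  qed (use assms in auto)
  moreover have "(s, t) \<in> (joined b w \<alpha>)\<^sup>*" if "orbit_rel (nxt b w \<alpha>) s t" for t
    using that
  proof (induction rule: orbit_rel_induct)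
    case (step t)
    then have "(t, nxt b w \<alpha> t) \<in> joined b w \<alpha>"
      using assms f.orbit_rel_in by (auto simp: joined_iff)
    then show ?case
      using step by (meson rtrancl.rtrancl_into_rtrancl)
  qed simp
  ultimately show ?thesis
    unfolding circle_def by blast
qed

lemma circle_subset: "s \<in> S \<Longrightarrow> circle b w \<alpha> s \<subseteq> S"
  using finite_permutation.orbit_rel_in[OF perm, of \<alpha> s] by (auto simp: circle_eq)

lemma finite_circle: "s \<in> S \<Longrightarrow> finite (circle b w \<alpha> s)"
  using circle_subset finite_segments finite_subset by blast

lemma in_circle [simp]: "s \<in> circle b w \<alpha> s"
  by (simp add: circle_def)

lemma circle_eqI: "s \<in> S \<Longrightarrow> t \<in> circle b w \<alpha> s \<Longrightarrow> circle b w \<alpha> t = circle b w \<alpha> s"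
proof -
  interpret f: finite_permutation S "nxt b w \<alpha>" by (rule perm)
  assume s: "s \<in> S" and "t \<in> circle b w \<alpha> s"
  then have t: "orbit_rel (nxt b w \<alpha>) s t" "t \<in> S"
    using circle_subset[of s \<alpha>] by (auto simp: circle_eq)
  then show ?thesis
    using orbit_rel_trans[OF t(1)] orbit_rel_trans[OF f.orbit_rel_sym[OF t(1)]]
    by (auto simp: circle_eq s)
qed

lemma gen_in_circle: "s \<in> S \<Longrightarrow> label \<alpha> s \<in> circle b w \<alpha> s"
  unfolding gen_def using finite_circle in_circle by (metis Min_in empty_iff)

lemma gen_in: "s \<in> S \<Longrightarrow> label \<alpha> s \<in> S"
  using gen_in_circle circle_subset by blast

lemma gen_eq_iff_circle: "s \<in> S \<Longrightarrow> t \<in> S \<Longrightarrow> label \<alpha> s = label \<alpha> t \<longleftrightarrow> t \<in> circle b w \<alpha> s"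
  using gen_in_circle circle_eqI in_circle unfolding gen_def by metis

lemma gen_eq_iff: "s \<in> S \<Longrightarrow> t \<in> S \<Longrightarrow> label \<alpha> s = label \<alpha> t \<longleftrightarrow> orbit_rel (nxt b w \<alpha>) s t"
  by (simp add: gen_eq_iff_circle circle_eq)

lemma gen_gen [simp]: "s \<in> S \<Longrightarrow> label \<alpha> (label \<alpha> s) = label \<alpha> s"
  using gen_eq_iff_circle gen_in gen_in_circle by metis

lemma gen_nxt: "s \<in> S \<Longrightarrow> label \<alpha> (nxt b w \<alpha> s) = label \<alpha> s"
  using gen_eq_iff[of s "nxt b w \<alpha> s"] nxt_in orbit_rel_step by metis

lemma gens_subset: "gens b w \<alpha> \<subseteq> S"
  using gen_in by (auto simp: gens_def)

lemma finite_gens: "finite (gens b w \<alpha>)"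
  using finite_segments by (simp add: gens_def)

lemma gen_gens: "g \<in> gens b w \<alpha> \<Longrightarrow> label \<alpha> g = g"
  by (auto simp: gens_def)

lemma gen_in_gens: "s \<in> S \<Longrightarrow> label \<alpha> s \<in> gens b w \<alpha>"
  by (auto simp: gens_def)

section \<open>How circles change along an edge of the cube\<close>

text \<open>Multiplication by a transposition either joins or cuts cycles, so every edge is a merge
  or a split. The common orientation of all resolutions is what excludes a surgery turning one
  circle into one circle.\<close>

lemma gen_insert_iff:
  assumes "x < length w" "x \<notin> \<alpha>"
  shows "label (insert x \<alpha>) (lower_in w x) = label (insert x \<alpha>) (upper_in w x) \<longleftrightarrow>
    label \<alpha> (lower_in w x) \<noteq> label \<alpha> (upper_in w x)"
  using finite_permutation.orbit_rel_transpose_iff[OF perm lower_upper_neq(1)] points_in[OF assms(1)]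
  by (simp add: gen_eq_iff nxt_insert[OF assms])

lemma gen_merge:
  assumes "x < length w" "x \<notin> \<alpha>" "label \<alpha> (lower_in w x) \<noteq> label \<alpha> (upper_in w x)"
    and "s \<in> S" "t \<in> S"
  shows "label (insert x \<alpha>) s = label (insert x \<alpha>) t \<longleftrightarrow> label \<alpha> s = label \<alpha> t \<or>
    label \<alpha> s \<in> {label \<alpha> (lower_in w x), label \<alpha> (upper_in w x)} \<and>
    label \<alpha> t \<in> {label \<alpha> (lower_in w x), label \<alpha> (upper_in w x)}"
proof -
  interpret f: finite_permutation S "nxt b w \<alpha>" by (rule perm)
  note pts = points_in(1,2)[OF assms(1)]
  have "orbit_rel (nxt b w \<alpha> \<circ> transpose (lower_in w x) (upper_in w x)) (lower_in w x) (upper_in w x)"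
    using gen_insert_iff[OF assms(1,2)] assms(3) pts by (simp add: gen_eq_iff nxt_insert[OF assms(1,2)])
  note m = f.orbit_rel_merge[OF pts this, of s t]
  have sym: "orbit_rel (nxt b w \<alpha>) s t \<longleftrightarrow> orbit_rel (nxt b w \<alpha>) t s" for s t
    using f.orbit_rel_sym by blast
  show ?thesis
    using m assms pts sym[of t "lower_in w x"] sym[of t "upper_in w x"]
    by (simp add: gen_eq_iff nxt_insert[OF assms(1,2)])
qed

text \<open>Seen from the far end of the edge a split is a merge: a transposition is an involution,
  so \<open>\<alpha>\<close> arises from \<open>insert x \<alpha>\<close> by the same
  surgery.\<close>

lemma gen_split:
  assumes "x < length w" "x \<notin> \<alpha>" "label \<alpha> (lower_in w x) = label \<alpha> (upper_in w x)"
    and "s \<in> S" "t \<in> S"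
  shows "label \<alpha> s = label \<alpha> t \<longleftrightarrow> label (insert x \<alpha>) s = label (insert x \<alpha>) t \<or>
    label (insert x \<alpha>) s \<in> {label (insert x \<alpha>) (lower_in w x), label (insert x \<alpha>) (upper_in w x)} \<and>
    label (insert x \<alpha>) t \<in> {label (insert x \<alpha>) (lower_in w x), label (insert x \<alpha>) (upper_in w x)}"
proof -
  interpret f: finite_permutation S "nxt b w (insert x \<alpha>)" by (rule perm)
  note pts = points_in(1,2)[OF assms(1)]
  have eq: "nxt b w \<alpha> = nxt b w (insert x \<alpha>) \<circ> transpose (lower_in w x) (upper_in w x)"
    by (simp add: nxt_insert[OF assms(1,2)] comp_assoc)
  then have "orbit_rel (nxt b w (insert x \<alpha>) \<circ> transpose (lower_in w x) (upper_in w x)) (lower_in w x) (upper_in w x)"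
    using assms(3) pts by (simp add: gen_eq_iff)
  note m = f.orbit_rel_merge[OF pts this, folded eq, of s t]
  have sym: "orbit_rel (nxt b w (insert x \<alpha>)) s t \<longleftrightarrow> orbit_rel (nxt b w (insert x \<alpha>)) t s" for s t
    using f.orbit_rel_sym by blast
  show ?thesis
    using m assms pts sym[of t "lower_in w x"] sym[of t "upper_in w x"]
    by (simp add: gen_eq_iff)
qed

section \<open>Edge maps in terms of the incoming segments\<close>

lemma arc_eq:
  assumes "x < length w" "d \<in> arc_dirs w \<alpha> x"
  shows "arc w x d = {(arc_in w x d, odd (snd (arc_in w x d))),
    (nxt b w \<alpha> (arc_in w x d), even (snd (nxt b w \<alpha> (arc_in w x d))))}"
  using assms points_in(3)[OF assms(1), of d]
  by (cases d) (auto simp: arc_in_def lower_in_def upper_in_def nxt_def arc_dirs_def at_crossing_def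
      other_strand_def split: if_splits)

lemma arc_gen_eq:
  assumes "x < length w" "d \<in> arc_dirs w \<alpha> x"
  shows "arc_gen b w \<alpha> x d = label \<alpha> (arc_in w x d)"
  unfolding arc_gen_def arc_eq[OF assms]
  using gen_nxt[OF points_in(3)[OF assms(1)]] by (intro the_equality) auto

lemma gen_arc_in_eq_iff:
  "label \<alpha> (arc_in w x (opposite d)) = label \<alpha> (arc_in w x d) \<longleftrightarrow>
    label \<alpha> (lower_in w x) = label \<alpha> (upper_in w x)"
  by (cases d) (auto simp: arc_in_def)

definition splits_at :: "vertex \<Rightarrow> nat \<Rightarrow> bool" where
  "splits_at \<alpha> x \<longleftrightarrow> label \<alpha> (lower_in w x) = label \<alpha> (upper_in w x)"

definition edge_fun :: "(nat \<Rightarrow> direction) \<Rightarrow> vertex \<Rightarrow> nat \<Rightarrow> segment \<Rightarrow> segment" where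
  "edge_fun A \<alpha> x = (if splits_at \<alpha> x
     then (label (insert x \<alpha>))(label \<alpha> (lower_in w x) := label (insert x \<alpha>) (tail1 w A x))
     else label (insert x \<alpha>))"

text \<open>The splitting condition and the vertex \<open>\<gamma>\<close> are separate arguments so
  that, in a composite along a face, the factors of both edges can be written over the terminal
  vertex of the face.\<close>

definition edge_diff :: "(nat \<Rightarrow> direction) \<Rightarrow> bool \<Rightarrow> vertex \<Rightarrow> nat \<Rightarrow> (segment, 'r::comm_ring_1) ext \<Rightarrow> (segment, 'r) ext" where
  "edge_diff A c \<gamma> x \<omega> =
     (if c then gen_diff (label \<gamma> (tail1 w A x)) (label \<gamma> (head1 w A x)) \<omega> else \<omega>)"

lemma edge_map_eq:
  assumes "arrow_choice w A" "x \<in> crossings w - \<alpha>"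
  shows "edge_map b w A \<alpha> x \<omega> =
    edge_diff A (splits_at \<alpha> x) (insert x \<alpha>) x (ext_map (gens b w \<alpha>) (edge_fun A \<alpha> x) \<omega>)"
proof -
  have x: "x < length w" "x \<notin> \<alpha>" and x': "x \<in> crossings w"
    using assms by auto
  note d0 = arrow_choice_arc_dirs(1)[OF assms(1) x' x(2)]
  note d1 = arrow_choice_arc_dirs(2)[OF assms(1) x', of "insert x \<alpha>", simplified]
  have "label \<alpha> (tail0 w A x) = label \<alpha> (lower_in w x)" if "splits_at \<alpha> x"
    using that arc_in_cases[of w x "opposite (A x)"] by (auto simp: splits_at_def)
  then show ?thesis
    using gen_arc_in_eq_iff[of \<alpha> x "A x"]
    by (simp add: edge_map_def Let_def arc_gen_eq[OF x(1)] d0 d1 arc_dirs_opposite splits_at_def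
        edge_diff_def edge_fun_def gen_diff_def wedge_diff_left)
qed

end

section \<open>The even-odd rule\<close>

text \<open>The even-odd rule for the point just to the right of \<open>s\<close>. The set is
  arbitrary rather than a single circle, because unions of circles occur as well.\<close>

definition right_even :: "nat \<Rightarrow> segment set \<Rightarrow> segment \<Rightarrow> bool" where
  "right_even b C s \<longleftrightarrow> even (card {j'. snd s < j' \<and> j' \<le> b \<and> (fst s, j') \<in> C})"

lemma right_even_last: "right_even b C (t, b)"
proof -
  have "{j'. snd (t, b) < j' \<and> j' \<le> b \<and> (fst (t, b), j') \<in> C} = {}"
    by auto
  then show ?thesis
    unfolding right_even_def by (simp only: card.empty even_zero)
qed

lemma right_even_step:
  assumes "j < b"
  shows "right_even b C (t, j) \<longleftrightarrow> (right_even b C (t, Suc j) \<longleftrightarrow> (t, Suc j) \<notin> C)"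
proof -
  have fin: "finite {j'. Suc j < j' \<and> j' \<le> b \<and> (t, j') \<in> C}"
    by (rule finite_subset[of _ "{..b}"]) auto
  have "{j'. j < j' \<and> j' \<le> b \<and> (t, j') \<in> C} =
      (if (t, Suc j) \<in> C then insert (Suc j) {j'. Suc j < j' \<and> j' \<le> b \<and> (t, j') \<in> C}
       else {j'. Suc j < j' \<and> j' \<le> b \<and> (t, j') \<in> C})"
    using assms by (auto simp: Suc_lessI) (metis Suc_lessI)+
  then show ?thesis
    using fin by (simp add: right_even_def)
qed

lemma right_even_Un:
  assumes "C \<inter> C' = {}"
  shows "right_even b (C \<union> C') s \<longleftrightarrow> (right_even b C s \<longleftrightarrow> right_even b C' s)"
proof -
  let ?J = "\<lambda>C. {j'. snd s < j' \<and> j' \<le> b \<and> (fst s, j') \<in> C}"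
  have "finite (?J C)" for C
    by (rule finite_subset[of _ "{..b}"]) auto
  moreover have "?J (C \<union> C') = ?J C \<union> ?J C'" "?J C \<inter> ?J C' = {}"
    using assms by auto
  ultimately show ?thesis
    by (simp add: right_even_def card_Un_disjoint)
qed

context braid_diagram
begin

text \<open>Within the diagram, \<open>C\<close> is a union of circles of
  \<open>\<alpha>\<close>.\<close>

definition saturated :: "vertex \<Rightarrow> segment set \<Rightarrow> bool" where
  "saturated \<alpha> C \<longleftrightarrow> (\<forall>s\<in>S. \<forall>t\<in>S. label \<alpha> s = label \<alpha> t \<longrightarrow> (s \<in> C \<longleftrightarrow> t \<in> C))"

lemma gen_prv: "s \<in> S \<Longrightarrow> label \<alpha> (prv b w \<alpha> s) = label \<alpha> s"
  using gen_nxt[OF prv_in[of s \<alpha>], of \<alpha>] nxt_prv[of s \<alpha>] by simp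

lemma gen_above: "s \<in> S \<Longrightarrow> label \<alpha> (above w \<alpha> s) = label \<alpha> s"
  using gen_nxt[of s \<alpha>] gen_prv[of s \<alpha>] by (auto simp: nxt_def prv_def split: if_splits)

lemma gen_below: "s \<in> S \<Longrightarrow> label \<alpha> (below w \<alpha> s) = label \<alpha> s"
  using gen_nxt[of s \<alpha>] gen_prv[of s \<alpha>] by (auto simp: nxt_def prv_def split: if_splits)

lemma saturated_above: "saturated \<alpha> C \<Longrightarrow> s \<in> S \<Longrightarrow> above w \<alpha> s \<in> C \<longleftrightarrow> s \<in> C"
  using gen_above[of s \<alpha>] above_in[of s \<alpha>] unfolding saturated_def by blast

lemma saturated_below: "saturated \<alpha> C \<Longrightarrow> s \<in> S \<Longrightarrow> below w \<alpha> s \<in> C \<longleftrightarrow> s \<in> C"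
  using gen_below[of s \<alpha>] below_in[of s \<alpha>] unfolding saturated_def by blast

lemma in_segments_iff: "(t, j) \<in> S \<longleftrightarrow> t \<le> length w \<and> 1 \<le> j \<and> j \<le> b"
  by (simp add: segments_def)

lemma saturated_closing:
  "saturated \<alpha> C \<Longrightarrow> 1 \<le> j \<Longrightarrow> j \<le> b \<Longrightarrow> (length w, j) \<in> C \<longleftrightarrow> (0, j) \<in> C"
  using saturated_above[of \<alpha> C "(length w, j)"] by (simp add: in_segments_iff)

lemma saturated_vertical:
  "saturated \<alpha> C \<Longrightarrow> t < length w \<Longrightarrow> 1 \<le> j \<Longrightarrow> j \<le> b \<Longrightarrow> \<not> at_crossing w t j \<or> vertical w \<alpha> t \<Longrightarrow>
    (t, j) \<in> C \<longleftrightarrow> (Suc t, j) \<in> C"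
  using saturated_above[of \<alpha> C "(t, j)"] by (auto simp: in_segments_iff)

lemma saturated_turn:
  assumes "saturated \<alpha> C" "t < length w" "\<not> vertical w \<alpha> t"
  shows "(t, strand (w ! t)) \<in> C \<longleftrightarrow> (t, Suc (strand (w ! t))) \<in> C"
    "(Suc t, strand (w ! t)) \<in> C \<longleftrightarrow> (Suc t, Suc (strand (w ! t))) \<in> C"
  using saturated_above[OF assms(1), of "(t, strand (w ! t))"]
    saturated_below[OF assms(1), of "(Suc t, strand (w ! t))"] strand_bounds[OF assms(2)] assms(2,3)
  by (simp_all add: in_segments_iff at_crossing_def other_strand_def)

text \<open>Compare the rays at the two heights from right to left. Away from a turn the strands
  correspond. The two strands of a turn are met both or not at all at each height, so they are
  skipped together. The excluded position is the one between these two strands.\<close>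

lemma right_even_vertical:
  assumes "saturated \<alpha> C" "t < length w" "j \<le> b" "vertical w \<alpha> t \<or> j \<noteq> strand (w ! t)"
  shows "right_even b C (t, j) \<longleftrightarrow> right_even b C (Suc t, j)"
  using assms(3,4)
proof (induction "b - j" arbitrary: j rule: less_induct)
  case less
  let ?i = "strand (w ! t)"
  show ?case
  proof (cases "j = b")
    case True
    then show ?thesis
      by (simp add: right_even_last)
  next
    case False
    then have j: "j < b"
      using less.prems by simp
    show ?thesis
    proof (cases "\<not> vertical w \<alpha> t \<and> Suc j = ?i")
      case True
      then have "Suc j < b"
        using strand_bounds[OF assms(2)] by simp
      moreover have "right_even b C (t, Suc (Suc j)) \<longleftrightarrow> right_even b C (Suc t, Suc (Suc j))"
        using \<open>Suc j < b\<close> True by (intro less.hyps) auto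
      moreover have "(t, Suc j) \<in> C \<longleftrightarrow> (t, Suc (Suc j)) \<in> C" "(Suc t, Suc j) \<in> C \<longleftrightarrow> (Suc t, Suc (Suc j)) \<in> C"
        using saturated_turn[OF assms(1,2)] True by simp_all
      ultimately show ?thesis
        using j by (simp add: right_even_step) blast
    next
      case ne: False
      then have "right_even b C (t, Suc j) \<longleftrightarrow> right_even b C (Suc t, Suc j)"
        using j by (intro less.hyps) auto
      moreover have "(t, Suc j) \<in> C \<longleftrightarrow> (Suc t, Suc j) \<in> C"
        using less.prems ne j by (intro saturated_vertical[OF assms(1,2)]) (auto simp: at_crossing_def)
      ultimately show ?thesis
        using j by (simp add: right_even_step)
    qed
  qed
qed

lemma right_even_turn:
  assumes "t' = t \<or> t' = Suc t" "saturated \<alpha> C" "t < length w" "\<not> vertical w \<alpha> t" "at_crossing w t j"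
  shows "(t', j) \<notin> C \<Longrightarrow> right_even b C (t', other_strand w t j) \<longleftrightarrow> right_even b C (t', j)"
    "(t', j) \<in> C \<Longrightarrow> right_even b C (t', other_strand w t j) \<longleftrightarrow> \<not> right_even b C (t', j)"
  using right_even_step[of "strand (w ! t)" b C t'] saturated_turn[OF assms(2-4)] strand_bounds[OF assms(3)]
    assms(1,5) by (auto simp: at_crossing_def other_strand_def)

lemma right_even_closing:
  assumes "saturated \<alpha> C"
  shows "right_even b C (length w, j) \<longleftrightarrow> right_even b C (0, j)"
proof -
  have "{j'. j < j' \<and> j' \<le> b \<and> (length w, j') \<in> C} = {j'. j < j' \<and> j' \<le> b \<and> (0, j') \<in> C}"
    using saturated_closing[OF assms] by auto
  then show ?thesis
    by (simp add: right_even_def)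
qed

text \<open>Off \<open>C\<close>, a curve stays on one side of \<open>C\<close>. On
  \<open>C\<close>, the parity just to the right of the curve changes exactly where the curve
  switches between running up and running down; comparing it with the parity of the strand, which
  records the direction, yields a constant again.\<close>

definition same_parity :: "segment set \<Rightarrow> segment \<Rightarrow> segment \<Rightarrow> bool" where
  "same_parity C s s' \<longleftrightarrow> (s \<notin> C \<longrightarrow> (right_even b C s' \<longleftrightarrow> right_even b C s)) \<and>
    (s \<in> C \<longrightarrow> ((right_even b C s' \<longleftrightarrow> odd (snd s')) \<longleftrightarrow> (right_even b C s \<longleftrightarrow> odd (snd s))))"

lemma same_parity_above:
  assumes sat: "saturated \<alpha> C" and s: "s \<in> S"
  shows "same_parity C s (above w \<alpha> s)"
proof -
  obtain t j where tj: "s = (t, j)" "t \<le> length w" "1 \<le> j" "j \<le> b"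
    using s by (cases s) (simp add: in_segments_iff)
  consider "t = length w" | "t < length w" "at_crossing w t j" "\<not> vertical w \<alpha> t"
    | "t < length w" "\<not> at_crossing w t j \<or> vertical w \<alpha> t"
    using tj by linarith
  then show ?thesis
  proof cases
    case 1
    then show ?thesis
      using right_even_closing[OF sat, of j] by (simp add: same_parity_def tj)
  next
    case 2
    then show ?thesis
      using right_even_turn[of t t, OF _ sat] by (auto simp: same_parity_def tj)
  next
    case 3
    then have "right_even b C (t, j) \<longleftrightarrow> right_even b C (Suc t, j)"
      using tj by (intro right_even_vertical[OF sat]) (auto simp: at_crossing_def)
    then show ?thesis
      using 3 by (auto simp: same_parity_def tj)
  qed
qed

lemma same_parity_below:
  assumes sat: "saturated \<alpha> C" and s: "s \<in> S"
  shows "same_parity C s (below w \<alpha> s)"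
proof -
  obtain t j where tj: "s = (t, j)" "t \<le> length w" "1 \<le> j" "j \<le> b"
    using s by (cases s) (simp add: in_segments_iff)
  consider "t = 0" | t' where "t = Suc t'" "at_crossing w t' j" "\<not> vertical w \<alpha> t'"
    | t' where "t = Suc t'" "\<not> at_crossing w t' j \<or> vertical w \<alpha> t'"
    by (cases t) auto
  then show ?thesis
  proof cases
    case 1
    then show ?thesis
      using right_even_closing[OF sat, of j] by (simp add: same_parity_def tj)
  next
    case 2
    then show ?thesis
      using right_even_turn[of "Suc t'" t', OF _ sat] tj by (auto simp: same_parity_def)
  next
    case 3
    then have "right_even b C (t', j) \<longleftrightarrow> right_even b C (Suc t', j)"
      using tj by (intro right_even_vertical[OF sat]) (auto simp: at_crossing_def)
    then show ?thesis
      using 3 by (auto simp: same_parity_def tj)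
  qed
qed

lemma same_parity_nxt: "saturated \<alpha> C \<Longrightarrow> s \<in> S \<Longrightarrow> same_parity C s (nxt b w \<alpha> s)"
  using same_parity_above[of \<alpha> C s] same_parity_below[of \<alpha> C s] by (simp add: nxt_def)

lemma same_parity:
  assumes sat: "saturated \<alpha> C" and st: "s \<in> S" "t \<in> S" "label \<alpha> s = label \<alpha> t"
  shows "same_parity C s t"
proof -
  interpret f: finite_permutation S "nxt b w \<alpha>" by (rule perm)
  have "orbit_rel (nxt b w \<alpha>) s t"
    using st by (simp add: gen_eq_iff)
  then show ?thesis
  proof (induction rule: orbit_rel_induct)
    case (step t)
    then have t: "t \<in> S" "label \<alpha> s = label \<alpha> t"
      using st f.orbit_rel_in[of s t] by (auto simp: gen_eq_iff)
    then have "s \<in> C \<longleftrightarrow> t \<in> C"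
      using sat st unfolding saturated_def by blast
    then show ?case
      using step.IH same_parity_nxt[OF sat t(1)] unfolding same_parity_def by blast
  qed (simp add: same_parity_def)
qed

lemma saturated_circle: "s \<in> S \<Longrightarrow> saturated \<alpha> (circle b w \<alpha> s)"
  unfolding saturated_def using gen_eq_iff_circle[of s _ \<alpha>] by metis

lemma right_even_const:
  assumes "saturated \<alpha> C" "s \<in> S" "t \<in> S" "label \<alpha> s = label \<alpha> t" "s \<notin> C"
  shows "right_even b C t \<longleftrightarrow> right_even b C s"
  using same_parity[OF assms(1-4)] assms(5) by (simp add: same_parity_def)

text \<open>Says that the counterclockwise orientation of the circle through \<open>s\<close> agrees
  with \<open>nxt\<close>, which runs upwards on odd strands. By \<open>oriented_up_const\<close>
  this is a property of the circle.\<close>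

definition oriented_up :: "vertex \<Rightarrow> segment \<Rightarrow> bool" where
  "oriented_up \<alpha> s \<longleftrightarrow> (ccw_up b w \<alpha> s \<longleftrightarrow> odd (snd s))"

lemma ccw_up_eq: "ccw_up b w \<alpha> s \<longleftrightarrow> right_even b (circle b w \<alpha> s) s"
  by (cases s) (simp add: right_even_def)

lemma oriented_up_const:
  assumes "s \<in> S" "t \<in> S" "label \<alpha> s = label \<alpha> t"
  shows "oriented_up \<alpha> s \<longleftrightarrow> oriented_up \<alpha> t"
proof -
  have "circle b w \<alpha> t = circle b w \<alpha> s"
    using assms circle_eqI gen_eq_iff_circle by metis
  then show ?thesis
    using same_parity[OF saturated_circle[OF assms(1)] assms] in_circle[of s \<alpha>]
    by (simp add: oriented_up_def ccw_up_eq same_parity_def)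
qed

text \<open>
  A point of the region between the two arcs at \<open>x\<close>. When the arcs belong to different circles, the
  parity there is determined by the position of either circle relative to the other one, hence it is
  the same at all crossings joining these two circles. This replaces the Jordan curve theorem.
\<close>

definition gap :: "vertex \<Rightarrow> nat \<Rightarrow> segment" where
  "gap \<alpha> x = (x, if vertical w \<alpha> x then strand (w ! x) else Suc (strand (w ! x)))"

text \<open>The gap is not separated by \<open>C1\<close> from the arc of \<open>C2\<close>
  bordering it, nor by \<open>C2\<close> from the arc of \<open>C1\<close>, and along these circles
  both parities are constant. The right side depends on \<open>y\<close> only through the two
  circles and is symmetric in them.\<close>

lemma right_even_gap:
  assumes y: "y < length w"
    and ne: "label \<alpha> (lower_in w y) \<noteq> label \<alpha> (upper_in w y)"
  defines "C1 \<equiv> circle b w \<alpha> (lower_in w y)" and "C2 \<equiv> circle b w \<alpha> (upper_in w y)"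
  shows "right_even b (C1 \<union> C2) (gap \<alpha> y) \<longleftrightarrow> (right_even b C1 (upper_in w y) \<longleftrightarrow> right_even b C2 (lower_in w y))"
proof -
  let ?i = "strand (w ! y)"
  note pts = points_in(1,2)[OF y]
  note ib = strand_bounds[OF y]
  have sat: "saturated \<alpha> C1" "saturated \<alpha> C2"
    unfolding C1_def C2_def by (rule saturated_circle[OF pts(1)], rule saturated_circle[OF pts(2)])
  have C1: "s \<in> C1 \<longleftrightarrow> label \<alpha> s = label \<alpha> (lower_in w y)"
    and C2: "s \<in> C2 \<longleftrightarrow> label \<alpha> s = label \<alpha> (upper_in w y)" if "s \<in> S" for s
    using that pts gen_eq_iff_circle[of "lower_in w y" s \<alpha>] gen_eq_iff_circle[of "upper_in w y" s \<alpha>]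
    by (auto simp: C1_def C2_def)
  have "C1 \<inter> C2 = {}"
    using C1 C2 ne circle_subset[OF pts(1), of \<alpha>] by (auto simp: C1_def)
  then have un: "right_even b (C1 \<union> C2) s \<longleftrightarrow> (right_even b C1 s \<longleftrightarrow> right_even b C2 s)" for s
    by (rule right_even_Un)
  have onC1: "right_even b C2 s \<longleftrightarrow> right_even b C2 (lower_in w y)"
    if "s \<in> S" "label \<alpha> s = label \<alpha> (lower_in w y)" for s
    using that pts ne C2[of "lower_in w y"] by (intro right_even_const[OF sat(2)]) auto
  have onC2: "right_even b C1 s \<longleftrightarrow> right_even b C1 (upper_in w y)"
    if "s \<in> S" "label \<alpha> s = label \<alpha> (upper_in w y)" for s
    using that pts ne C1[of "upper_in w y"] by (intro right_even_const[OF sat(1)]) auto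
  have S: "(y, ?i) \<in> S" "(y, Suc ?i) \<in> S" "(Suc y, ?i) \<in> S" "(Suc y, Suc ?i) \<in> S"
    using y ib by (auto simp: in_segments_iff)
  note nx = nxt_lower_upper[OF y, of \<alpha>] gen_nxt[OF pts(1), of \<alpha>] gen_nxt[OF pts(2), of \<alpha>]
  show ?thesis
  proof (cases "vertical w \<alpha> y")
    case True
    have st: "right_even b C (y, ?i) \<longleftrightarrow> (right_even b C (y, Suc ?i) \<longleftrightarrow> (y, Suc ?i) \<notin> C)" for C
      using ib by (intro right_even_step) simp
    show ?thesis
    proof (cases "odd ?i")
      case o: True
      have g: "label \<alpha> (y, ?i) = label \<alpha> (lower_in w y)" "label \<alpha> (y, Suc ?i) = label \<alpha> (upper_in w y)"
        using nx True o by (auto simp: lower_in_def upper_in_def)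
      then have "(y, Suc ?i) \<notin> C1"
        using C1 S ne by auto
      then show ?thesis
        using st[of C1] onC1[OF S(1) g(1)] onC2[OF S(2) g(2)] True by (auto simp: un gap_def)
    next
      case o: False
      have g: "label \<alpha> (y, ?i) = label \<alpha> (upper_in w y)" "label \<alpha> (y, Suc ?i) = label \<alpha> (lower_in w y)"
        using nx True o by (auto simp: lower_in_def upper_in_def)
      then have "(y, Suc ?i) \<notin> C2"
        using C2 S ne by auto
      then show ?thesis
        using st[of C2] onC2[OF S(1) g(1)] onC1[OF S(2) g(2)] True by (auto simp: un gap_def)
    qed
  next
    case False
    have g: "label \<alpha> (y, Suc ?i) = label \<alpha> (lower_in w y)" "label \<alpha> (Suc y, Suc ?i) = label \<alpha> (upper_in w y)"
      using nx False by (auto simp: lower_in_def upper_in_def split: if_splits)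
    have "right_even b C1 (y, Suc ?i) \<longleftrightarrow> right_even b C1 (Suc y, Suc ?i)"
      using y ib by (intro right_even_vertical[OF sat(1)]) auto
    then show ?thesis
      using onC1[OF S(2) g(1)] onC2[OF S(4) g(2)] False by (simp add: un gap_def) 
  qed
qed

section \<open>Arrows with both ends on one circle\<close>

definition inside :: "vertex \<Rightarrow> nat \<Rightarrow> bool" where
  "inside \<alpha> x \<longleftrightarrow> \<not> right_even b (circle b w \<alpha> (lower_in w x)) (gap \<alpha> x)"

text \<open>Two arrows on a circle have alternating ends exactly if the surgery along one of them
  separates the ends of the other.\<close>

definition interleaved :: "vertex \<Rightarrow> nat \<Rightarrow> nat \<Rightarrow> bool" where
  "interleaved \<alpha> x y \<longleftrightarrow> splits_at \<alpha> x \<and> splits_at \<alpha> y \<and> \<not> splits_at (insert x \<alpha>) y"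

lemma splits_at_insert:
  "x < length w \<Longrightarrow> x \<notin> \<alpha> \<Longrightarrow> splits_at (insert x \<alpha>) x \<longleftrightarrow> \<not> splits_at \<alpha> x"
  using gen_insert_iff by (simp add: splits_at_def)

lemma arrow_inside_eq:
  assumes "arrow_choice w A" "x \<in> crossings w - \<alpha>" "splits_at \<alpha> x"
  shows "arrow_inside b w A \<alpha> x \<longleftrightarrow> inside \<alpha> x"
proof -
  have x: "x < length w" "x \<notin> \<alpha>" "x \<in> crossings w"
    using assms by auto
  have "arc_gen b w \<alpha> x (opposite (A x)) = label \<alpha> (tail0 w A x)"
    using arrow_choice_arc_dirs(1)[OF assms(1) x(3,2)] arc_dirs_opposite by (intro arc_gen_eq x) auto
  also have "\<dots> = label \<alpha> (lower_in w x)"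
    using assms(3) arc_in_cases[of w x "opposite (A x)"] by (auto simp: splits_at_def)
  also have "circle b w \<alpha> \<dots> = circle b w \<alpha> (lower_in w x)"
    using points_in[OF x(1)] gen_in_circle by (intro circle_eqI) auto
  finally show ?thesis
    by (simp add: arrow_inside_def inside_def right_even_def gap_def if_distrib[of "\<lambda>k. k < _"] cong: if_cong)
qed

text \<open>Performing \<open>x\<close> and then \<open>y\<close> splits the circle and joins it
  again, so at the terminal vertex the two ends of \<open>x\<close> share a circle. Hence the edge
  along \<open>x\<close> that ends there is a merge.\<close>

lemma interleaved_sym:
  assumes "x < length w" "y < length w" "x \<notin> \<alpha>" "y \<notin> \<alpha>" "x \<noteq> y" "interleaved \<alpha> x y"
  shows "interleaved \<alpha> y x"
proof -
  have i: "insert x (insert y \<alpha>) = insert y (insert x \<alpha>)" by auto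
  note pts = points_in(1,2)[OF assms(1)] points_in(1,2)[OF assms(2)]
  have "splits_at (insert y (insert x \<alpha>)) x"
    unfolding splits_at_def
    using assms pts gen_split[of x \<alpha> "lower_in w y" "upper_in w y"]
    by (subst gen_merge) (auto simp: interleaved_def splits_at_def)
  then have "\<not> splits_at (insert y \<alpha>) x"
    using splits_at_insert[of x "insert y \<alpha>"] assms i by auto
  then show ?thesis
    using assms by (simp add: interleaved_def)
qed

lemma interleaved_gens:
  assumes "x < length w" "y < length w" "x \<notin> \<alpha>" "y \<notin> \<alpha>" "x \<noteq> y" "interleaved \<alpha> x y"
  shows "label \<alpha> (lower_in w y) = label \<alpha> (lower_in w x)"
    and "{label (insert x \<alpha>) (lower_in w y), label (insert x \<alpha>) (upper_in w y)} =
      {label (insert x \<alpha>) (lower_in w x), label (insert x \<alpha>) (upper_in w x)}"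
proof -
  note pts = points_in(1,2)[OF assms(1)] points_in(1,2)[OF assms(2)]
  have *: "label (insert x \<alpha>) (lower_in w y) \<noteq> label (insert x \<alpha>) (upper_in w y)"
    "label (insert x \<alpha>) (lower_in w y) \<in> {label (insert x \<alpha>) (lower_in w x), label (insert x \<alpha>) (upper_in w x)}"
    "label (insert x \<alpha>) (upper_in w y) \<in> {label (insert x \<alpha>) (lower_in w x), label (insert x \<alpha>) (upper_in w x)}"
    using assms pts gen_split[of x \<alpha> "lower_in w y" "upper_in w y"]
    by (auto simp: interleaved_def splits_at_def)
  then show "{label (insert x \<alpha>) (lower_in w y), label (insert x \<alpha>) (upper_in w y)} =
      {label (insert x \<alpha>) (lower_in w x), label (insert x \<alpha>) (upper_in w x)}"
    by auto
  show "label \<alpha> (lower_in w y) = label \<alpha> (lower_in w x)"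
    using * assms pts gen_split[of x \<alpha> "lower_in w y" "lower_in w x"]
    by (auto simp: interleaved_def splits_at_def)
qed

text \<open>
  After the surgery at \<open>x\<close> both \<open>x\<close> and \<open>y\<close> join the same two circles, and the surgery moves the
  arrow at \<open>x\<close> to the other side of the original circle.
\<close>

lemma inside_iff_not_inside:
  assumes "x < length w" "y < length w" "x \<notin> \<alpha>" "y \<notin> \<alpha>" "x \<noteq> y" "interleaved \<alpha> x y"
  shows "inside \<alpha> x \<longleftrightarrow> \<not> inside \<alpha> y"
proof -
  let ?\<beta> = "insert x \<alpha>"
  define C1 where "C1 = circle b w ?\<beta> (lower_in w x)"
  define C2 where "C2 = circle b w ?\<beta> (upper_in w x)"
  note pts = points_in(1,2)[OF assms(1)] points_in(1,2)[OF assms(2)]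
  have sx: "splits_at \<alpha> x" and nx: "label ?\<beta> (lower_in w x) \<noteq> label ?\<beta> (upper_in w x)"
    and ny: "label ?\<beta> (lower_in w y) \<noteq> label ?\<beta> (upper_in w y)"
    using assms splits_at_insert[of x \<alpha>] by (auto simp: interleaved_def splits_at_def)
  have circ: "circle b w \<alpha> (lower_in w x) = C1 \<union> C2"
  proof -
    have "s \<in> circle b w \<alpha> (lower_in w x) \<longleftrightarrow> s \<in> C1 \<union> C2" if "s \<in> S" for s
      using that pts gen_split[OF assms(1,3) _ pts(1) that] sx
        gen_eq_iff_circle[OF pts(1) that, of \<alpha>] gen_eq_iff_circle[OF pts(1) that, of ?\<beta>]
        gen_eq_iff_circle[OF pts(2) that, of ?\<beta>]
      by (auto simp: C1_def C2_def splits_at_def)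
    then show ?thesis
      using circle_subset[OF pts(1), of \<alpha>] circle_subset[OF pts(1), of ?\<beta>] circle_subset[OF pts(2), of ?\<beta>]
      unfolding C1_def C2_def by blast
  qed
  have circy: "circle b w \<alpha> (lower_in w y) = C1 \<union> C2"
    using interleaved_gens(1)[OF assms] circ circle_eqI gen_eq_iff_circle pts by metis
  have same: "circle b w ?\<beta> s = circle b w ?\<beta> t" if "label ?\<beta> s = label ?\<beta> t" "s \<in> S" "t \<in> S" for s t
    using that circle_eqI gen_eq_iff_circle by metis
  have const: "right_even b (circle b w ?\<beta> r) s \<longleftrightarrow> right_even b (circle b w ?\<beta> r) t"
    if "label ?\<beta> s = label ?\<beta> t" "label ?\<beta> r \<noteq> label ?\<beta> s" "s \<in> S" "t \<in> S" "r \<in> S" for r s t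
    using that gen_eq_iff_circle[of r t ?\<beta>] by (intro right_even_const[OF saturated_circle]) auto
  have vert: "vertical w ?\<beta> y = vertical w \<alpha> y" "vertical w ?\<beta> x \<longleftrightarrow> \<not> vertical w \<alpha> x"
    using assms by (auto simp: vertical_def)
  define B where "B \<longleftrightarrow> (right_even b C1 (upper_in w x) \<longleftrightarrow> right_even b C2 (lower_in w x))"
  have "right_even b (C1 \<union> C2) (gap \<alpha> y) \<longleftrightarrow> B"
  proof -
    \<comment> \<open>The arrow at \<open>y\<close> joins the same two circles as \<open>x\<close>,
      possibly in the other order; the parity in the gap is symmetric in them.\<close>
    consider "label ?\<beta> (lower_in w y) = label ?\<beta> (lower_in w x)" "label ?\<beta> (upper_in w y) = label ?\<beta> (upper_in w x)"
      | "label ?\<beta> (lower_in w y) = label ?\<beta> (upper_in w x)" "label ?\<beta> (upper_in w y) = label ?\<beta> (lower_in w x)"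
      using interleaved_gens(2)[OF assms] ny by (auto simp: doubleton_eq_iff)
    then show ?thesis
    proof cases
      case 1
      then have "right_even b C1 (upper_in w y) \<longleftrightarrow> right_even b C1 (upper_in w x)"
        "right_even b C2 (lower_in w y) \<longleftrightarrow> right_even b C2 (lower_in w x)"
        using nx pts unfolding C1_def C2_def by (intro const; simp)+
      then show ?thesis
        using right_even_gap[OF assms(2) ny] same[OF 1(1)] same[OF 1(2)] pts vert(1)
        by (simp add: B_def C1_def C2_def gap_def)
    next
      case 2
      then have "right_even b C1 (lower_in w y) \<longleftrightarrow> right_even b C1 (upper_in w x)"
        "right_even b C2 (upper_in w y) \<longleftrightarrow> right_even b C2 (lower_in w x)"
        using nx pts unfolding C1_def C2_def by (intro const; simp)+
      then show ?thesis
        using right_even_gap[OF assms(2) ny] same[OF 2(1)] same[OF 2(2)] pts vert(1)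
        by (auto simp: B_def C1_def C2_def gap_def Un_commute)
    qed
  qed
  moreover have "right_even b (C1 \<union> C2) (gap ?\<beta> x) \<longleftrightarrow> B"
    using right_even_gap[OF assms(1) nx] by (simp add: B_def C1_def C2_def)
  \<comment> \<open>The gaps before and after the surgery are neighbouring positions at height
    \<open>x\<close>, separated by the strand \<open>Suc ?i\<close>, which belongs to the
    circle.\<close>
  moreover have "right_even b (C1 \<union> C2) (gap \<alpha> x) \<longleftrightarrow> \<not> right_even b (C1 \<union> C2) (gap ?\<beta> x)"
  proof -
    let ?i = "strand (w ! x)"
    have "(x, Suc ?i) \<in> S"
      using strand_bounds[OF assms(1)] assms(1) by (simp add: in_segments_iff)
    moreover have "label \<alpha> (x, Suc ?i) = label \<alpha> (lower_in w x)"
      using nxt_lower_upper[OF assms(1), of \<alpha>] gen_nxt[OF pts(1), of \<alpha>] gen_nxt[OF pts(2), of \<alpha>] sx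
      by (auto simp: lower_in_def upper_in_def splits_at_def split: if_splits)
    ultimately have "(x, Suc ?i) \<in> C1 \<union> C2"
      using gen_eq_iff_circle[OF pts(1), of "(x, Suc ?i)" \<alpha>] circ by simp
    then show ?thesis
      using right_even_step[of ?i b "C1 \<union> C2" x] strand_bounds[OF assms(1)] vert(2) by (auto simp: gap_def)
  qed
  ultimately show ?thesis
    unfolding inside_def circ circy by blast
qed

section \<open>Counterclockwise traversal of a circle\<close>

lemma oriented_up_nxt: "s \<in> S \<Longrightarrow> oriented_up \<alpha> (nxt b w \<alpha> s) \<longleftrightarrow> oriented_up \<alpha> s"
  using gen_nxt nxt_in by (intro oriented_up_const) auto

text \<open>If the counterclockwise orientation is opposite to \<open>nxt\<close>, the arc is
  entered at the end through which \<open>nxt\<close> leaves it.\<close>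

lemma arc_pos_eq:
  assumes "x < length w" "d \<in> arc_dirs w \<alpha> x"
  shows "arc_pos b w \<alpha> x d =
    (if oriented_up \<alpha> (arc_in w x d) then arc_in w x d else nxt b w \<alpha> (arc_in w x d))"
proof -
  define p where "p = arc_in w x d"
  have "oriented_up \<alpha> (nxt b w \<alpha> p) \<longleftrightarrow> oriented_up \<alpha> p"
    using points_in[OF assms(1)] by (simp add: oriented_up_nxt p_def)
  then show ?thesis
    unfolding arc_pos_def arc_eq[OF assms] p_def[symmetric]
    by (intro the_equality) (auto simp: oriented_up_def split: if_splits)
qed

lemma ccw_next_funpow:
  assumes "s \<in> S"
  shows "(ccw_next b w \<alpha> ^^ k) s = ((if oriented_up \<alpha> s then nxt b w \<alpha> else prv b w \<alpha>) ^^ k) s"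
proof -
  have "(ccw_next b w \<alpha> ^^ k) s = ((if oriented_up \<alpha> s then nxt b w \<alpha> else prv b w \<alpha>) ^^ k) s \<and>
      (ccw_next b w \<alpha> ^^ k) s \<in> S \<and> label \<alpha> ((ccw_next b w \<alpha> ^^ k) s) = label \<alpha> s"
  proof (induction k)
    case (Suc k)
    define t where "t = (ccw_next b w \<alpha> ^^ k) s"
    have t: "t \<in> S" "label \<alpha> t = label \<alpha> s"
      "t = ((if oriented_up \<alpha> s then nxt b w \<alpha> else prv b w \<alpha>) ^^ k) s"
      using Suc unfolding t_def by blast+
    have "oriented_up \<alpha> t \<longleftrightarrow> oriented_up \<alpha> s"
      using t assms by (intro oriented_up_const) auto
    then have "ccw_next b w \<alpha> t = (if oriented_up \<alpha> s then nxt b w \<alpha> else prv b w \<alpha>) t"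
      using t(1) by (auto simp: ccw_next_def nxt_def prv_def oriented_up_def)
    moreover have "label \<alpha> ((if oriented_up \<alpha> s then nxt b w \<alpha> else prv b w \<alpha>) t) = label \<alpha> s"
      using gen_nxt[OF t(1), of \<alpha>] gen_prv[OF t(1), of \<alpha>] t(2) by simp
    moreover have "(if oriented_up \<alpha> s then nxt b w \<alpha> else prv b w \<alpha>) t \<in> S"
      using nxt_in[OF t(1), of \<alpha>] prv_in[OF t(1), of \<alpha>] by simp
    ultimately show ?case
      using t(3) by (simp flip: t_def)
  qed (use assms in simp)
  then show ?thesis by blast
qed

lemma gen_pair:
  "{label \<alpha> (arc_in w x (opposite d)), label \<alpha> (arc_in w x d)} =
    {label \<alpha> (lower_in w x), label \<alpha> (upper_in w x)}"
  by (cases d) (auto simp: arc_in_def)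

lemma gen_arc_in_mem:
  "label \<alpha> (arc_in w x d) \<in> {label \<alpha> (lower_in w x), label \<alpha> (upper_in w x)}"
  using arc_in_cases[of w x d] by auto

text \<open>Surgery along the arrow at \<open>z\<close> cuts the circle into the
  \<open>nxt\<close>-path from tail to head, which becomes the circle of the head, and the path from
  head to tail, which becomes the circle of the tail. The first end met after the tail lies on the
  former if the counterclockwise orientation follows \<open>nxt\<close>, and on the latter
  otherwise.\<close>

lemma next_endpointI:
  assumes A: "arrow_choice w A" and z: "z \<in> crossings w - \<alpha>" "z' \<in> crossings w - \<alpha>" "z \<noteq> z'"
    and il: "interleaved \<alpha> z z'" and d: "d \<in> {A z', opposite (A z')}"
    and u: "oriented_up \<alpha> (lower_in w z) \<longleftrightarrow>
      label (insert z \<alpha>) (arc_in w z' d) = label (insert z \<alpha>) (head0 w A z)"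
  shows "next_endpoint b w A \<alpha> z z' d"
proof -
  let ?\<beta> = "insert z \<alpha>" and ?f = "nxt b w \<alpha>"
  have l: "z < length w" "z' < length w" "z \<notin> \<alpha>" "z' \<notin> \<alpha>" "z \<in> crossings w" "z' \<in> crossings w"
    using z by auto
  interpret f: finite_permutation S ?f by (rule perm)
  interpret f': finite_permutation S "nxt b w ?\<beta>" by (rule perm)
  define t h u e where "t = tail0 w A z" and "h = head0 w A z" and "u = arc_in w z' d"
    and "e = arc_in w z' (opposite d)"
  note defs = t_def h_def u_def e_def
  have S: "t \<in> S" "h \<in> S" "u \<in> S" "e \<in> S"
    using points_in(3) l by (simp_all add: defs)
  have th: "{t, h} = {lower_in w z, upper_in w z}"
    unfolding defs by (rule arc_in_set)
  have ue: "{u, e} = {lower_in w z', upper_in w z'}"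
    unfolding defs using arc_in_set[of w z' d] by auto
  have "{t, h} \<inter> {u, e} = {}"
    unfolding th ue using points_neq[OF z(3)] .
  then have ne: "u \<noteq> h" "u \<noteq> t" "e \<noteq> h"
    by auto
  have tr: "nxt b w ?\<beta> = ?f \<circ> transpose t h"
    using nxt_insert[OF l(1,3)] th by (auto simp: doubleton_eq_iff transpose_commute)
  have gth: "label ?\<beta> h \<noteq> label ?\<beta> t"
    using gen_arc_in_eq_iff[of ?\<beta> z "A z"] splits_at_insert[OF l(1,3)] il
    by (auto simp: defs interleaved_def splits_at_def)
  have gue: "{label ?\<beta> u, label ?\<beta> e} = {label ?\<beta> t, label ?\<beta> h}"
    using interleaved_gens(2)[OF l(1-4) z(3) il] gen_pair[of ?\<beta> z' d] gen_pair[of ?\<beta> z "A z"]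
    by (auto simp: defs)
  have dirs: "A z \<in> arc_dirs w \<alpha> z" "opposite (A z) \<in> arc_dirs w \<alpha> z"
    "A z' \<in> arc_dirs w \<alpha> z'" "opposite (A z') \<in> arc_dirs w \<alpha> z'" "d \<in> arc_dirs w \<alpha> z'"
    using arrow_choice_arc_dirs(1)[OF A l(5,3)] arrow_choice_arc_dirs(1)[OF A l(6,4)] d arc_dirs_opposite
    by auto
  have up: "oriented_up \<alpha> s \<longleftrightarrow> oriented_up \<alpha> (lower_in w z)" if "s \<in> {t, h, u, e}" for s
  proof (rule oriented_up_const)
    show "label \<alpha> s = label \<alpha> (lower_in w z)"
      using that gen_arc_in_mem[of \<alpha> z "A z"] gen_arc_in_mem[of \<alpha> z "opposite (A z)"]
        gen_arc_in_mem[of \<alpha> z' d] gen_arc_in_mem[of \<alpha> z' "opposite d"]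
        interleaved_gens(1)[OF l(1-4) z(3) il] il
      by (auto simp: defs interleaved_def splits_at_def)
  qed (use that S points_in l in auto)
  \<comment> \<open>Against \<open>nxt\<close> all four positions are shifted by one step, in
    accordance with \<open>arc_pos_eq\<close>.\<close>
  define pos where "pos s = (if oriented_up \<alpha> (lower_in w z) then s else ?f s)" for s
  have start: "arc_pos b w \<alpha> z (opposite (A z)) = pos t"
    using arc_pos_eq[OF l(1) dirs(2)] up by (simp add: pos_def defs)
  have goal: "arc_pos b w \<alpha> z' d = pos u"
    using arc_pos_eq[OF l(2) dirs(5)] up by (simp add: pos_def defs)
  have head: "arc_pos b w \<alpha> z (A z) = pos h"
    using arc_pos_eq[OF l(1) dirs(1)] up by (simp add: pos_def defs)
  have other: "arc_pos b w \<alpha> z' (opposite d) = pos e"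
    using arc_pos_eq[OF l(2)] dirs arc_dirs_opposite up by (simp add: pos_def defs)
  have "{arc_pos b w \<alpha> y a | y a. y \<in> {z, z'} \<and> a \<in> {A y, opposite (A y)}} =
      {arc_pos b w \<alpha> z (opposite (A z)), arc_pos b w \<alpha> z (A z),
       arc_pos b w \<alpha> z' (A z'), arc_pos b w \<alpha> z' (opposite (A z'))}"
    by blast
  also have "\<dots> = {arc_pos b w \<alpha> z (opposite (A z)), arc_pos b w \<alpha> z (A z), arc_pos b w \<alpha> z' d, arc_pos b w \<alpha> z' (opposite d)}"
    using d by auto
  finally have ends: "{arc_pos b w \<alpha> y a | y a. y \<in> {z, z'} \<and> a \<in> {A y, opposite (A y)}} = {pos t, pos h, pos u, pos e}"
    by (simp only: start head goal other)
  have post: "pos t \<in> S"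
    using S(1) nxt_in by (simp add: pos_def)
  have "oriented_up \<alpha> (pos t) \<longleftrightarrow> oriented_up \<alpha> (lower_in w z)"
    using up[of t] oriented_up_nxt[OF S(1)] by (simp add: pos_def)
  then have it: "(ccw_next b w \<alpha> ^^ k) (pos t) =
      ((if oriented_up \<alpha> (lower_in w z) then ?f else inv_into UNIV ?f) ^^ k) (pos t)" for k
    using ccw_next_funpow[OF post] by (simp add: inv_nxt)
  have "\<exists>k>0. (ccw_next b w \<alpha> ^^ k) (pos t) = pos u \<and>
      (\<forall>m. 0 < m \<and> m < k \<longrightarrow> (ccw_next b w \<alpha> ^^ m) (pos t) \<notin> {pos t, pos h, pos u, pos e})"
  proof (cases "oriented_up \<alpha> (lower_in w z)")
    case True
    then have g: "label ?\<beta> h = label ?\<beta> u"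
      using assms(7) by (simp add: defs)
    have "\<exists>k>0. (?f ^^ k) t = u \<and> (\<forall>m. 0 < m \<and> m < k \<longrightarrow> (?f ^^ m) t \<notin> {t, h, u, e})"
    proof (rule f.next_visit[OF S(1,2)])
      show "orbit_rel (?f \<circ> transpose t h) h u" "\<not> orbit_rel (?f \<circ> transpose t h) h t"
        "\<not> orbit_rel (?f \<circ> transpose t h) h e"
        unfolding tr[symmetric] using g gth gue S by (auto simp flip: gen_eq_iff simp: doubleton_eq_iff)
    qed (rule ne)
    then show ?thesis
      using True unfolding it by (simp add: pos_def)
  next
    case False
    then have g: "label ?\<beta> t = label ?\<beta> u"
      using assms(7) gue by (auto simp: defs doubleton_eq_iff)
    have "\<exists>k>0. (inv_into UNIV ?f ^^ k) (?f t) = ?f u \<and>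
      (\<forall>m. 0 < m \<and> m < k \<longrightarrow> (inv_into UNIV ?f ^^ m) (?f t) \<notin> {?f t, ?f h, ?f u, ?f e})"
    proof (rule f.previous_visit[OF S(1,2)])
      show "orbit_rel (?f \<circ> transpose t h) t u" "\<not> orbit_rel (?f \<circ> transpose t h) t h"
        "\<not> orbit_rel (?f \<circ> transpose t h) t e"
        unfolding tr[symmetric] using g gth gue S by (auto simp flip: gen_eq_iff simp: doubleton_eq_iff)
    qed (use ne in auto)
    then show ?thesis
      using False unfolding it by (simp add: pos_def)
  qed
  then show ?thesis
    unfolding next_endpoint_def Let_def ends start goal .
qed

section \<open>Composites of two edge maps\<close>

lemma edge_fun_merge:
  assumes "y < length w" "y \<notin> \<delta>" "s \<in> S" "\<not> splits_at \<delta> y"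
  shows "edge_fun A \<delta> y (label \<delta> s) = label (insert y \<delta>) s"
  using assms gen_in[OF assms(3), of \<delta>] gen_merge[OF assms(1,2), of "label \<delta> s" s]
  by (simp add: edge_fun_def splits_at_def)

lemma edge_fun_split:
  assumes "y < length w" "y \<notin> \<delta>" "s \<in> S" "splits_at \<delta> y"
  shows "edge_fun A \<delta> y (label \<delta> s) = label (insert y \<delta>) s \<or>
    {edge_fun A \<delta> y (label \<delta> s), label (insert y \<delta>) s} \<subseteq>
      {label (insert y \<delta>) (lower_in w y), label (insert y \<delta>) (upper_in w y)}"
proof (cases "label \<delta> s = label \<delta> (lower_in w y)")
  case True
  then show ?thesis
    using assms points_in[OF assms(1)] gen_split[OF assms(1,2) _ assms(3), of "lower_in w y"]
      gen_arc_in_mem[of "insert y \<delta>" y "opposite (clockwise (A y))"]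
    by (auto simp: edge_fun_def splits_at_def)
next
  case False
  then show ?thesis
    using assms points_in[OF assms(1)] gen_split[OF assms(1,2) _ gen_in[OF assms(3)] assms(3), of \<delta>]
    by (auto simp: edge_fun_def splits_at_def)
qed

text \<open>Whichever half is chosen at a split, the value is the new label of some segment of the
  old circle. So a following edge can be evaluated on that segment.\<close>

lemma edge_fun_repr:
  assumes "y < length w" "s \<in> S"
  obtains s' where "s' \<in> S" "label \<delta> s' = label \<delta> s"
    "edge_fun A \<delta> y (label \<delta> s) = label (insert y \<delta>) s'"
proof (cases "splits_at \<delta> y \<and> label \<delta> s = label \<delta> (lower_in w y)")
  case True
  show thesis
  proof (rule that[of "tail1 w A y"])
    show "label \<delta> (tail1 w A y) = label \<delta> s"
      using True gen_arc_in_mem[of \<delta> y "opposite (clockwise (A y))"] by (auto simp: splits_at_def)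
  qed (use True points_in[OF assms(1)] in \<open>auto simp: edge_fun_def\<close>)
next
  case False
  show thesis
    by (rule that[of "label \<delta> s"]) (use False assms(2) gen_in in \<open>auto simp: edge_fun_def\<close>)
qed

lemma edge_fun_gens:
  assumes "y < length w"
  shows "edge_fun A \<delta> y ` gens b w \<delta> \<subseteq> gens b w (insert y \<delta>)"
proof -
  have "edge_fun A \<delta> y (label \<delta> s) \<in> gens b w (insert y \<delta>)" if "s \<in> S" for s
    using edge_fun_repr[OF assms that, of \<delta> A] gen_in_gens by metis
  then show ?thesis
    by (auto simp: gens_def)
qed

text \<open>The difference produced by the first edge is pushed forward to the terminal vertex. When
  the second edge splits as well, a factor may land on the other half of its circle, but the second
  difference identifies these two halves.\<close>

lemma face_comp_eq:
  assumes A: "arrow_choice w A" and xy: "x \<in> crossings w - \<alpha>" "y \<in> crossings w - \<alpha>" "x \<noteq> y"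
  shows "face_comp b w A \<alpha> x y \<omega> =
    edge_diff A (splits_at (insert x \<alpha>) y) (insert y (insert x \<alpha>)) y
      (edge_diff A (splits_at \<alpha> x) (insert y (insert x \<alpha>)) x
        (ext_map (gens b w \<alpha>) (edge_fun A (insert x \<alpha>) y \<circ> edge_fun A \<alpha> x) \<omega>))"
proof -
  let ?\<beta> = "insert x \<alpha>" and ?\<gamma> = "insert y (insert x \<alpha>)"
  let ?f = "edge_fun A \<alpha> x" and ?g = "edge_fun A (insert x \<alpha>) y"
  let ?u = "tail1 w A x" and ?v = "head1 w A x"
  have l: "x < length w" "y < length w" "y \<notin> ?\<beta>" "x \<in> crossings w - \<alpha>" "y \<in> crossings w - ?\<beta>"
    using xy by auto
  have S: "?u \<in> S" "?v \<in> S"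
    using points_in(3)[OF l(1)] by auto
  have comp: "ext_map (gens b w ?\<beta>) ?g (ext_map (gens b w \<alpha>) ?f \<omega>) = ext_map (gens b w \<alpha>) (?g \<circ> ?f) \<omega>"
    by (intro ext_map_comp finite_gens edge_fun_gens l)
  have "ext_map (gens b w ?\<beta>) ?g (edge_diff A (splits_at \<alpha> x) ?\<beta> x (ext_map (gens b w \<alpha>) ?f \<omega>)) =
      (if splits_at \<alpha> x then gen_diff (?g (label ?\<beta> ?u)) (?g (label ?\<beta> ?v)) (ext_map (gens b w \<alpha>) (?g \<circ> ?f) \<omega>)
       else ext_map (gens b w \<alpha>) (?g \<circ> ?f) \<omega>)"
    using S gen_in_gens by (simp add: edge_diff_def ext_map_gen_diff finite_gens comp)
  then have fc: "face_comp b w A \<alpha> x y \<omega> = edge_diff A (splits_at ?\<beta> y) ?\<gamma> y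
      (if splits_at \<alpha> x then gen_diff (?g (label ?\<beta> ?u)) (?g (label ?\<beta> ?v)) (ext_map (gens b w \<alpha>) (?g \<circ> ?f) \<omega>)
       else ext_map (gens b w \<alpha>) (?g \<circ> ?f) \<omega>)"
    unfolding face_comp_def edge_map_eq[OF A l(4)] edge_map_eq[OF A l(5)] by simp
  show ?thesis
  proof (cases "splits_at \<alpha> x")
    case True
    show ?thesis
    proof (cases "splits_at ?\<beta> y")
      case y: True
      have *: "?g (label ?\<beta> s) = label ?\<gamma> s \<or>
          {?g (label ?\<beta> s), label ?\<gamma> s} \<subseteq> {label ?\<gamma> (tail1 w A y), label ?\<gamma> (head1 w A y)}"
        if "s \<in> S" for s
        using edge_fun_split[OF l(2,3) that y, of A] gen_pair[of ?\<gamma> y "clockwise (A y)"] by simp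
      show ?thesis
        unfolding fc using True y gen_diff_cong[OF *[OF S(1)] *[OF S(2)]] by (simp add: edge_diff_def)
    next
      case False
      then show ?thesis
        unfolding fc using True edge_fun_merge[OF l(2,3)] S by (simp add: edge_diff_def)
    qed
  next
    case False
    then show ?thesis
      unfolding fc by (simp add: edge_diff_def)
  qed
qed

end

section \<open>Types of faces\<close>

lemma ext_basis_empty_in: "ext_basis {} \<in> ext_alg G"
  by (auto simp: ext_alg_def ext_basis_def split: if_splits)

lemma basis_one_nonzero: "ext_basis {} \<noteq> (0 :: ('g, int) ext)"
proof
  assume "ext_basis {} = (0 :: ('g, int) ext)"
  from fun_cong[OF this, of "{}"] show False
    by (simp add: ext_basis_def)
qed

context braid_diagram
begin

abbreviation circle_pair :: "vertex \<Rightarrow> nat \<Rightarrow> segment set" where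
  "circle_pair \<alpha> x \<equiv> {label \<alpha> (lower_in w x), label \<alpha> (upper_in w x)}"

text \<open>
  A description of the faces of type A or X in terms of the circles through the ends of the arrows.
  In the last case both composites merge the same two circles and split the result again, and the
  maps differ by a sign according to whether the two arrows are parallel.
\<close>

definition even_face :: "(nat \<Rightarrow> direction) \<Rightarrow> vertex \<Rightarrow> nat \<Rightarrow> nat \<Rightarrow> bool" where
  "even_face A \<alpha> x y \<longleftrightarrow>
     (if splits_at \<alpha> x \<and> splits_at \<alpha> y then
        if splits_at (insert x \<alpha>) y then True
        else if inside \<alpha> x
        then oriented_up \<alpha> (lower_in w x) \<longleftrightarrow>
          label (insert x \<alpha>) (tail0 w A y) = label (insert x \<alpha>) (head0 w A x)
        else oriented_up \<alpha> (lower_in w x) \<longleftrightarrow>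
          label (insert y \<alpha>) (tail0 w A x) = label (insert y \<alpha>) (head0 w A y)
      else \<not> splits_at \<alpha> x \<and> \<not> splits_at \<alpha> y \<and> splits_at (insert x \<alpha>) y \<and>
        label (insert y (insert x \<alpha>)) (tail1 w A x) \<noteq> label (insert y (insert x \<alpha>)) (tail1 w A y))"

end

locale braid_face = braid_diagram +
  fixes A :: "nat \<Rightarrow> direction" and \<alpha> :: vertex and x y :: nat
  assumes A: "arrow_choice w A"
    and x: "x \<in> crossings w - \<alpha>" and y: "y \<in> crossings w - \<alpha>" and xy: "x \<noteq> y"
begin

lemma swap: "braid_face b w A \<alpha> y x"
  using A x y xy by unfold_locales auto

lemma facts: "x < length w" "y < length w" "x \<notin> \<alpha>" "y \<notin> \<alpha>" "y \<notin> insert x \<alpha>" "x \<notin> insert y \<alpha>"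
  using x y xy by auto

abbreviation \<xi> :: vertex where "\<xi> \<equiv> insert x \<alpha>"

abbreviation \<zeta> :: vertex where "\<zeta> \<equiv> insert y \<alpha>"

abbreviation \<gamma> :: vertex where "\<gamma> \<equiv> insert y \<xi>"

lemma insert_swap: "insert x \<zeta> = \<gamma>"
  by auto

lemma pts: "lower_in w x \<in> S" "upper_in w x \<in> S" "lower_in w y \<in> S" "upper_in w y \<in> S"
  using points_in facts by auto

lemma splits_insert:
  "splits_at \<xi> x \<longleftrightarrow> \<not> splits_at \<alpha> x"
  "splits_at \<zeta> y \<longleftrightarrow> \<not> splits_at \<alpha> y"
  "splits_at \<gamma> y \<longleftrightarrow> \<not> splits_at \<xi> y"
  "splits_at \<gamma> x \<longleftrightarrow> \<not> splits_at \<zeta> x"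
  using splits_at_insert[of x \<alpha>] splits_at_insert[of y \<alpha>] splits_at_insert[of y \<xi>]
    splits_at_insert[of x \<zeta>] facts insert_swap by auto

text \<open>Merging never separates segments and splitting never joins them.\<close>

lemma splits_merge_split:
  assumes "\<not> splits_at \<alpha> x" "splits_at \<alpha> y"
  shows "splits_at \<xi> y" "\<not> splits_at \<zeta> x"
  using assms gen_merge[OF facts(1,3) _ pts(3,4)] gen_split[OF facts(2,4) _ pts(1,2)]
  by (auto simp: splits_at_def)

text \<open>A merge at \<open>x\<close> brings only its own two circles together, so
  \<open>y\<close> can turn from a merge into a split only if it joins the same two circles as
  \<open>x\<close>.\<close>

lemma merge_split_pair:
  assumes "\<not> splits_at \<alpha> x" "\<not> splits_at \<alpha> y" "splits_at \<xi> y"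
  shows "splits_at \<zeta> x" "circle_pair \<gamma> x = circle_pair \<gamma> y"
proof -
  have "circle_pair \<alpha> x = circle_pair \<alpha> y"
    using assms gen_merge[OF facts(1,3) _ pts(3,4)] by (auto simp: splits_at_def)
  then show *: "splits_at \<zeta> x"
    using assms gen_merge[OF facts(2,4) _ pts(1,2)] by (auto simp: splits_at_def)
  have "label \<gamma> (lower_in w x) \<noteq> label \<gamma> (upper_in w x)"
    using splits_insert(4) * by (simp add: splits_at_def)
  moreover have "label \<xi> (lower_in w x) = label \<xi> (upper_in w x)"
    using splits_insert(1) assms by (simp add: splits_at_def)
  ultimately show "circle_pair \<gamma> x = circle_pair \<gamma> y"
    using gen_split[OF facts(2,5) _ pts(1,2)] assms(3) by (auto simp: splits_at_def)
qed

lemma gens_in_S: "g \<in> gens b w \<alpha> \<Longrightarrow> g \<in> S"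
  using gens_subset by blast

lemma comp_not_vanishes:
  "face_comp b w A \<alpha> x y (ext_basis {}) \<noteq> 0 \<Longrightarrow> \<not> comp_vanishes b w A \<alpha> x y"
  using ext_basis_empty_in by (auto simp: comp_vanishes_def)

lemma edge_diff_one_nonzero:
  assumes "\<not> splits_at \<gamma> x"
  shows "edge_diff A c \<gamma> x (ext_basis {}) \<noteq> (0 :: (segment, int) ext)"
proof (cases c)
  case True
  then show ?thesis
    using gen_arc_in_eq_iff[of \<gamma> x "clockwise (A x)"] assms
    by (auto simp: edge_diff_def splits_at_def intro!: gen_diff_one_nonzero)
next
  case False
  then show ?thesis
    by (simp add: edge_diff_def basis_one_nonzero)
qed

text \<open>Both composites are the algebra map sending each circle to the one that contains it at
  the terminal vertex; nonvanishing is seen on 1.\<close>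

lemma merge_merge:
  assumes "\<not> splits_at \<alpha> x" "\<not> splits_at \<alpha> y" "\<not> splits_at \<xi> y"
  shows "type_C b w A \<alpha> x y"
proof -
  interpret s: braid_face b w A \<alpha> y x by (rule swap)
  have "\<not> splits_at \<zeta> x"
    using s.merge_split_pair(1) assms by blast
  note ns = assms this
  have f: "(edge_fun A \<xi> y \<circ> edge_fun A \<alpha> x) g = (edge_fun A \<zeta> x \<circ> edge_fun A \<alpha> y) g"
    if "g \<in> gens b w \<alpha>" for g
    using gens_in_S[OF that] gen_gens[OF that] facts ns insert_swap
      edge_fun_merge[OF facts(1,3), of g A] edge_fun_merge[OF facts(2,4), of g A]
      edge_fun_merge[OF facts(2,5), of g A] edge_fun_merge[OF facts(1,6), of g A]
    by simp
  have eq: "face_comp b w A \<alpha> x y \<omega> = face_comp b w A \<alpha> y x \<omega>" for \<omega>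
    unfolding face_comp_eq[OF A x y xy] face_comp_eq[OF A y x xy[symmetric]]
    using ns ext_map_cong[OF finite_gens f, where \<omega> = \<omega>] by (simp add: edge_diff_def comp_def)
  have nz: "face_comp b w A \<alpha> x y (ext_basis {}) \<noteq> 0"
    unfolding face_comp_eq[OF A x y xy] using ns by (simp add: edge_diff_def ext_map_one finite_gens basis_one_nonzero)
  show ?thesis
    unfolding type_C_def
    using comp_not_vanishes[OF nz] s.comp_not_vanishes[OF nz[unfolded eq]] eq by blast
qed

text \<open>The generator maps can disagree only in the choice between the two halves of the circle
  split by \<open>y\<close>, and multiplication by the difference of these halves hides this. On 1
  the composite gives that difference.\<close>

lemma merge_split:
  assumes "\<not> splits_at \<alpha> x" "splits_at \<alpha> y"
  shows "face_comp b w A \<alpha> x y \<omega> = face_comp b w A \<alpha> y x \<omega>"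
    and "face_comp b w A \<alpha> x y (ext_basis {}) \<noteq> 0"
proof -
  note ns = assms splits_merge_split[OF assms]
  let ?f = "edge_fun A \<xi> y \<circ> edge_fun A \<alpha> x"
  let ?g = "edge_fun A \<zeta> x \<circ> edge_fun A \<alpha> y"
  have pair: "{label \<gamma> (tail1 w A y), label \<gamma> (head1 w A y)} = circle_pair \<gamma> y"
    using gen_pair[of \<gamma> y "clockwise (A y)"] by simp
  have fg: "?f g = ?g g \<or> {?f g, ?g g} \<subseteq> {label \<gamma> (tail1 w A y), label \<gamma> (head1 w A y)}"
    if g: "g \<in> gens b w \<alpha>" for g
  proof -
    note gS = gens_in_S[OF g]
    have "?f g = edge_fun A \<xi> y (label \<xi> g)"
      using edge_fun_merge[OF facts(1,3) gS ns(1)] gen_gens[OF g] by simp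
    then have 1: "?f g = label \<gamma> g \<or> {?f g, label \<gamma> g} \<subseteq> circle_pair \<gamma> y"
      using edge_fun_split[OF facts(2,5) gS ns(3), of A] by simp
    obtain s where s: "s \<in> S" "label \<alpha> s = g" "edge_fun A \<alpha> y g = label \<zeta> s"
      using edge_fun_repr[OF facts(2) gS, of \<alpha> A] gen_gens[OF g] by metis
    then have 2: "?g g = label \<gamma> s"
      using edge_fun_merge[OF facts(1,6) s(1) ns(4)] insert_swap by simp
    have "label \<xi> s = label \<xi> g"
      using gen_merge[OF facts(1,3) _ s(1) gS] ns(1) s(2) gen_gens[OF g] by (simp add: splits_at_def)
    then have 3: "label \<gamma> s = label \<gamma> g \<or> {label \<gamma> s, label \<gamma> g} \<subseteq> circle_pair \<gamma> y"
      using gen_split[OF facts(2,5) _ s(1) gS] ns(3) by (simp add: splits_at_def)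
    from 1 2 3 show ?thesis
      unfolding pair by auto
  qed
  show "face_comp b w A \<alpha> x y \<omega> = face_comp b w A \<alpha> y x \<omega>"
    unfolding face_comp_eq[OF A x y xy] face_comp_eq[OF A y x xy[symmetric]] insert_swap
    using ns gen_diff_ext_map_cong[where f = ?f and f' = ?g and \<omega> = \<omega> and G = "gens b w \<alpha>", OF finite_gens fg] by (simp add: edge_diff_def)
  interpret s: braid_face b w A \<alpha> y x by (rule swap)
  show "face_comp b w A \<alpha> x y (ext_basis {}) \<noteq> 0"
    unfolding face_comp_eq[OF A x y xy] 
    using ns s.edge_diff_one_nonzero[of True] splits_insert(3) insert_swap
    by (simp add: edge_diff_def ext_map_one finite_gens)
qed

lemma merge_split_type:
  assumes "\<not> splits_at \<alpha> x" "splits_at \<alpha> y"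
  shows "type_C b w A \<alpha> x y" "type_C b w A \<alpha> y x"
proof -
  interpret s: braid_face b w A \<alpha> y x by (rule swap)
  note eq = merge_split(1)[OF assms]
  note nz = merge_split(2)[OF assms]
  show "type_C b w A \<alpha> x y" "type_C b w A \<alpha> y x"
    unfolding type_C_def
    using comp_not_vanishes[OF nz] s.comp_not_vanishes[OF nz[unfolded eq]] eq by auto
qed

text \<open>Up to choices that the difference absorbs, both composites apply one algebra map and
  then multiply by the difference of the same two circles. The orders of subtraction agree if and
  only if the tails of the rotated arrows lie on the same circle.\<close>

lemma merge_split_twice:
  assumes "\<not> splits_at \<alpha> x" "\<not> splits_at \<alpha> y" "splits_at \<xi> y"
  shows "label \<gamma> (tail1 w A x) = label \<gamma> (tail1 w A y) \<Longrightarrow> type_C b w A \<alpha> x y"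
    and "label \<gamma> (tail1 w A x) \<noteq> label \<gamma> (tail1 w A y) \<Longrightarrow> type_A b w A \<alpha> x y"
proof -
  interpret s: braid_face b w A \<alpha> y x by (rule swap)
  note ns = assms merge_split_pair(1)[OF assms]
  let ?f = "edge_fun A \<xi> y \<circ> edge_fun A \<alpha> x"
  let ?g = "edge_fun A \<zeta> x \<circ> edge_fun A \<alpha> y"
  let ?a = "label \<gamma> (tail1 w A y)" and ?c = "label \<gamma> (head1 w A y)"
  let ?a' = "label \<gamma> (tail1 w A x)" and ?c' = "label \<gamma> (head1 w A x)"
  have pair: "{?a, ?c} = circle_pair \<gamma> y" "{?a', ?c'} = circle_pair \<gamma> y"
    using gen_pair[of \<gamma> y "clockwise (A y)"] gen_pair[of \<gamma> x "clockwise (A x)"] merge_split_pair(2)[OF assms]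
    by simp_all
  have fg: "?f g = ?g g \<or> {?f g, ?g g} \<subseteq> {?a, ?c}" if g: "g \<in> gens b w \<alpha>" for g
  proof -
    note gS = gens_in_S[OF g]
    have "?f g = edge_fun A \<xi> y (label \<xi> g)"
      using edge_fun_merge[OF facts(1,3) gS ns(1)] gen_gens[OF g] by simp
    then have 1: "?f g = label \<gamma> g \<or> {?f g, label \<gamma> g} \<subseteq> circle_pair \<gamma> y"
      using edge_fun_split[OF facts(2,5) gS ns(3), of A] by simp
    have "?g g = edge_fun A \<zeta> x (label \<zeta> g)"
      using edge_fun_merge[OF facts(2,4) gS ns(2)] gen_gens[OF g] by simp
    then have 2: "?g g = label \<gamma> g \<or> {?g g, label \<gamma> g} \<subseteq> circle_pair \<gamma> y"
      using edge_fun_split[OF facts(1,6) gS ns(4), of A] insert_swap merge_split_pair(2)[OF assms] by simp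
    from 1 2 show ?thesis
      unfolding pair by auto
  qed
  have xy_eq: "face_comp b w A \<alpha> x y \<omega> = gen_diff ?a ?c (ext_map (gens b w \<alpha>) ?g \<omega>)" for \<omega>
    unfolding face_comp_eq[OF A x y xy]
    using ns gen_diff_ext_map_cong[where f = ?f and f' = ?g and \<omega> = \<omega> and G = "gens b w \<alpha>", OF finite_gens fg] by (simp add: edge_diff_def)
  have yx_eq: "face_comp b w A \<alpha> y x \<omega> = gen_diff ?a' ?c' (ext_map (gens b w \<alpha>) ?g \<omega>)" for \<omega>
    unfolding face_comp_eq[OF A y x xy[symmetric]] insert_swap using ns by (simp add: edge_diff_def)
  have ne: "?a \<noteq> ?c" "?a' \<noteq> ?c'"
    using gen_arc_in_eq_iff[of \<gamma> y "clockwise (A y)"] gen_arc_in_eq_iff[of \<gamma> x "clockwise (A x)"]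
      splits_insert(3,4) ns by (auto simp: splits_at_def)
  have nz: "face_comp b w A \<alpha> x y (ext_basis {}) \<noteq> 0" "face_comp b w A \<alpha> y x (ext_basis {}) \<noteq> 0"
    unfolding xy_eq yx_eq using ne by (simp_all add: ext_map_one finite_gens gen_diff_one_nonzero)
  note nv = comp_not_vanishes[OF nz(1)] s.comp_not_vanishes[OF nz(2)]
  show "type_C b w A \<alpha> x y" if "?a' = ?a"
  proof -
    have "?c' = ?c"
      using that pair ne by (auto simp: doubleton_eq_iff)
    then show ?thesis
      unfolding type_C_def xy_eq yx_eq using nv that by auto
  qed
  show "type_A b w A \<alpha> x y" if "?a' \<noteq> ?a"
  proof -
    have "{?a', ?c'} = {?a, ?c}"
      using pair by simp
    then have "?a' = ?c" "?c' = ?a"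
      using that by (auto simp: doubleton_eq_iff)
    then show ?thesis
      unfolding type_A_def xy_eq yx_eq using nv gen_diff_swap[of ?a ?c] by auto
  qed
qed

text \<open>Both composites multiply by both differences, in opposite orders, and multiplications by
  differences of generators anticommute.\<close>

lemma split_split:
  assumes "splits_at \<alpha> x" "splits_at \<alpha> y" "splits_at \<xi> y"
  shows "type_A b w A \<alpha> x y"
proof -
  interpret s: braid_face b w A \<alpha> y x by (rule swap)
  have "splits_at \<zeta> x"
    using interleaved_sym[OF facts(2,1,4,3) xy[symmetric]] assms by (auto simp: interleaved_def)
  note ns = assms this
  let ?f = "edge_fun A \<xi> y \<circ> edge_fun A \<alpha> x"
  let ?g = "edge_fun A \<zeta> x \<circ> edge_fun A \<alpha> y"
  let ?a = "label \<gamma> (tail1 w A y)" and ?c = "label \<gamma> (head1 w A y)"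
  let ?a' = "label \<gamma> (tail1 w A x)" and ?c' = "label \<gamma> (head1 w A x)"
  have pair: "{?a, ?c} = circle_pair \<gamma> y" "{?a', ?c'} = circle_pair \<gamma> x"
    using gen_pair[of \<gamma> y "clockwise (A y)"] gen_pair[of \<gamma> x "clockwise (A x)"] by simp_all
  \<comment> \<open>The two pairs of halves share a circle when one circle falls into three, so the
    values of the two generator maps may be linked only in several steps.\<close>
  let ?R = "{?a, ?c} \<times> {?a, ?c} \<union> {?a', ?c'} \<times> {?a', ?c'}"
  have R: "(u, v) \<in> ?R\<^sup>*" if "u = v \<or> {u, v} \<subseteq> circle_pair \<gamma> y \<or> {u, v} \<subseteq> circle_pair \<gamma> x" for u v
  proof (cases "u = v")
    case False
    then have "(u, v) \<in> ?R"
      using that unfolding pair by blast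
    then show ?thesis ..
  qed simp
  have fg: "(?f g, ?g g) \<in> ?R\<^sup>*" if g: "g \<in> gens b w \<alpha>" for g
  proof -
    note gS = gens_in_S[OF g]
    obtain s where s: "s \<in> S" "label \<alpha> s = g" "edge_fun A \<alpha> x g = label \<xi> s"
      using edge_fun_repr[OF facts(1) gS, of \<alpha> A] gen_gens[OF g] by metis
    obtain t where t: "t \<in> S" "label \<alpha> t = g" "edge_fun A \<alpha> y g = label \<zeta> t"
      using edge_fun_repr[OF facts(2) gS, of \<alpha> A] gen_gens[OF g] by metis
    have 1: "(?f g, label \<gamma> s) \<in> ?R\<^sup>*"
      using edge_fun_split[OF facts(2,5) s(1) ns(3), of A] s(3) by (intro R) auto
    have 2: "(label \<gamma> t, ?g g) \<in> ?R\<^sup>*"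
      using edge_fun_split[OF facts(1,6) t(1) ns(4), of A] t(3) insert_swap by (intro R) auto
    have down: "(label \<gamma> p, label \<gamma> q) \<in> ?R\<^sup>*"
      if "label \<xi> p = label \<xi> q" "p \<in> S" "q \<in> S" for p q
      using that gen_split[OF facts(2,5) _ that(2,3)] ns(3) by (intro R) (auto simp: splits_at_def)
    have "label \<xi> s = label \<xi> t \<or>
        label \<xi> s \<in> circle_pair \<xi> x \<and> label \<xi> t \<in> circle_pair \<xi> x"
      using gen_split[OF facts(1,3) _ s(1) t(1)] ns(1) s(2) t(2) by (simp add: splits_at_def)
    then have "(label \<gamma> s, label \<gamma> t) \<in> ?R\<^sup>*"
    proof
      assume "label \<xi> s = label \<xi> t"
      then show ?thesis
        using s t by (intro down)
    next
      assume "label \<xi> s \<in> circle_pair \<xi> x \<and> label \<xi> t \<in> circle_pair \<xi> x"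
      then have "\<exists>p\<in>{lower_in w x, upper_in w x}. label \<xi> s = label \<xi> p"
        "\<exists>q\<in>{lower_in w x, upper_in w x}. label \<xi> q = label \<xi> t"
        by auto
      then obtain p q where pq: "p \<in> {lower_in w x, upper_in w x}" "q \<in> {lower_in w x, upper_in w x}"
        "label \<xi> s = label \<xi> p" "label \<xi> q = label \<xi> t"
        by blast
      have "(label \<gamma> s, label \<gamma> p) \<in> ?R\<^sup>*" "(label \<gamma> q, label \<gamma> t) \<in> ?R\<^sup>*"
      proof -
        have "p \<in> S" "q \<in> S"
          using pq pts by auto
        then show "(label \<gamma> s, label \<gamma> p) \<in> ?R\<^sup>*" "(label \<gamma> q, label \<gamma> t) \<in> ?R\<^sup>*"
          using down[OF pq(3) s(1)] down[OF pq(4) _ t(1)] by blast+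
      qed
      moreover have "(label \<gamma> p, label \<gamma> q) \<in> ?R\<^sup>*"
        using pq by (intro R) auto
      ultimately show ?thesis
        by (meson rtrancl_trans)
    qed
    with 1 2 show ?thesis
      by (meson rtrancl_trans)
  qed
  have xy_eq: "face_comp b w A \<alpha> x y \<omega> = gen_diff ?a ?c (gen_diff ?a' ?c' (ext_map (gens b w \<alpha>) ?g \<omega>))" for \<omega>
    unfolding face_comp_eq[OF A x y xy]
    using ns gen_diff_gen_diff_ext_map_cong[where f = ?f and f' = ?g and \<omega> = \<omega> and G = "gens b w \<alpha>", OF finite_gens fg] by (simp add: edge_diff_def)
  have yx_eq: "face_comp b w A \<alpha> y x \<omega> = - gen_diff ?a ?c (gen_diff ?a' ?c' (ext_map (gens b w \<alpha>) ?g \<omega>))" for \<omega>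
    unfolding face_comp_eq[OF A y x xy[symmetric]] insert_swap
    using ns gen_diff_gen_diff[of ?a' ?c' ?a ?c] by (simp add: edge_diff_def)
  have ne: "?a \<noteq> ?c" "?a' \<noteq> ?c'"
    using gen_arc_in_eq_iff[of \<gamma> y "clockwise (A y)"] gen_arc_in_eq_iff[of \<gamma> x "clockwise (A x)"]
      splits_insert(3,4) ns by (auto simp: splits_at_def)
  have "circle_pair \<gamma> y \<noteq> circle_pair \<gamma> x"
    using gen_split[OF facts(2,5) _ pts(1,2)] ns splits_insert(1) by (auto simp: splits_at_def)
  then have nz: "gen_diff ?a ?c (gen_diff ?a' ?c' (ext_basis {})) \<noteq> (0 :: (segment, int) ext)"
    using ne pair by (intro gen_diff_gen_diff_one_nonzero) auto
  then have nz: "face_comp b w A \<alpha> x y (ext_basis {}) \<noteq> 0" "face_comp b w A \<alpha> y x (ext_basis {}) \<noteq> 0"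
    unfolding xy_eq yx_eq by (simp_all add: ext_map_one finite_gens)
  show ?thesis
    unfolding type_A_def
    using comp_not_vanishes[OF nz(1)] s.comp_not_vanishes[OF nz(2)] by (simp add: xy_eq yx_eq)
qed

text \<open>The second edge joins the two circles created by the first, so the difference
  contributed by the first edge becomes zero.\<close>

lemma interleaved_vanishes:
  assumes "interleaved \<alpha> x y"
  shows "comp_vanishes b w A \<alpha> x y"
proof -
  interpret s: braid_face b w A \<alpha> y x by (rule swap)
  have "\<not> splits_at \<zeta> x"
    using interleaved_sym[OF facts(1-4) xy assms] by (simp add: interleaved_def)
  then have "label \<gamma> (tail1 w A x) = label \<gamma> (head1 w A x)"
    using splits_insert(4) gen_arc_in_eq_iff[of \<gamma> x "clockwise (A x)"] by (simp add: splits_at_def)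
  then show ?thesis
    using assms by (simp add: comp_vanishes_def face_comp_eq[OF A x y xy] interleaved_def edge_diff_def)
qed

lemma type_of_interleaved:
  assumes il: "interleaved \<alpha> x y" and ins: "inside \<alpha> x"
  defines "P \<equiv> (oriented_up \<alpha> (lower_in w x) \<longleftrightarrow>
    label \<xi> (tail0 w A y) = label \<xi> (head0 w A x))"
  shows "P \<Longrightarrow> type_X b w A \<alpha> x y \<and> type_X b w A \<alpha> y x"
    and "\<not> P \<Longrightarrow> type_Y b w A \<alpha> x y \<and> type_Y b w A \<alpha> y x"
proof -
  interpret s: braid_face b w A \<alpha> y x by (rule swap)
  have il': "interleaved \<alpha> y x"
    using interleaved_sym[OF facts(1-4) xy il] .
  have ain: "arrow_inside b w A \<alpha> x" "\<not> arrow_inside b w A \<alpha> y"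
    using arrow_inside_eq[OF A x] arrow_inside_eq[OF A y] il ins inside_iff_not_inside[OF facts(1-4) xy il]
    by (auto simp: interleaved_def)
  note v = interleaved_vanishes[OF il] s.interleaved_vanishes[OF il']
  show "type_X b w A \<alpha> x y \<and> type_X b w A \<alpha> y x" if P
  proof -
    have "next_endpoint b w A \<alpha> x y (opposite (A y))"
      using that by (intro next_endpointI[OF A x y xy il]) (auto simp: P_def)
    then show ?thesis
      unfolding type_X_def using v ain by auto
  qed
  show "type_Y b w A \<alpha> x y \<and> type_Y b w A \<alpha> y x" if "\<not> P"
  proof -
    have ty: "{label \<xi> (tail0 w A y), label \<xi> (head0 w A y)} = circle_pair \<xi> x"
      using gen_pair[of "\<xi>" y "A y"] interleaved_gens(2)[OF facts(1-4) xy il] by simp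
    moreover have "label \<xi> (head0 w A x) \<in> circle_pair \<xi> x"
      by (rule gen_arc_in_mem)
    moreover have "label \<xi> (tail0 w A y) \<noteq> label \<xi> (head0 w A y)"
      using il gen_arc_in_eq_iff[of "\<xi>" y "A y"] by (simp add: interleaved_def splits_at_def)
    ultimately have "label \<xi> (head0 w A y) = label \<xi> (head0 w A x) \<longleftrightarrow>
        label \<xi> (tail0 w A y) \<noteq> label \<xi> (head0 w A x)"
      by (metis insert_iff empty_iff)
    then have "next_endpoint b w A \<alpha> x y (A y)"
      using that by (intro next_endpointI[OF A x y xy il]) (auto simp: P_def)
    then show ?thesis
      unfolding type_Y_def using v ain by auto
  qed
qed

text \<open>Turns the implications in the definition of a sign assignment into a definite parity on
  every face: no face escapes the four types.\<close>

lemma face_type: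
  shows "even_face A \<alpha> x y \<Longrightarrow> type_A b w A \<alpha> x y \<or> type_X b w A \<alpha> x y"
    and "\<not> even_face A \<alpha> x y \<Longrightarrow> type_C b w A \<alpha> x y \<or> type_Y b w A \<alpha> x y"
proof -
  interpret s: braid_face b w A \<alpha> y x by (rule swap)
  have "(even_face A \<alpha> x y \<longrightarrow> type_A b w A \<alpha> x y \<or> type_X b w A \<alpha> x y) \<and>
    (\<not> even_face A \<alpha> x y \<longrightarrow> type_C b w A \<alpha> x y \<or> type_Y b w A \<alpha> x y)"
  proof (cases "splits_at \<alpha> x \<and> splits_at \<alpha> y")
    case True
    show ?thesis
    proof (cases "splits_at \<xi> y")
      case t: True
      then show ?thesis
        using split_split True by (simp add: even_face_def)
    next
      case False
      then have il: "interleaved \<alpha> x y"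
        using True by (simp add: interleaved_def)
      note il' = interleaved_sym[OF facts(1-4) xy il]
      have o: "oriented_up \<alpha> (lower_in w y) \<longleftrightarrow> oriented_up \<alpha> (lower_in w x)"
        using interleaved_gens(1)[OF facts(1-4) xy il] pts by (intro oriented_up_const)
      show ?thesis
        using type_of_interleaved[OF il] s.type_of_interleaved[OF il']
          inside_iff_not_inside[OF facts(1-4) xy il] True False o
        by (auto simp: even_face_def)
    qed
  next
    case False
    then consider "\<not> splits_at \<alpha> x" "splits_at \<alpha> y" | "splits_at \<alpha> x" "\<not> splits_at \<alpha> y"
      | "\<not> splits_at \<alpha> x" "\<not> splits_at \<alpha> y" "splits_at \<xi> y"
      | "\<not> splits_at \<alpha> x" "\<not> splits_at \<alpha> y" "\<not> splits_at \<xi> y"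
      by blast
    then show ?thesis
    proof cases
      case 1
      then show ?thesis
        using merge_split_type by (simp add: even_face_def)
    next
      case 2
      then show ?thesis
        using s.merge_split_type by (simp add: even_face_def)
    next
      case 3
      then show ?thesis
        using merge_split_twice by (auto simp: even_face_def)
    next
      case 4
      then show ?thesis
        using merge_merge by (simp add: even_face_def)
    qed
  qed
  then show "even_face A \<alpha> x y \<Longrightarrow> type_A b w A \<alpha> x y \<or> type_X b w A \<alpha> x y"
    "\<not> even_face A \<alpha> x y \<Longrightarrow> type_C b w A \<alpha> x y \<or> type_Y b w A \<alpha> x y"
    by blast+
qed

end

section \<open>Signs and reversal of arrows\<close>

lemma prod_signs:
  fixes f :: "'a \<Rightarrow> int"
  assumes "finite E" "\<And>e. e \<in> E \<Longrightarrow> f e \<in> {1, - 1}"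
  shows "(\<Prod>e\<in>E. f e) = (- 1) ^ card {e \<in> E. f e = - 1}"
  using assms
proof (induction E rule: finite_induct)
  case (insert e E)
  have "{d \<in> insert e E. f d = - 1} = (if f e = - 1 then insert e {d \<in> E. f d = - 1} else {d \<in> E. f d = - 1})"
    by auto
  then show ?case
    using insert by auto
qed simp

context braid_diagram
begin

definition reversal_sign :: "(nat \<Rightarrow> direction) \<Rightarrow> (nat \<Rightarrow> direction) \<Rightarrow> vertex \<Rightarrow> nat \<Rightarrow> int" where
  "reversal_sign A A' \<alpha> x = (if A' x \<noteq> A x \<and> splits_at \<alpha> x then - 1 else 1)"

text \<open>Reversing an arrow exchanges the two halves of a split circle. This negates the
  difference, and the changed choice of the half receiving the generator is absorbed by it.\<close>

lemma edge_map_reversal: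
  assumes A: "arrow_choice w A" "arrow_choice w A'" and x: "x \<in> crossings w - \<alpha>"
  shows "edge_map b w A' \<alpha> x \<omega> = (\<lambda>U. of_int (reversal_sign A A' \<alpha> x) * edge_map b w A \<alpha> x \<omega> U)"
proof (cases "A' x \<noteq> A x \<and> splits_at \<alpha> x")
  case False
  then have "edge_map b w A' \<alpha> x \<omega> = edge_map b w A \<alpha> x \<omega>"
    unfolding edge_map_eq[OF A(1) x] edge_map_eq[OF A(2) x] by (auto simp: edge_diff_def edge_fun_def)
  then show ?thesis
    using False by (auto simp: reversal_sign_def)
next
  case True
  let ?\<beta> = "insert x \<alpha>"
  let ?u = "label ?\<beta> (tail1 w A x)" and ?v = "label ?\<beta> (head1 w A x)"
  have A': "A' x = opposite (A x)"
    using arrow_choice_cases[OF A] x True by auto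
  have "gen_diff ?u ?v (ext_map (gens b w \<alpha>) (edge_fun A' \<alpha> x) \<omega>) =
      gen_diff ?u ?v (ext_map (gens b w \<alpha>) (edge_fun A \<alpha> x) \<omega>)"
    using True A' by (intro gen_diff_ext_map_cong finite_gens) (auto simp: edge_fun_def)
  then show ?thesis
    using True gen_diff_swap[of ?v ?u "ext_map (gens b w \<alpha>) (edge_fun A' \<alpha> x) \<omega>"] unfolding edge_map_eq[OF A(1) x] edge_map_eq[OF A(2) x]
    by (simp add: edge_diff_def reversal_sign_def A' fun_eq_iff)
qed

end

context braid_face
begin

lemma face_sign:
  assumes \<epsilon>: "sign_assignment b w A \<epsilon>" and \<alpha>: "\<alpha> \<subseteq> crossings w"
  shows "\<epsilon> (\<alpha>, x) * \<epsilon> (\<alpha>, y) * \<epsilon> (\<xi>, y) * \<epsilon> (\<zeta>, x) =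
    (if even_face A \<alpha> x y then 1 else - 1)"
proof -
  have face: "is_face w \<alpha> x y"
    using \<alpha> x y xy by (simp add: is_face_def)
  have vals: "\<epsilon> e \<in> {1, - 1}" if "e \<in> face_edges \<alpha> x y" for e
  proof -
    have *: "\<And>\<alpha> x. \<alpha> \<subseteq> crossings w \<Longrightarrow> x \<in> crossings w - \<alpha> \<Longrightarrow> \<epsilon> (\<alpha>, x) \<in> {1, - 1}"
      using \<epsilon> unfolding sign_assignment_def by blast
    show ?thesis
      using that \<alpha> x y xy *[of \<alpha> x] *[of \<alpha> y] *[of "\<xi>" y] *[of "\<zeta>" x]
      by (auto simp: face_edges_def)
  qed
  \<comment> \<open>The four edges of a face are distinct, so the product over the set
    \<open>face_edges\<close> has four factors.\<close>
  have ne: "\<xi> \<noteq> \<alpha>" "\<zeta> \<noteq> \<alpha>"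
    using facts by blast+
  have "(\<Prod>e\<in>face_edges \<alpha> x y. \<epsilon> e) = (- 1) ^ card {e \<in> face_edges \<alpha> x y. \<epsilon> e = - 1}"
    by (intro prod_signs vals) (auto simp: face_edges_def)
  moreover have "(\<Prod>e\<in>face_edges \<alpha> x y. \<epsilon> e) = \<epsilon> (\<alpha>, x) * \<epsilon> (\<alpha>, y) * \<epsilon> (\<xi>, y) * \<epsilon> (\<zeta>, x)"
    using xy ne ne[symmetric] by (simp add: face_edges_def mult.assoc)
  moreover have "even (card {e \<in> face_edges \<alpha> x y. \<epsilon> e = - 1}) \<longleftrightarrow> even_face A \<alpha> x y"
    using \<epsilon> face face_type unfolding sign_assignment_def by blast
  ultimately show ?thesis
    by (auto simp: minus_one_power_iff)
qed

text \<open>Reversing one arrow changes the product of signs exactly if just one of the two parallel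
  edges at its crossing splits. This happens for interleaved arrows and for a merge followed by a
  split of the same two circles, which are the two cases in which \<open>even_face\<close> refers to
  the arrows.\<close>

lemma even_face_reversal:
  assumes A': "arrow_choice w A'"
  shows "(even_face A \<alpha> x y \<longleftrightarrow> even_face A' \<alpha> x y) \<longleftrightarrow>
    reversal_sign A A' \<alpha> x * reversal_sign A A' \<alpha> y *
    reversal_sign A A' \<xi> y * reversal_sign A A' \<zeta> x = 1"
proof -
  interpret s: braid_face b w A \<alpha> y x by (rule swap)
  have rx: "A' x = A x \<or> A' x = opposite (A x)" and ry: "A' y = A y \<or> A' y = opposite (A y)"
    using arrow_choice_cases[OF A A'] x y by auto
  consider (ss) "splits_at \<alpha> x" "splits_at \<alpha> y" "splits_at \<xi> y"
    | (il) "splits_at \<alpha> x" "splits_at \<alpha> y" "\<not> splits_at \<xi> y"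
    | (ms) "\<not> splits_at \<alpha> x" "splits_at \<alpha> y"
    | (sm) "splits_at \<alpha> x" "\<not> splits_at \<alpha> y"
    | (mss) "\<not> splits_at \<alpha> x" "\<not> splits_at \<alpha> y" "splits_at \<xi> y"
    | (mm) "\<not> splits_at \<alpha> x" "\<not> splits_at \<alpha> y" "\<not> splits_at \<xi> y"
    by blast
  then show ?thesis
  proof cases
    case ss
    have "splits_at \<zeta> x"
      using interleaved_sym[OF facts(2,1,4,3) xy[symmetric]] ss by (auto simp: interleaved_def)
    then show ?thesis
      using ss by (simp add: even_face_def reversal_sign_def)
  next
    case il
    then have int: "interleaved \<alpha> x y"
      by (simp add: interleaved_def)
    note int' = interleaved_sym[OF facts(1-4) xy int]
    \<comment> \<open>Each arrow has one end on each of two common circles, so reversing it negates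
      every equation between an end of one arrow and an end of the other.\<close>
    have toggle: "(label \<beta> (arc_in w z (opposite d)) = label \<beta> c) \<longleftrightarrow> (label \<beta> (arc_in w z d) \<noteq> label \<beta> c)"
      if "circle_pair \<beta> z = {p, q}" "p \<noteq> q" "label \<beta> c \<in> {p, q}" for \<beta> z d p q c
    proof -
      define l m where "l = label \<beta> (arc_in w z (opposite d))" and "m = label \<beta> (arc_in w z d)"
      have "{l, m} = {p, q}"
        using gen_pair[of \<beta> z d] that(1) by (simp add: l_def m_def)
      then show ?thesis
        unfolding l_def[symmetric] m_def[symmetric] using that(2,3) by (auto simp: doubleton_eq_iff)
    qed
    have p: "circle_pair \<xi> y = circle_pair \<xi> x" "circle_pair \<zeta> x = circle_pair \<zeta> y"
      using interleaved_gens(2)[OF facts(1-4) xy int] interleaved_gens(2)[OF facts(2,1,4,3) xy[symmetric] int'] .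
    have ne: "label \<xi> (lower_in w x) \<noteq> label \<xi> (upper_in w x)"
      "label \<zeta> (lower_in w y) \<noteq> label \<zeta> (upper_in w y)"
      using splits_insert il by (auto simp: splits_at_def)
    have ty: "(label \<xi> (arc_in w y (opposite d)) = label \<xi> (arc_in w x e)) \<longleftrightarrow>
        (label \<xi> (arc_in w y d) \<noteq> label \<xi> (arc_in w x e))" for d e
      by (rule toggle[OF p(1) ne(1) gen_arc_in_mem])
    have tx: "(label \<zeta> (arc_in w x (opposite d)) = label \<zeta> (arc_in w y e)) \<longleftrightarrow>
        (label \<zeta> (arc_in w x d) \<noteq> label \<zeta> (arc_in w y e))" for d e
      by (rule toggle[OF p(2) ne(2) gen_arc_in_mem])
    have tx': "(label \<xi> (arc_in w y e) = label \<xi> (arc_in w x (opposite d))) \<longleftrightarrow>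
        (label \<xi> (arc_in w y e) \<noteq> label \<xi> (arc_in w x d))" for d e
      using toggle[OF refl ne(1), of "arc_in w y e" d] gen_arc_in_mem[of "\<xi>" y e] p(1)
      by (metis (no_types, lifting))
    have ty': "(label \<zeta> (arc_in w x e) = label \<zeta> (arc_in w y (opposite d))) \<longleftrightarrow>
        (label \<zeta> (arc_in w x e) \<noteq> label \<zeta> (arc_in w y d))" for d e
      using toggle[OF refl ne(2), of "arc_in w x e" d] gen_arc_in_mem[of "\<zeta>" x e] p(2)
      by (metis (no_types, lifting))
    have nx: "\<not> splits_at \<zeta> x"
      using int' by (simp add: interleaved_def)
    from rx ry show ?thesis
      using il nx
      by (elim disjE; cases "inside \<alpha> x"; simp add: even_face_def reversal_sign_def tx ty tx' ty'; blast?)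
  next
    case ms
    then show ?thesis
      using splits_merge_split by (simp add: even_face_def reversal_sign_def)
  next
    case sm
    then show ?thesis
      using s.splits_merge_split by (simp add: even_face_def reversal_sign_def)
  next
    case mss
    note n = merge_split_pair[OF mss]
    have ne: "label \<gamma> (lower_in w x) \<noteq> label \<gamma> (upper_in w x)"
      using splits_insert(4) n by (simp add: splits_at_def)
    have toggle: "(label \<gamma> (arc_in w x (opposite d)) = label \<gamma> (arc_in w y e)) \<longleftrightarrow>
        (label \<gamma> (arc_in w x d) \<noteq> label \<gamma> (arc_in w y e))"
      "(label \<gamma> (arc_in w x e) = label \<gamma> (arc_in w y (opposite d))) \<longleftrightarrow>
        (label \<gamma> (arc_in w x e) \<noteq> label \<gamma> (arc_in w y d))" for d e
      using gen_pair[of \<gamma> x d] gen_pair[of \<gamma> y d] gen_arc_in_mem[of \<gamma> x e] gen_arc_in_mem[of \<gamma> y e] n(2) ne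
      by (auto simp: doubleton_eq_iff)
    from rx ry show ?thesis
      using mss n(1)
      by (elim disjE; simp add: even_face_def reversal_sign_def toggle)
  next
    case mm
    then have "\<not> splits_at \<zeta> x"
      using s.merge_split_pair(1) by blast
    then show ?thesis
      using mm by (simp add: even_face_def reversal_sign_def)
  qed
qed

end

section \<open>Order-preserving relabelling of generators\<close>

text \<open>Acts on coefficients, hence contravariantly: a map of labels from the smaller diagram to
  the larger one carries elements over the larger diagram to elements over the smaller one. For a
  strictly monotone map the sorted basis monomials correspond and no signs appear.\<close>

definition relabel :: "('g \<Rightarrow> 'h) \<Rightarrow> ('h, 'r) ext \<Rightarrow> ('g, 'r) ext" where
  "relabel f \<omega> = (\<lambda>U. \<omega> (f ` U))"

lemma relabel_gen_wedge:
  fixes f :: "'g::linorder \<Rightarrow> 'h::linorder"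
  assumes "strict_mono f"
  shows "relabel f (ext_gen (f g) \<and>\<^sub>e \<omega>) = (ext_gen g \<and>\<^sub>e relabel f \<omega>)"
proof (rule ext)
  fix U
  have inj: "inj f"
    using assms by (rule strict_mono_imp_inj_on)
  have "{t \<in> f ` U. t < f g} = f ` {t \<in> U. t < g}"
    using strict_mono_less[OF assms] by auto
  then have "card {t \<in> f ` U. t < f g} = card {t \<in> U. t < g}"
    using inj by (simp add: card_image inj_on_subset)
  moreover have "f ` U - {f g} = f ` (U - {g})"
    using inj by (auto simp: inj_eq)
  ultimately show "relabel f (ext_gen (f g) \<and>\<^sub>e \<omega>) U = (ext_gen g \<and>\<^sub>e relabel f \<omega>) U"
    using inj by (simp add: relabel_def ext_gen_wedge_apply inj_image_mem_iff finite_image_iff inj_on_subset)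
qed

lemma relabel_gen_diff:
  "strict_mono f \<Longrightarrow> relabel f (gen_diff (f u) (f v) \<omega>) = gen_diff u v (relabel f \<omega>)"
  using relabel_gen_wedge[of f u \<omega>] relabel_gen_wedge[of f v \<omega>]
  by (simp add: gen_diff_def relabel_def fun_eq_iff)

lemma relabel_wedge_list:
  fixes f :: "'g::linorder \<Rightarrow> 'h::linorder"
  shows "strict_mono f \<Longrightarrow> relabel f (wedge_list (map f l)) = wedge_list l"
proof (induction l)
  case Nil
  show ?case
    by (simp add: relabel_def ext_basis_def fun_eq_iff)
next
  case (Cons g l)
  then show ?case
    by (simp add: relabel_gen_wedge)
qed

lemma sorted_list_of_set_image_strict_mono:
  fixes f :: "'g::linorder \<Rightarrow> 'h::linorder"
  assumes "strict_mono f" "finite S"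
  shows "sorted_list_of_set (f ` S) = map f (sorted_list_of_set S)"
proof (rule sorted_distinct_set_unique)
  have inj: "inj f"
    using assms(1) by (rule strict_mono_imp_inj_on)
  show "sorted (map f (sorted_list_of_set S))"
    using assms by (simp add: sorted_map sorted_wrt_mono_rel[OF _ sorted_sorted_list_of_set] strict_mono_less_eq)
  show "distinct (map f (sorted_list_of_set S))"
    by (simp add: distinct_map inj_on_subset[OF inj subset_UNIV])
qed (use assms in auto)

lemma relabel_ext_map:
  fixes f :: "'g::linorder \<Rightarrow> 'h::linorder" and \<omega> :: "('h, 'r::comm_ring_1) ext"
  assumes f: "strict_mono f" and G: "finite G" and h: "\<And>g. g \<in> G \<Longrightarrow> h (f g) = f (k g)"
  shows "relabel f (ext_map (f ` G) h \<omega>) = ext_map G k (relabel f \<omega>)"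
proof (rule ext)
  fix U
  have inj: "inj f"
    using f by (rule strict_mono_imp_inj_on)
  have "Pow (f ` G) = (`) f ` Pow G"
    by (simp add: image_Pow_surj)
  moreover have "inj_on ((`) f) (Pow G)"
    using inj by (simp add: inj_on_def inj_image_eq_iff)
  ultimately have "relabel f (ext_map (f ` G) h \<omega>) U =
      (\<Sum>S\<in>Pow G. \<omega> (f ` S) * wedge_list (map h (sorted_list_of_set (f ` S))) (f ` U))"
    by (simp add: relabel_def ext_map_def sum.reindex)
  also have "\<dots> = (\<Sum>S\<in>Pow G. relabel f \<omega> S * wedge_list (map k (sorted_list_of_set S)) U)"
  proof (intro sum.cong refl)
    fix S assume S: "S \<in> Pow G"
    then have fin: "finite S"
      using G by (auto intro: finite_subset)
    have "map h (sorted_list_of_set (f ` S)) = map f (map k (sorted_list_of_set S))"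
      using S fin h by (auto simp: sorted_list_of_set_image_strict_mono[OF f])
    then have "wedge_list (map h (sorted_list_of_set (f ` S))) (f ` U) =
        (relabel f (wedge_list (map f (map k (sorted_list_of_set S)))) U :: 'r)"
      by (simp only: relabel_def)
    then show "\<omega> (f ` S) * wedge_list (map h (sorted_list_of_set (f ` S))) (f ` U) =
        relabel f \<omega> S * wedge_list (map k (sorted_list_of_set S)) U"
      unfolding relabel_wedge_list[OF f] by (simp add: relabel_def)
  qed
  finally show "relabel f (ext_map (f ` G) h \<omega>) U = ext_map G k (relabel f \<omega>) U"
    by (simp add: ext_map_def)
qed

section \<open>Deleting a positive crossing\<close>

locale braid_deletion =
  fixes b i :: nat and u v :: braid_word
  assumes braid_word: "is_braid_word b (u @ PosGen i # v)"
begin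

abbreviation D :: braid_word where "D \<equiv> u @ PosGen i # v"
abbreviation E :: braid_word where "E \<equiv> u @ v"
abbreviation n :: nat where "n \<equiv> length u"

sublocale D: braid_diagram b D
  using braid_word by unfold_locales

sublocale E: braid_diagram b E
  using braid_word by unfold_locales (auto simp: is_braid_word_def)

text \<open>The values omit \<open>n\<close>, so image sets are vertices at which the deleted
  crossing is 0-smoothed.\<close>

definition emb :: "nat \<Rightarrow> nat" where
  "emb y = (if y < n then y else Suc y)"

text \<open>
  Smoothing the crossing \<open>n\<close> vertically joins \<open>(n, j)\<close> to \<open>(Suc n, j)\<close>. Since \<open>(n, j)\<close> is the
  smaller one, the labels of the circles avoid height \<open>Suc n\<close>, and \<open>lift\<close> preserves them; the map
  \<open>collapse\<close> is not monotone.
\<close>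

definition lift :: "segment \<Rightarrow> segment" where
  "lift s = (if fst s \<le> n then s else (Suc (fst s), snd s))"

definition collapse :: "segment \<Rightarrow> segment" where
  "collapse s = (if fst s \<le> n then s else (fst s - 1, snd s))"

lemma strict_mono_emb: "strict_mono emb"
  by (auto simp: strict_mono_def emb_def)

lemma inj_emb: "inj emb"
  using strict_mono_emb by (rule strict_mono_imp_inj_on)

lemma emb_mem_iff [simp]: "emb y \<in> emb ` \<alpha> \<longleftrightarrow> y \<in> \<alpha>"
  using inj_emb by (rule inj_image_mem_iff)

lemma n_notin [simp]: "n \<notin> emb ` \<alpha>"
  by (auto simp: emb_def)

lemma emb_less_iff: "emb y < length D \<longleftrightarrow> y < length E"
  by (auto simp: emb_def)

lemma nth_emb [simp]: "D ! emb y = E ! y"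
  by (auto simp: emb_def nth_append Suc_diff_le)

lemma crossings_cases:
  assumes "t < length D"
  obtains "t = n" | y where "y < length E" "t = emb y"
proof (cases t n rule: linorder_cases)
  case less
  then show thesis
    by (intro that(2)[of t]) (auto simp: emb_def)
next
  case greater
  then show thesis
    using assms by (intro that(2)[of "t - 1"]) (auto simp: emb_def)
qed (rule that(1))

lemma emb_crossings: "emb ` \<beta> \<subseteq> crossings D \<longleftrightarrow> \<beta> \<subseteq> crossings E"
  using emb_less_iff by auto

lemma vertical_emb [simp]: "vertical D (emb ` \<alpha>) (emb y) \<longleftrightarrow> vertical E \<alpha> y"
  by (simp add: vertical_def)

lemma vertical_n: "vertical D (emb ` \<alpha>) n"
  by (simp add: vertical_def)

lemma at_crossing_emb [simp]: "at_crossing D (emb y) j \<longleftrightarrow> at_crossing E y j"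
  by (simp add: at_crossing_def)

lemma other_strand_emb [simp]: "other_strand D (emb y) j = other_strand E y j"
  by (simp add: other_strand_def)

lemma strict_mono_lift: "strict_mono lift"
  by (auto simp: strict_mono_def lift_def less_prod_def less_eq_prod_def)

lemma lift_in: "s \<in> E.S \<Longrightarrow> lift s \<in> D.S"
  by (auto simp: lift_def segments_def)

lemma collapse_in: "s \<in> D.S \<Longrightarrow> collapse s \<in> E.S"
  by (auto simp: collapse_def segments_def)

lemma collapse_lift [simp]: "collapse (lift s) = s"
  by (simp add: collapse_def lift_def)

lemma lift_collapse_le: "lift (collapse s) \<le> s"
  by (cases s) (auto simp: collapse_def lift_def less_eq_prod_def)

lemma D_in: "t \<le> length D \<Longrightarrow> 1 \<le> j \<Longrightarrow> j \<le> b \<Longrightarrow> (t, j) \<in> D.S"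
  and E_in: "t \<le> length E \<Longrightarrow> 1 \<le> j \<Longrightarrow> j \<le> b \<Longrightarrow> (t, j) \<in> E.S"
  by (simp_all add: segments_def)

section \<open>Circles of the two diagrams\<close>

lemma gen_deleted:
  assumes "1 \<le> j" "j \<le> b"
  shows "gen b D (emb ` \<alpha>) (Suc n, j) = gen b D (emb ` \<alpha>) (n, j)"
  using D.gen_above[of "(n, j)" "emb ` \<alpha>"] assms D_in[of n j] vertical_n[of \<alpha>] by simp

lemma gen_lift_collapse:
  assumes "s \<in> D.S"
  shows "gen b D (emb ` \<alpha>) (lift (collapse s)) = gen b D (emb ` \<alpha>) s"
proof -
  obtain t j where s: "s = (t, j)" "1 \<le> j" "j \<le> b"
    using assms by (cases s) (simp add: segments_def)
  show ?thesis
    using gen_deleted[OF s(2,3), of \<alpha>] by (cases "t = Suc n") (auto simp: s collapse_def lift_def)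
qed

lemma collapse_emb [simp]: "collapse (emb y, j) = (y, j)" "collapse (Suc (emb y), j) = (Suc y, j)"
  by (auto simp: collapse_def emb_def)

lemma collapse_ends [simp]: "collapse (0, j) = (0, j)" "collapse (Suc (n + length v), j) = (n + length v, j)"
  "collapse (n, j) = (n, j)" "collapse (Suc n, j) = (n, j)"
  by (auto simp: collapse_def)

text \<open>A step upwards in the larger diagram becomes such a step in the smaller one, except that
  passing the deleted crossing becomes no step at all.\<close>

lemma gen_collapse_above:
  assumes "s \<in> D.S"
  shows "gen b E \<alpha> (collapse (above D (emb ` \<alpha>) s)) = gen b E \<alpha> (collapse s)"
proof -
  obtain t j where s: "s = (t, j)" "t \<le> length D" "1 \<le> j" "j \<le> b"
    using assms by (cases s) (simp add: segments_def)
  consider "t = length D" | "t = n" | y where "y < length E" "t = emb y"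
    using s(2) crossings_cases[of t] by (metis le_neq_implies_less)
  then show ?thesis
  proof cases
    case 1
    then show ?thesis
      using E.gen_above[of "(length E, j)" \<alpha>] E_in[of "length E" j] s by simp
  next
    case 2
    then show ?thesis
      using vertical_n[of \<alpha>] by (simp add: s)
  next
    case 3
    then have "emb y \<noteq> length D"
      using emb_less_iff[of y] by simp
    then show ?thesis
      using 3 E.gen_above[of "(y, j)" \<alpha>] E_in[of y j] s by (auto split: if_splits)
  qed
qed

lemma gen_collapse_below:
  assumes "s \<in> D.S"
  shows "gen b E \<alpha> (collapse (below D (emb ` \<alpha>) s)) = gen b E \<alpha> (collapse s)"
proof -
  obtain t j where s: "s = (t, j)" "t \<le> length D" "1 \<le> j" "j \<le> b"
    using assms by (cases s) (simp add: segments_def)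
  consider "t = 0" | "t = Suc n" | y where "y < length E" "t = Suc (emb y)"
  proof (cases t)
    case (Suc t')
    then have "t' < length D"
      using s(2) by simp
    then show thesis
      by (rule crossings_cases) (use Suc that in auto)
  qed (rule that(1))
  then show ?thesis
  proof cases
    case 1
    then show ?thesis
      using E.gen_below[of "(0, j)" \<alpha>] E_in[of 0 j] s by simp
  next
    case 2
    then show ?thesis
      using vertical_n[of \<alpha>] by (simp add: s)
  next
    case 3
    then show ?thesis
      using E.gen_below[of "(Suc y, j)" \<alpha>] E_in[of "Suc y" j] s by (auto split: if_splits)
  qed
qed

lemma gen_collapse:
  assumes "r \<in> D.S" "s \<in> D.S" "gen b D (emb ` \<alpha>) r = gen b D (emb ` \<alpha>) s"
  shows "gen b E \<alpha> (collapse r) = gen b E \<alpha> (collapse s)"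
proof -
  interpret f: finite_permutation D.S "nxt b D (emb ` \<alpha>)" by (rule D.perm)
  have "orbit_rel (nxt b D (emb ` \<alpha>)) r s"
    using assms by (simp add: D.gen_eq_iff)
  then show ?thesis
  proof (induction rule: orbit_rel_induct)
    case (step t)
    then have "t \<in> D.S"
      using f.orbit_rel_in assms(1) by blast
    then show ?case
      using step gen_collapse_above[of t \<alpha>] gen_collapse_below[of t \<alpha>] by (simp add: nxt_def)
  qed simp
qed

text \<open>In the first claim only \<open>y = n\<close> is at issue: there \<open>lift\<close>
  stays at height \<open>n\<close> while \<open>emb\<close> moves to \<open>n + 1\<close>, and the
  vertical smoothing joins the two.\<close>

lemma gen_emb:
  assumes "1 \<le> j" "j \<le> b"
  shows "gen b D (emb ` \<alpha>) (lift (y, j)) = gen b D (emb ` \<alpha>) (emb y, j)"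
    and "lift (Suc y, j) = (Suc (emb y), j)"
proof -
  show "gen b D (emb ` \<alpha>) (lift (y, j)) = gen b D (emb ` \<alpha>) (emb y, j)"
    using gen_deleted[OF assms, of \<alpha>] by (cases "y = n") (auto simp: lift_def emb_def)
  show "lift (Suc y, j) = (Suc (emb y), j)"
    by (auto simp: lift_def emb_def)
qed

lemma gen_lift_ends:
  assumes "1 \<le> j" "j \<le> b"
  shows "gen b D (emb ` \<alpha>) (lift (length E, j)) = gen b D (emb ` \<alpha>) (lift (0, j))"
proof -
  \<comment> \<open>If \<open>v\<close> is empty, the top height of the smaller diagram is
    \<open>n\<close> itself, and \<open>lift\<close> does not raise it to the top of the larger
    one.\<close>
  have "gen b D (emb ` \<alpha>) (lift (length E, j)) = gen b D (emb ` \<alpha>) (length D, j)"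
    using gen_deleted[OF assms, of \<alpha>] by (cases "v = []") (auto simp: lift_def)
  also have "\<dots> = gen b D (emb ` \<alpha>) (0, j)"
    using D.gen_above[of "(length D, j)" "emb ` \<alpha>"] D_in[of "length D" j] assms by simp
  finally show ?thesis
    by (simp add: lift_def)
qed

lemma gen_lift_above:
  assumes "s \<in> E.S"
  shows "gen b D (emb ` \<alpha>) (lift (above E \<alpha> s)) = gen b D (emb ` \<alpha>) (lift s)"
proof -
  obtain t j where s: "s = (t, j)" "t \<le> length E" "1 \<le> j" "j \<le> b"
    using assms by (cases s) (simp add: segments_def)
  show ?thesis
  proof (cases "t = length E")
    case True
    then show ?thesis
      using gen_lift_ends[OF s(3,4), of \<alpha>] by (simp add: s)
  next
    case False
    then have t: "t < length E" "emb t < length D"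
      using s(2) emb_less_iff[of t] by auto
    have "(emb t, j) \<in> D.S"
      using t s by (intro D_in) auto
    note ab = D.gen_above[OF this, of "emb ` \<alpha>"]
    have "1 \<le> other_strand E t j" "other_strand E t j \<le> b" if "at_crossing E t j"
      using E.other_strand_range[OF t(1) that] by auto
    then show ?thesis
      using ab t False gen_emb(1)[OF s(3,4), of \<alpha> t] gen_emb(2)[OF s(3,4), of t]
        gen_emb(1)[of "other_strand E t j" \<alpha> t] gen_emb(2)[of "other_strand E t j" t]
      by (auto simp: s split: if_splits)
  qed
qed

lemma gen_lift_below:
  assumes "s \<in> E.S"
  shows "gen b D (emb ` \<alpha>) (lift (below E \<alpha> s)) = gen b D (emb ` \<alpha>) (lift s)"
proof -
  obtain t j where s: "s = (t, j)" "t \<le> length E" "1 \<le> j" "j \<le> b"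
    using assms by (cases s) (simp add: segments_def)
  show ?thesis
  proof (cases t)
    case 0
    then show ?thesis
      using gen_lift_ends[OF s(3,4), of \<alpha>] by (simp add: s)
  next
    case (Suc t')
    then have t: "t' < length E" "emb t' < length D"
      using s(2) emb_less_iff[of t'] by auto
    have "(Suc (emb t'), j) \<in> D.S"
      using t s by (intro D_in) auto
    note bl = D.gen_below[OF this, of "emb ` \<alpha>"]
    have "1 \<le> other_strand E t' j" "other_strand E t' j \<le> b" if "at_crossing E t' j"
      using E.other_strand_range[OF t(1) that] by auto
    then show ?thesis
      using bl t Suc gen_emb(1)[OF s(3,4), of \<alpha> t'] gen_emb(2)[OF s(3,4), of t']
        gen_emb(1)[of "other_strand E t' j" \<alpha> t'] gen_emb(2)[of "other_strand E t' j" t']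
      by (auto simp: s split: if_splits)
  qed
qed

lemma gen_lift:
  assumes "r \<in> E.S" "s \<in> E.S" "gen b E \<alpha> r = gen b E \<alpha> s"
  shows "gen b D (emb ` \<alpha>) (lift r) = gen b D (emb ` \<alpha>) (lift s)"
proof -
  interpret f: finite_permutation E.S "nxt b E \<alpha>" by (rule E.perm)
  have "orbit_rel (nxt b E \<alpha>) r s"
    using assms by (simp add: E.gen_eq_iff)
  then show ?thesis
  proof (induction rule: orbit_rel_induct)
    case (step t)
    then have "t \<in> E.S"
      using f.orbit_rel_in assms(1) by blast
    then show ?case
      using step gen_lift_above[of t \<alpha>] gen_lift_below[of t \<alpha>] by (simp add: nxt_def)
  qed simp
qed

lemma gen_collapse_iff:
  assumes "r \<in> D.S" "s \<in> D.S"
  shows "gen b D (emb ` \<alpha>) r = gen b D (emb ` \<alpha>) s \<longleftrightarrow> gen b E \<alpha> (collapse r) = gen b E \<alpha> (collapse s)"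
  using gen_collapse[OF assms] gen_lift[of "collapse r" "collapse s" \<alpha>] collapse_in assms
    gen_lift_collapse[of r \<alpha>] gen_lift_collapse[of s \<alpha>] by metis

lemma circle_collapse:
  assumes "r \<in> D.S" "s \<in> D.S"
  shows "s \<in> circle b D (emb ` \<alpha>) r \<longleftrightarrow> collapse s \<in> circle b E \<alpha> (collapse r)"
  using gen_collapse_iff[OF assms, of \<alpha>] D.gen_eq_iff_circle[OF assms, of "emb ` \<alpha>"]
    E.gen_eq_iff_circle[of "collapse r" "collapse s" \<alpha>] collapse_in assms by blast

text \<open>The lift of the least segment of the small circle lies on the large circle. It is least
  there because \<open>lift\<close> is monotone and \<open>lift (collapse s) \<le> s\<close> for
  every \<open>s\<close>.\<close>

lemma gen_eq_lift:
  assumes r: "r \<in> D.S"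
  shows "gen b D (emb ` \<alpha>) r = lift (gen b E \<alpha> (collapse r))"
  unfolding gen_def[of b D]
proof (rule Min_eqI)
  let ?m = "gen b E \<alpha> (collapse r)"
  have m: "?m \<in> E.S"
    using r collapse_in E.gen_in by blast
  show "finite (circle b D (emb ` \<alpha>) r)"
    using r by (rule D.finite_circle)
  show "lift ?m \<in> circle b D (emb ` \<alpha>) r"
    using circle_collapse[OF r lift_in[OF m], of \<alpha>] E.gen_in_circle[OF collapse_in[OF r]] by simp
  fix s assume s: "s \<in> circle b D (emb ` \<alpha>) r"
  then have sS: "s \<in> D.S"
    using D.circle_subset[OF r] by blast
  then have "collapse s \<in> circle b E \<alpha> (collapse r)"
    using s circle_collapse[OF r] by blast
  then have "?m \<le> collapse s"
    unfolding gen_def using E.finite_circle[OF collapse_in[OF r]] by (intro Min_le)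
  then have "lift ?m \<le> lift (collapse s)"
    using strict_mono_less_eq[OF strict_mono_lift] by blast
  also have "\<dots> \<le> s"
    by (rule lift_collapse_le)
  finally show "lift ?m \<le> s" .
qed

lemma gens_lift: "gens b D (emb ` \<alpha>) = lift ` gens b E \<alpha>"
proof -
  have "E.S = collapse ` D.S"
    using collapse_in lift_in collapse_lift by (metis image_subset_iff subset_antisym subsetI image_eqI)
  then show ?thesis
    unfolding gens_def by (auto simp: gen_eq_lift image_image)
qed

lemma collapse_arc_in [simp]: "collapse (arc_in D (emb y) d) = arc_in E y d"
  "collapse (lower_in D (emb y)) = lower_in E y" "collapse (upper_in D (emb y)) = upper_in E y"
  by (simp_all add: arc_in_def lower_in_def upper_in_def)

lemma points_emb_in:
  assumes "y < length E"
  shows "lower_in D (emb y) \<in> D.S" "upper_in D (emb y) \<in> D.S" "arc_in D (emb y) d \<in> D.S"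
  using D.points_in emb_less_iff assms by auto

section \<open>Invariance of faces and edge maps under the deletion\<close>

lemma splits_at_emb: "y < length E \<Longrightarrow> D.splits_at (emb ` \<alpha>) (emb y) \<longleftrightarrow> E.splits_at \<alpha> y"
  using points_emb_in by (simp add: D.splits_at_def E.splits_at_def gen_collapse_iff)

text \<open>\<open>collapse\<close> changes heights only, so a ray in the larger diagram meets a
  circle on the same strands as the corresponding ray in the smaller one.\<close>

lemma right_even_collapse:
  assumes r: "r \<in> D.S" and s: "s \<in> D.S"
  shows "right_even b (circle b D (emb ` \<alpha>) r) s \<longleftrightarrow> right_even b (circle b E \<alpha> (collapse r)) (collapse s)"
proof -
  have "(fst s, j) \<in> circle b D (emb ` \<alpha>) r \<longleftrightarrow> (fst (collapse s), j) \<in> circle b E \<alpha> (collapse r)"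
    if "snd s < j" "j \<le> b" for j
  proof -
    have "(fst s, j) \<in> D.S"
      using s that by (cases s) (simp add: segments_def)
    moreover have "collapse (fst s, j) = (fst (collapse s), j)"
      by (simp add: collapse_def)
    ultimately show ?thesis
      using circle_collapse[OF r, of "(fst s, j)" \<alpha>] by simp
  qed
  moreover have "snd (collapse s) = snd s"
    by (simp add: collapse_def)
  ultimately show ?thesis
    unfolding right_even_def by (metis (no_types, lifting) Collect_cong)
qed

lemma oriented_up_collapse:
  assumes "s \<in> D.S"
  shows "D.oriented_up (emb ` \<alpha>) s \<longleftrightarrow> E.oriented_up \<alpha> (collapse s)"
proof -
  have "snd (collapse s) = snd s"
    by (simp add: collapse_def)
  then show ?thesis
    using right_even_collapse[OF assms assms, of \<alpha>]
    by (simp add: D.oriented_up_def E.oriented_up_def D.ccw_up_eq E.ccw_up_eq)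
qed

lemma inside_emb:
  assumes y: "y < length E"
  shows "D.inside (emb ` \<alpha>) (emb y) \<longleftrightarrow> E.inside \<alpha> y"
proof -
  have "collapse (D.gap (emb ` \<alpha>) (emb y)) = E.gap \<alpha> y"
    by (simp add: D.gap_def E.gap_def)
  moreover have "D.gap (emb ` \<alpha>) (emb y) \<in> D.S"
    using D.strand_bounds[of "emb y"] y emb_less_iff[of y] by (auto simp: D.gap_def intro!: D_in)
  ultimately show ?thesis
    using right_even_collapse[OF points_emb_in(1)[OF y]] by (simp add: D.inside_def E.inside_def)
qed

text \<open>\<open>even_face\<close> mentions only equality of labels, splitting, the side on which
  an arrow lies and orientation, each of which survives the deletion.\<close>

lemma even_face_emb:
  assumes "x < length E" "y < length E"
  shows "D.even_face A (emb ` \<alpha>) (emb x) (emb y) \<longleftrightarrow> E.even_face (A \<circ> emb) \<alpha> x y"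
proof -
  have i: "insert (emb z) (emb ` \<beta>) = emb ` insert z \<beta>" for z \<beta>
    by simp
  show ?thesis
    unfolding D.even_face_def E.even_face_def i
    using assms points_emb_in[OF assms(1)] points_emb_in[OF assms(2)]
    by (simp only: splits_at_emb inside_emb oriented_up_collapse gen_collapse_iff collapse_arc_in o_apply)
qed

lemma arrow_choice_emb:
  assumes "arrow_choice D A"
  shows "arrow_choice E (A \<circ> emb)"
  unfolding arrow_choice_def
proof
  fix y assume "y \<in> crossings E"
  then have "emb y \<in> crossings D"
    using emb_less_iff by simp
  then have "A (emb y) \<in> (if positive D (emb y) then {East, West} else {North, South})"
    using assms unfolding arrow_choice_def by blast
  then show "(A \<circ> emb) y \<in> (if positive E y then {East, West} else {North, South})"
    by simp
qed

text \<open>The generator maps correspond under \<open>lift\<close>, including the choice made at a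
  split, because the arrows of the smaller diagram are the inherited ones.\<close>

lemma edge_map_emb:
  assumes A: "arrow_choice D A" and x: "x \<in> crossings E - \<alpha>"
  shows "relabel lift (edge_map b D A (emb ` \<alpha>) (emb x) \<omega>) = edge_map b E (A \<circ> emb) \<alpha> x (relabel lift \<omega>)"
proof -
  have xl: "x < length E"
    using x by simp
  have x': "emb x \<in> crossings D - emb ` \<alpha>"
    using x emb_less_iff[of x] by simp
  have i: "insert (emb x) (emb ` \<alpha>) = emb ` insert x \<alpha>"
    by simp
  have f: "D.edge_fun A (emb ` \<alpha>) (emb x) (lift g) = lift (E.edge_fun (A \<circ> emb) \<alpha> x g)"
    if "g \<in> gens b E \<alpha>" for g
  proof -
    have "g \<in> E.S"
      using that E.gens_subset by blast
    then have "gen b D (emb ` insert x \<alpha>) (lift g) = lift (gen b E (insert x \<alpha>) g)"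
      using gen_eq_lift[OF lift_in, of g "insert x \<alpha>"] by (simp del: image_insert)
    moreover have "lift p = lift q \<longleftrightarrow> p = q" for p q
      using strict_mono_lift by (simp add: strict_mono_eq)
    ultimately show ?thesis
      using points_emb_in[OF xl]
      by (simp add: D.edge_fun_def E.edge_fun_def i splits_at_emb[OF xl] gen_eq_lift del: image_insert)
  qed
  have ext: "relabel lift (ext_map (gens b D (emb ` \<alpha>)) (D.edge_fun A (emb ` \<alpha>) (emb x)) \<omega>) =
      ext_map (gens b E \<alpha>) (E.edge_fun (A \<circ> emb) \<alpha> x) (relabel lift \<omega>)"
    unfolding gens_lift by (intro relabel_ext_map strict_mono_lift E.finite_gens f)
  show ?thesis
    unfolding D.edge_map_eq[OF A x'] E.edge_map_eq[OF arrow_choice_emb[OF A] x] ext[symmetric] i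
    using points_emb_in(3)[OF xl]
    by (simp add: D.edge_diff_def E.edge_diff_def splits_at_emb[OF xl] gen_eq_lift
        relabel_gen_diff[OF strict_mono_lift] del: image_insert)
qed

text \<open>The deleted crossing is positive, hence 0-smoothed in the braid-like resolution.\<close>

lemma braid_vertex_emb: "braid_vertex D = emb ` braid_vertex E"
proof -
  have "y \<in> braid_vertex D \<longleftrightarrow> y \<in> emb ` braid_vertex E" for y
  proof (cases "y < length D")
    case True
    then show ?thesis
    proof (cases rule: crossings_cases)
      case 1
      then show ?thesis
        using n_notin[of "braid_vertex E"] by (simp add: braid_vertex_def)
    next
      case (2 z)
      then show ?thesis
        using emb_less_iff[of z] by (simp add: braid_vertex_def)
    qed
  next
    case False
    then show ?thesis
      using emb_less_iff by (auto simp: braid_vertex_def)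
  qed
  then show ?thesis
    by blast
qed

lemma relabel_psi_chain: "relabel lift (psi_chain b D (emb ` \<alpha>)) = psi_chain b E \<alpha>"
proof -
  have "emb ` \<alpha> = emb ` braid_vertex E \<longleftrightarrow> \<alpha> = braid_vertex E"
    using inj_emb by (rule inj_image_eq_iff)
  moreover have "map (\<lambda>j. gen b D (emb ` braid_vertex E) (0, j)) [1..<Suc b] =
      map lift (map (\<lambda>j. gen b E (braid_vertex E) (0, j)) [1..<Suc b])"
    by (auto simp: gen_eq_lift D_in)
  ultimately show ?thesis
    unfolding psi_chain_def braid_vertex_emb
    by (simp only: relabel_wedge_list[OF strict_mono_lift] if_distrib[of "relabel lift"] if_True if_False cong: if_cong)
      (auto simp: relabel_def fun_eq_iff)
qed

end

section \<open>Signs on the cube and homology\<close>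

lemma sign_square: "a \<in> {1, - 1} \<Longrightarrow> a * a = (1 :: int)"
  by auto

text \<open>Vanishing of the first cohomology of the cube with values in the signs. Every sign is
  its own inverse, so the coboundary of \<open>\<eta>\<close> is written as a product.\<close>

lemma cube_cocycle_trivial:
  fixes r :: "nat set \<times> nat \<Rightarrow> int"
  assumes sign: "\<And>\<alpha> x. \<alpha> \<subseteq> {..<N} \<Longrightarrow> x \<in> {..<N} - \<alpha> \<Longrightarrow> r (\<alpha>, x) \<in> {1, - 1}"
    and face: "\<And>\<alpha> x y. \<alpha> \<subseteq> {..<N} \<Longrightarrow> x \<in> {..<N} - \<alpha> \<Longrightarrow> y \<in> {..<N} - \<alpha> \<Longrightarrow> x \<noteq> y \<Longrightarrow>
      r (\<alpha>, x) * r (\<alpha>, y) * r (insert x \<alpha>, y) * r (insert y \<alpha>, x) = 1"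
  obtains \<eta> where "\<And>\<alpha>. \<alpha> \<subseteq> {..<N} \<Longrightarrow> \<eta> \<alpha> \<in> {1, - 1 :: int}"
    and "\<And>\<alpha> x. \<alpha> \<subseteq> {..<N} \<Longrightarrow> x \<in> {..<N} - \<alpha> \<Longrightarrow> r (\<alpha>, x) = \<eta> \<alpha> * \<eta> (insert x \<alpha>)"
proof -
  \<comment> \<open>the product along the path from the empty vertex that adds the elements of \<open>\<alpha>\<close> in increasing order\<close>
  define \<eta> where "\<eta> \<alpha> = (\<Prod>y\<in>\<alpha>. r ({z \<in> \<alpha>. z < y}, y))" for \<alpha>
  have \<eta>_sign: "\<eta> \<alpha> \<in> {1, - 1}" if "\<alpha> \<subseteq> {..<N}" for \<alpha>
  proof -
    have "r ({z \<in> \<alpha>. z < y}, y) \<in> {1, - 1}" if "y \<in> \<alpha>" for y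
      using \<open>\<alpha> \<subseteq> {..<N}\<close> that by (intro sign) auto
    then have "\<eta> \<alpha> = (- 1) ^ card {y \<in> \<alpha>. r ({z \<in> \<alpha>. z < y}, y) = - 1}"
      unfolding \<eta>_def using that by (intro prod_signs) (auto intro: finite_subset)
    then show ?thesis
      by (simp add: minus_one_power_iff)
  qed
  have \<eta>_max: "\<eta> (insert x \<alpha>) = \<eta> \<alpha> * r (\<alpha>, x)" if "finite \<alpha>" "\<And>a. a \<in> \<alpha> \<Longrightarrow> a < x" for \<alpha> x
  proof -
    have "x \<notin> \<alpha>" "{z \<in> insert x \<alpha>. z < x} = \<alpha>"
      using that(2) by auto
    moreover have "{z \<in> insert x \<alpha>. z < y} = {z \<in> \<alpha>. z < y}" if "y \<in> \<alpha>" for y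
      using that \<open>\<And>a. a \<in> \<alpha> \<Longrightarrow> a < x\<close>[of y] by auto
    ultimately show ?thesis
      unfolding \<eta>_def using that(1) by (simp add: mult.commute)
  qed
  have cocycle: "r (\<alpha>, x) = \<eta> \<alpha> * \<eta> (insert x \<alpha>)" if "finite \<alpha>" "\<alpha> \<subseteq> {..<N}" "x \<in> {..<N} - \<alpha>" for \<alpha> x
    using that
  proof (induction \<alpha> arbitrary: x rule: finite_linorder_max_induct)
    case empty
    then show ?case
      using \<eta>_max[of "{}" x] by (simp add: \<eta>_def)
  next
    case (insert m \<alpha>)
    show ?case
    proof (cases "m < x")
      case True
      then have "\<eta> (insert x (insert m \<alpha>)) = \<eta> (insert m \<alpha>) * r (insert m \<alpha>, x)"
        using insert by (intro \<eta>_max) auto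
      then show ?thesis
        using sign_square[OF \<eta>_sign[OF insert.prems(1)]] by (simp flip: mult.assoc)
    next
      \<comment> \<open>An edge that does not add the largest element is compared, across the face
        spanned by \<open>x\<close> and the maximum \<open>m\<close>, with three edges whose signs
        are already known.\<close>
      case False
      then have x: "x < m"
        using insert.prems by auto
      have 1: "\<eta> (insert m (insert x \<alpha>)) = \<eta> (insert x \<alpha>) * r (insert x \<alpha>, m)"
        using insert x by (intro \<eta>_max) auto
      have 2: "\<eta> (insert m \<alpha>) = \<eta> \<alpha> * r (\<alpha>, m)"
        using insert by (intro \<eta>_max) auto
      have 3: "r (\<alpha>, x) = \<eta> \<alpha> * \<eta> (insert x \<alpha>)"
        using insert by (intro insert.IH) auto
      have m: "m \<in> {..<N} - \<alpha>" "m \<in> {..<N} - insert x \<alpha>" "x \<in> {..<N} - \<alpha>" "\<alpha> \<subseteq> {..<N}" "insert x \<alpha> \<subseteq> {..<N}"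
        "x \<in> {..<N} - insert m \<alpha>" "insert m \<alpha> \<subseteq> {..<N}"
        using insert x by auto
      have 4: "r (\<alpha>, x) * r (\<alpha>, m) * r (insert x \<alpha>, m) * r (insert m \<alpha>, x) = 1"
        using m x by (intro face) auto
      have "r (insert m \<alpha>, x) = r (\<alpha>, x) * r (\<alpha>, m) * r (insert x \<alpha>, m)"
        using 4 sign_square[OF sign[OF m(7,6)]] by (metis mult.assoc mult.right_neutral mult_1)
      then show ?thesis
        unfolding insert_commute[of x m] 1 2 3 by simp
    qed
  qed
  show thesis
  proof (rule that[of \<eta>])
    show "r (\<alpha>, x) = \<eta> \<alpha> * \<eta> (insert x \<alpha>)" if "\<alpha> \<subseteq> {..<N}" "x \<in> {..<N} - \<alpha>" for \<alpha> x
      using that by (intro cocycle) (auto intro: finite_subset)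
  qed (rule \<eta>_sign)
qed

section \<open>Chains, boundaries and homology classes\<close>

lemma ext_alg_iff: "\<omega> \<in> ext_alg G \<longleftrightarrow> (\<forall>S. \<not> S \<subseteq> G \<longrightarrow> \<omega> S = 0)"
  by (auto simp: ext_alg_def)

lemma chains_iff:
  "c \<in> chains b w \<longleftrightarrow> (\<forall>\<alpha>. (\<alpha> \<subseteq> crossings w \<longrightarrow> c \<alpha> \<in> ext_alg (gens b w \<alpha>)) \<and> (\<not> \<alpha> \<subseteq> crossings w \<longrightarrow> c \<alpha> = 0))"
  unfolding chains_def by (simp only: mem_Collect_eq if_split_mem2 singleton_iff)

lemma chains_add: "c \<in> chains b w \<Longrightarrow> c' \<in> chains b w \<Longrightarrow> c + c' \<in> chains b w"
  unfolding chains_iff ext_alg_iff by simp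

lemma chains_scale: "c \<in> chains b w \<Longrightarrow> (\<lambda>\<alpha> S. r * c \<alpha> S) \<in> chains b w"
  unfolding chains_iff ext_alg_iff by (simp add: fun_eq_iff)

lemma edge_map_add: "edge_map b w A \<alpha> x (\<omega> + \<eta>) = edge_map b w A \<alpha> x \<omega> + edge_map b w A \<alpha> x \<eta>"
  by (simp add: edge_map_def Let_def ext_map_add wedge_add_right)

lemma edge_map_scale: "edge_map b w A \<alpha> x (\<lambda>U. r * \<omega> U) = (\<lambda>U. r * edge_map b w A \<alpha> x \<omega> U)"
  by (simp add: edge_map_def Let_def ext_map_scale wedge_scale_right)

lemma differential_add: "differential b w A \<epsilon> (c + c') = differential b w A \<epsilon> c + differential b w A \<epsilon> c'"
  by (simp add: differential_def fun_eq_iff edge_map_add sum.distrib algebra_simps)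

lemma differential_scale:
  "differential b w A \<epsilon> (\<lambda>\<alpha> S. r * c \<alpha> S) = (\<lambda>\<alpha> S. r * differential b w A \<epsilon> c \<alpha> S)"
  by (simp add: differential_def fun_eq_iff edge_map_scale sum_distrib_left algebra_simps)

lemma boundaries_add:
  "h \<in> boundaries b w A \<epsilon> \<Longrightarrow> h' \<in> boundaries b w A \<epsilon> \<Longrightarrow> h + h' \<in> boundaries b w A \<epsilon>"
  unfolding boundaries_def by (auto simp flip: differential_add intro: chains_add)

lemma boundaries_scale: "h \<in> boundaries b w A \<epsilon> \<Longrightarrow> (\<lambda>\<alpha> S. r * h \<alpha> S) \<in> boundaries b w A \<epsilon>"
  unfolding boundaries_def by (auto simp flip: differential_scale intro: chains_scale)

lemma boundaries_zero: "(0 :: 'r::comm_ring_1 chain) \<in> boundaries b w A \<epsilon>"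
proof -
  have "(0 :: 'r chain) \<in> chains b w"
    by (simp add: chains_iff ext_alg_def)
  then have "(\<lambda>\<alpha> S. 0 * differential b w A \<epsilon> (0 :: 'r chain) \<alpha> S) \<in> boundaries b w A \<epsilon>"
    by (intro boundaries_scale) (auto simp: boundaries_def)
  then show ?thesis
    by (simp add: zero_fun_def)
qed

lemma boundaries_minus:
  assumes "h \<in> boundaries b w A \<epsilon>"
  shows "- h \<in> boundaries b w A \<epsilon>"
proof -
  have "(\<lambda>\<alpha> S. - 1 * h \<alpha> S) = - h"
    by (simp add: fun_eq_iff)
  then show ?thesis
    using boundaries_scale[OF assms, of "- 1"] by simp
qed

lemma homology_class_eq: "homology_class b w A \<epsilon> c = (\<lambda>h. h + c) ` boundaries b w A \<epsilon>"
  by (auto simp: homology_class_def r_coset_def cycles_def)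

lemma homology_class_cong:
  assumes "c - c' \<in> boundaries b w A \<epsilon>"
  shows "homology_class b w A \<epsilon> c = homology_class b w A \<epsilon> c'"
proof -
  have "homology_class b w A \<epsilon> c \<subseteq> homology_class b w A \<epsilon> c'"
    if "c - c' \<in> boundaries b w A \<epsilon>" for c c'
  proof
    fix a assume "a \<in> homology_class b w A \<epsilon> c"
    then obtain h where "h \<in> boundaries b w A \<epsilon>" "a = (h + (c - c')) + c'"
      by (auto simp: homology_class_eq)
    then show "a \<in> homology_class b w A \<epsilon> c'"
      using that boundaries_add unfolding homology_class_eq by blast
  qed
  moreover have "c' - c \<in> boundaries b w A \<epsilon>"
    using boundaries_minus[OF assms] by simp
  ultimately show ?thesis
    using assms by blast
qed

text \<open>Maps on classes are written as unions over all representatives. If the value does not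
  depend on the representative, the union is that value; it is not empty because 0 is a
  boundary.\<close>

lemma homology_class_UN:
  fixes c :: "'r::comm_ring_1 chain"
  assumes "\<And>h. h \<in> boundaries b w A \<epsilon> \<Longrightarrow> F (h + c) = X"
  shows "(\<Union>a\<in>homology_class b w A \<epsilon> c. F a) = X"
proof -
  have "(0 :: 'r chain) \<in> boundaries b w A \<epsilon>"
    by (rule boundaries_zero)
  then show ?thesis
    using assms by (auto simp: homology_class_eq)
qed

lemma carrier_odd_Kh: "carrier (odd_Kh b w A \<epsilon>) = homology_class b w A \<epsilon> ` carrier (cycles b w A \<epsilon>)"
  by (auto simp: odd_Kh_def FactGroup_def RCOSETS_def homology_class_def)

lemma mult_odd_Kh:
  "homology_class b w A \<epsilon> c \<otimes>\<^bsub>odd_Kh b w A \<epsilon>\<^esub> homology_class b w A \<epsilon> c' = homology_class b w A \<epsilon> (c + c')"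
proof -
  have "homology_class b w A \<epsilon> c \<otimes>\<^bsub>odd_Kh b w A \<epsilon>\<^esub> homology_class b w A \<epsilon> c' =
      {(h + c) + (h' + c') | h h'. h \<in> boundaries b w A \<epsilon> \<and> h' \<in> boundaries b w A \<epsilon>}"
    by (auto simp: odd_Kh_def FactGroup_def set_mult_def homology_class_eq cycles_def)
  also have "\<dots> = homology_class b w A \<epsilon> (c + c')"
  proof (intro equalityI subsetI)
    fix a assume "a \<in> {(h + c) + (h' + c') | h h'. h \<in> boundaries b w A \<epsilon> \<and> h' \<in> boundaries b w A \<epsilon>}"
    then obtain h h' where "h \<in> boundaries b w A \<epsilon>" "h' \<in> boundaries b w A \<epsilon>" "a = (h + h') + (c + c')"
      by (auto simp: algebra_simps)
    then show "a \<in> homology_class b w A \<epsilon> (c + c')"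
      using boundaries_add unfolding homology_class_eq by blast
  next
    fix a assume "a \<in> homology_class b w A \<epsilon> (c + c')"
    then obtain h where "h \<in> boundaries b w A \<epsilon>" "a = (h + c) + (0 + c')"
      by (auto simp: homology_class_eq algebra_simps)
    then show "a \<in> {(h + c) + (h' + c') | h h'. h \<in> boundaries b w A \<epsilon> \<and> h' \<in> boundaries b w A \<epsilon>}"
      using boundaries_zero by blast
  qed
  finally show ?thesis .
qed

lemma Kh_smult_homology_class:
  fixes c :: "'r::comm_ring_1 chain"
  shows "Kh_smult b w A \<epsilon> r (homology_class b w A \<epsilon> c) = homology_class b w A \<epsilon> (\<lambda>\<alpha> S. r * c \<alpha> S)"
  unfolding Kh_smult_def
proof (rule homology_class_UN)
  fix h :: "'r chain" assume "h \<in> boundaries b w A \<epsilon>"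
  moreover have "(\<lambda>\<alpha> S. r * (h + c) \<alpha> S) - (\<lambda>\<alpha> S. r * c \<alpha> S) = (\<lambda>\<alpha> S. r * h \<alpha> S)"
    by (simp add: fun_eq_iff algebra_simps)
  ultimately show "homology_class b w A \<epsilon> (\<lambda>\<alpha> S. r * (h + c) \<alpha> S) = homology_class b w A \<epsilon> (\<lambda>\<alpha> S. r * c \<alpha> S)"
    using boundaries_scale by (intro homology_class_cong) auto
qed

text \<open>Commuting with the differential sends boundaries to boundaries, so the class of the
  image does not depend on the representative.\<close>

lemma chain_map_induces:
  fixes \<Phi> :: "'r::comm_ring_1 chain \<Rightarrow> 'r chain"
  assumes add: "\<And>c c'. \<Phi> (c + c') = \<Phi> c + \<Phi> c'"
    and scale: "\<And>r c. \<Phi> (\<lambda>\<alpha> S. r * c \<alpha> S) = (\<lambda>\<alpha> S. r * \<Phi> c \<alpha> S)"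
    and chains: "\<And>c. c \<in> chains b w \<Longrightarrow> \<Phi> c \<in> chains b' w'"
    and diff: "\<And>c. differential b' w' A' \<epsilon>' (\<Phi> c) = \<Phi> (differential b w A \<epsilon> c)"
  shows "\<exists>p. Kh_module_hom b w A \<epsilon> b' w' A' \<epsilon>' p \<and>
    (\<forall>c. p (homology_class b w A \<epsilon> c) = homology_class b' w' A' \<epsilon>' (\<Phi> c))"
proof -
  define p where "p (X :: 'r chain set) = (\<Union>c\<in>X. homology_class b' w' A' \<epsilon>' (\<Phi> c))" for X
  have p: "p (homology_class b w A \<epsilon> c) = homology_class b' w' A' \<epsilon>' (\<Phi> c)" for c
    unfolding p_def
  proof (rule homology_class_UN)
    fix h :: "'r chain" assume "h \<in> boundaries b w A \<epsilon>"
    then have "\<Phi> h \<in> boundaries b' w' A' \<epsilon>'"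
      using chains by (auto simp: boundaries_def simp flip: diff)
    then show "homology_class b' w' A' \<epsilon>' (\<Phi> (h + c)) = homology_class b' w' A' \<epsilon>' (\<Phi> c)"
      by (intro homology_class_cong) (simp add: add)
  qed
  have zero: "\<Phi> 0 = 0"
    using add[of 0 0] by simp
  have "Kh_module_hom b w A \<epsilon> b' w' A' \<epsilon>' p"
    unfolding Kh_module_hom_def
  proof (intro conjI allI ballI)
    show "p \<in> hom (odd_Kh b w A \<epsilon>) (odd_Kh b' w' A' \<epsilon>')"
    proof (rule homI)
      fix X :: "'r chain set" assume "X \<in> carrier (odd_Kh b w A \<epsilon>)"
      then obtain c where "c \<in> carrier (cycles b w A \<epsilon>)" "X = homology_class b w A \<epsilon> c"
        by (auto simp: carrier_odd_Kh)
      moreover from this have "\<Phi> c \<in> carrier (cycles b' w' A' \<epsilon>')"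
        using chains by (simp add: cycles_def diff zero)
      ultimately show "p X \<in> carrier (odd_Kh b' w' A' \<epsilon>')"
        by (simp add: p carrier_odd_Kh)
    next
      fix X Y :: "'r chain set" assume "X \<in> carrier (odd_Kh b w A \<epsilon>)" "Y \<in> carrier (odd_Kh b w A \<epsilon>)"
      then obtain c c' where "X = homology_class b w A \<epsilon> c" "Y = homology_class b w A \<epsilon> c'"
        by (auto simp: carrier_odd_Kh)
      then show "p (X \<otimes>\<^bsub>odd_Kh b w A \<epsilon>\<^esub> Y) = p X \<otimes>\<^bsub>odd_Kh b' w' A' \<epsilon>'\<^esub> p Y"
        by (simp add: mult_odd_Kh p add)
    qed
    fix r and X :: "'r chain set" assume "X \<in> carrier (odd_Kh b w A \<epsilon>)"
    then obtain c where "X = homology_class b w A \<epsilon> c"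
      by (auto simp: carrier_odd_Kh)
    then show "p (Kh_smult b w A \<epsilon> r X) = Kh_smult b' w' A' \<epsilon>' r (p X)"
      by (simp add: Kh_smult_homology_class p scale)
  qed
  then show ?thesis
    using p by blast
qed

section \<open>The chain map of the deletion and the induced map on homology\<close>

context braid_deletion
begin

text \<open>Around a face the signs of the larger diagram give the parity for the inherited arrows,
  the signs of the smaller one the parity for \<open>A\<^sub>0\<close>, and the reversal signs their
  discrepancy; so the total product is 1.\<close>

lemma comparison_signs:
  assumes A: "arrow_choice D A" and \<epsilon>: "sign_assignment b D A \<epsilon>"
    and A\<^sub>0: "arrow_choice E A\<^sub>0" and \<epsilon>\<^sub>0: "sign_assignment b E A\<^sub>0 \<epsilon>\<^sub>0"
  obtains \<eta> where "\<And>\<alpha>. \<alpha> \<subseteq> crossings E \<Longrightarrow> \<eta> \<alpha> \<in> {1, - 1 :: int}"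
    and "\<And>\<alpha> x. \<alpha> \<subseteq> crossings E \<Longrightarrow> x \<in> crossings E - \<alpha> \<Longrightarrow>
      \<epsilon> (emb ` \<alpha>, emb x) * E.reversal_sign (A \<circ> emb) A\<^sub>0 \<alpha> x * \<epsilon>\<^sub>0 (\<alpha>, x) = \<eta> \<alpha> * \<eta> (insert x \<alpha>)"
proof -
  note A' = arrow_choice_emb[OF A]
  define r where "r = (\<lambda>(\<alpha>, x). \<epsilon> (emb ` \<alpha>, emb x) * E.reversal_sign (A \<circ> emb) A\<^sub>0 \<alpha> x * \<epsilon>\<^sub>0 (\<alpha>, x))"
  have rs: "E.reversal_sign (A \<circ> emb) A\<^sub>0 \<alpha> x \<in> {1, - 1}" for \<alpha> x
    by (simp add: E.reversal_sign_def)
  show thesis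
  proof (rule cube_cocycle_trivial[of "length E" r])
    fix \<alpha> x assume \<alpha>: "\<alpha> \<subseteq> crossings E" "x \<in> crossings E - \<alpha>"
    then have "emb ` \<alpha> \<subseteq> crossings D" "emb x \<in> crossings D - emb ` \<alpha>"
      using emb_crossings[of \<alpha>] emb_less_iff[of x] by auto
    then have "\<epsilon> (emb ` \<alpha>, emb x) \<in> {1, - 1}" "\<epsilon>\<^sub>0 (\<alpha>, x) \<in> {1, - 1}"
      using \<epsilon> \<epsilon>\<^sub>0 \<alpha> unfolding sign_assignment_def by blast+
    then show "r (\<alpha>, x) \<in> {1, - 1}"
      using rs[of \<alpha> x] by (auto simp: r_def)
  next
    fix \<alpha> x y
    assume \<alpha>: "\<alpha> \<subseteq> crossings E" and x: "x \<in> crossings E - \<alpha>" and y: "y \<in> crossings E - \<alpha>" and xy: "x \<noteq> y"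
    have len: "x < length E" "y < length E"
      using x y by auto
    have \<alpha>': "emb ` \<alpha> \<subseteq> crossings D" "emb x \<in> crossings D - emb ` \<alpha>" "emb y \<in> crossings D - emb ` \<alpha>" "emb x \<noteq> emb y"
      using \<alpha> x y xy emb_crossings[of \<alpha>] emb_less_iff[of x] emb_less_iff[of y] inj_emb by (auto dest: injD)
    interpret FD: braid_face b D A "emb ` \<alpha>" "emb x" "emb y"
      using \<alpha>' A by unfold_locales auto
    interpret FE: braid_face b E "A \<circ> emb" \<alpha> x y
      using x y xy A' by unfold_locales auto
    interpret FE0: braid_face b E A\<^sub>0 \<alpha> x y
      using x y xy A\<^sub>0 by unfold_locales auto
    let ?s = "E.reversal_sign (A \<circ> emb) A\<^sub>0"
    let ?p = "\<epsilon> (emb ` \<alpha>, emb x) * \<epsilon> (emb ` \<alpha>, emb y) * \<epsilon> (emb ` insert x \<alpha>, emb y) * \<epsilon> (emb ` insert y \<alpha>, emb x)"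
    let ?q = "?s \<alpha> x * ?s \<alpha> y * ?s (insert x \<alpha>) y * ?s (insert y \<alpha>) x"
    let ?t = "\<epsilon>\<^sub>0 (\<alpha>, x) * \<epsilon>\<^sub>0 (\<alpha>, y) * \<epsilon>\<^sub>0 (insert x \<alpha>, y) * \<epsilon>\<^sub>0 (insert y \<alpha>, x)"
    have p: "?p = (if E.even_face (A \<circ> emb) \<alpha> x y then 1 else - 1)"
      using FD.face_sign[OF \<epsilon> \<alpha>'(1)] even_face_emb[OF len] by simp
    have t: "?t = (if E.even_face A\<^sub>0 \<alpha> x y then 1 else - 1)"
      by (rule FE0.face_sign[OF \<epsilon>\<^sub>0 \<alpha>])
    have q: "(E.even_face (A \<circ> emb) \<alpha> x y \<longleftrightarrow> E.even_face A\<^sub>0 \<alpha> x y) \<longleftrightarrow> ?q = 1"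
      by (rule FE.even_face_reversal[OF A\<^sub>0])
    have "?q \<in> {1, - 1}"
      using rs[of \<alpha> x] rs[of \<alpha> y] rs[of "insert x \<alpha>" y] rs[of "insert y \<alpha>" x] by auto
    then have "?p * ?q * ?t = 1"
      unfolding p t using q by auto
    then show "r (\<alpha>, x) * r (\<alpha>, y) * r (insert x \<alpha>, y) * r (insert y \<alpha>, x) = 1"
      by (simp add: r_def algebra_simps)
  next
    fix \<eta> assume "\<And>\<alpha>. \<alpha> \<subseteq> crossings E \<Longrightarrow> \<eta> \<alpha> \<in> {1, - 1 :: int}"
      "\<And>\<alpha> x. \<alpha> \<subseteq> crossings E \<Longrightarrow> x \<in> crossings E - \<alpha> \<Longrightarrow> r (\<alpha>, x) = \<eta> \<alpha> * \<eta> (insert x \<alpha>)"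
    then show thesis
      by (intro that[of \<eta>]) (auto simp: r_def)
  qed
qed

definition deletion_map :: "(vertex \<Rightarrow> int) \<Rightarrow> 'r::comm_ring_1 chain \<Rightarrow> 'r chain" where
  "deletion_map \<eta> c = (\<lambda>\<alpha> S. of_int (\<eta> \<alpha>) * relabel lift (c (emb ` \<alpha>)) S)"

lemma deletion_map_chains:
  assumes "c \<in> chains b D"
  shows "deletion_map \<eta> c \<in> chains b E"
  unfolding chains_def
proof (intro CollectI allI)
  fix \<alpha>
  have c: "c (emb ` \<alpha>) \<in> (if \<alpha> \<subseteq> crossings E then ext_alg (gens b D (emb ` \<alpha>)) else {0})"
    using assms unfolding chains_def emb_crossings[symmetric] by blast
  show "deletion_map \<eta> c \<alpha> \<in> (if \<alpha> \<subseteq> crossings E then ext_alg (gens b E \<alpha>) else {0})"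
  proof (cases "\<alpha> \<subseteq> crossings E")
    case True
    have "S \<subseteq> gens b E \<alpha>" if "deletion_map \<eta> c \<alpha> S \<noteq> 0" for S
    proof -
      have "c (emb ` \<alpha>) (lift ` S) \<noteq> 0"
        using that by (auto simp: deletion_map_def relabel_def)
      then have "lift ` S \<subseteq> lift ` gens b E \<alpha>"
        using c True by (auto simp: ext_alg_def gens_lift)
      then show ?thesis
        using strict_mono_imp_inj_on[OF strict_mono_lift] by (simp add: inj_image_subset_iff)
    qed
    then show ?thesis
      using True by (simp add: ext_alg_def)
  next
    case False
    then show ?thesis
      using c by (auto simp: deletion_map_def relabel_def fun_eq_iff)
  qed
qed

text \<open>A vertex in the image does not contain \<open>n\<close>, so the edges ending at it start
  at image vertices, and both sides sum over corresponding edges. Edge by edge,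
  \<open>\<eta>\<close> converts the signs of one complex into those of the other.\<close>

lemma differential_deletion_map:
  assumes A: "arrow_choice D A" and \<epsilon>: "sign_assignment b D A \<epsilon>"
    and A\<^sub>0: "arrow_choice E A\<^sub>0"
    and \<eta>: "\<And>\<alpha>. \<alpha> \<subseteq> crossings E \<Longrightarrow> \<eta> \<alpha> \<in> {1, - 1 :: int}"
      "\<And>\<alpha> x. \<alpha> \<subseteq> crossings E \<Longrightarrow> x \<in> crossings E - \<alpha> \<Longrightarrow>
        \<epsilon> (emb ` \<alpha>, emb x) * E.reversal_sign (A \<circ> emb) A\<^sub>0 \<alpha> x * \<epsilon>\<^sub>0 (\<alpha>, x) = \<eta> \<alpha> * \<eta> (insert x \<alpha>)"
  shows "differential b E A\<^sub>0 \<epsilon>\<^sub>0 (deletion_map \<eta> c) = deletion_map \<eta> (differential b D A \<epsilon> c)"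
proof (intro ext)
  fix \<beta> S
  note A' = arrow_choice_emb[OF A]
  show "differential b E A\<^sub>0 \<epsilon>\<^sub>0 (deletion_map \<eta> c) \<beta> S = deletion_map \<eta> (differential b D A \<epsilon> c) \<beta> S"
  proof (cases "\<beta> \<subseteq> crossings E")
    case False
    then show ?thesis
      using emb_crossings[of \<beta>] by (auto simp: differential_def deletion_map_def relabel_def)
  next
    case True
    have "of_int (\<epsilon>\<^sub>0 (\<beta> - {x}, x)) * edge_map b E A\<^sub>0 (\<beta> - {x}) x (deletion_map \<eta> c (\<beta> - {x})) S =
        of_int (\<eta> \<beta>) * (of_int (\<epsilon> (emb ` \<beta> - {emb x}, emb x)) *
          edge_map b D A (emb ` \<beta> - {emb x}) (emb x) (c (emb ` \<beta> - {emb x})) (lift ` S))"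
      if x: "x \<in> \<beta>" for x
    proof -
      define \<alpha> where "\<alpha> = \<beta> - {x}"
      have \<alpha>: "\<alpha> \<subseteq> crossings E" "x \<in> crossings E - \<alpha>" "insert x \<alpha> = \<beta>"
        using x True by (auto simp: \<alpha>_def)
      have eq: "emb ` \<beta> - {emb x} = emb ` \<alpha>"
        using inj_emb by (auto simp: \<alpha>_def dest: injD)
      let ?s = "E.reversal_sign (A \<circ> emb) A\<^sub>0 \<alpha> x"
      let ?F = "edge_map b E (A \<circ> emb) \<alpha> x (relabel lift (c (emb ` \<alpha>))) S"
      have "emb ` \<alpha> \<subseteq> crossings D" "emb x \<in> crossings D - emb ` \<alpha>"
        using \<alpha> emb_crossings[of \<alpha>] emb_less_iff[of x] by auto
      then have "\<epsilon> (emb ` \<alpha>, emb x) \<in> {1, - 1}"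
        using \<epsilon> unfolding sign_assignment_def by blast
      \<comment> \<open>Multiplying by these squares brings the sign of the edge into a form to
        which the coboundary relation applies.\<close>
      then have sq: "\<epsilon> (emb ` \<alpha>, emb x) * \<epsilon> (emb ` \<alpha>, emb x) = 1" "\<eta> \<alpha> * \<eta> \<alpha> = 1"
        using \<eta>(1)[OF \<alpha>(1)] by (auto intro: sign_square)
      have "\<epsilon>\<^sub>0 (\<alpha>, x) * \<eta> \<alpha> * ?s = (\<epsilon> (emb ` \<alpha>, emb x) * \<epsilon> (emb ` \<alpha>, emb x)) * (\<epsilon>\<^sub>0 (\<alpha>, x) * \<eta> \<alpha> * ?s)"
        using sq by simp
      also have "\<dots> = \<epsilon> (emb ` \<alpha>, emb x) * \<eta> \<alpha> * (\<epsilon> (emb ` \<alpha>, emb x) * ?s * \<epsilon>\<^sub>0 (\<alpha>, x))"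
        by (simp only: ac_simps)
      also have "\<dots> = (\<eta> \<alpha> * \<eta> \<alpha>) * (\<eta> \<beta> * \<epsilon> (emb ` \<alpha>, emb x))"
        unfolding \<eta>(2)[OF \<alpha>(1,2)] \<alpha>(3) by (simp only: ac_simps)
      finally have sign: "\<epsilon>\<^sub>0 (\<alpha>, x) * \<eta> \<alpha> * ?s = \<eta> \<beta> * \<epsilon> (emb ` \<alpha>, emb x)"
        using sq by simp
      have "of_int (\<epsilon>\<^sub>0 (\<alpha>, x)) * edge_map b E A\<^sub>0 \<alpha> x (deletion_map \<eta> c \<alpha>) S =
          of_int (\<epsilon>\<^sub>0 (\<alpha>, x) * \<eta> \<alpha> * ?s) * ?F"
        unfolding deletion_map_def edge_map_scale E.edge_map_reversal[OF A' A\<^sub>0 \<alpha>(2)] by (simp add: mult.assoc)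
      also have "?F = edge_map b D A (emb ` \<alpha>) (emb x) (c (emb ` \<alpha>)) (lift ` S)"
        unfolding edge_map_emb[OF A \<alpha>(2), symmetric] by (simp add: relabel_def)
      finally show ?thesis
        unfolding sign eq \<alpha>_def[symmetric] by (simp add: mult.assoc)
    qed
    moreover have "inj_on emb \<beta>"
      using inj_emb by (rule inj_on_subset) simp
    moreover have "deletion_map \<eta> (differential b D A \<epsilon> c) \<beta> S =
        of_int (\<eta> \<beta>) * differential b D A \<epsilon> c (emb ` \<beta>) (lift ` S)"
      by (simp add: deletion_map_def relabel_def)
    ultimately show ?thesis
      using True emb_crossings[of \<beta>]
      by (simp add: differential_def sum.reindex sum_distrib_left cong: sum.cong)
  qed
qed

end

theorem proposition4p3:
  fixes b i :: nat and u v D D\<^sub>0 :: braid_word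
    and A A\<^sub>0 :: "nat \<Rightarrow> direction" and \<epsilon> \<epsilon>\<^sub>0 :: "vertex \<times> nat \<Rightarrow> int"
  assumes "coefficient_ring TYPE('r::comm_ring_1)"
    and "D = u @ PosGen i # v" and "D\<^sub>0 = u @ v"
    and "is_braid_word b D"
    and "arrow_choice D A" and "sign_assignment b D A \<epsilon>"
    and "arrow_choice D\<^sub>0 A\<^sub>0" and "sign_assignment b D\<^sub>0 A\<^sub>0 \<epsilon>\<^sub>0"
  shows "\<exists>p :: 'r chain set \<Rightarrow> 'r chain set.
           Kh_module_hom b D A \<epsilon> b D\<^sub>0 A\<^sub>0 \<epsilon>\<^sub>0 p \<and>
           (p (psi b D A \<epsilon>) = psi b D\<^sub>0 A\<^sub>0 \<epsilon>\<^sub>0 \<or>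
            p (psi b D A \<epsilon>) = inv\<^bsub>odd_Kh b D\<^sub>0 A\<^sub>0 \<epsilon>\<^sub>0\<^esub> (psi b D\<^sub>0 A\<^sub>0 \<epsilon>\<^sub>0))"
proof -
  interpret braid_deletion b i u v
    using assms(2,4) by unfold_locales simp
  note A = assms(5,6)[unfolded assms(2)] and A\<^sub>0 = assms(7,8)[unfolded assms(3)]
  show ?thesis
  proof (rule comparison_signs[OF A A\<^sub>0])
    fix \<eta> assume \<eta>: "\<And>\<alpha>. \<alpha> \<subseteq> crossings (u @ v) \<Longrightarrow> \<eta> \<alpha> \<in> {1, - 1 :: int}"
      "\<And>\<alpha> x. \<alpha> \<subseteq> crossings (u @ v) \<Longrightarrow> x \<in> crossings (u @ v) - \<alpha> \<Longrightarrow>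
        \<epsilon> (emb ` \<alpha>, emb x) * E.reversal_sign (A \<circ> emb) A\<^sub>0 \<alpha> x * \<epsilon>\<^sub>0 (\<alpha>, x) = \<eta> \<alpha> * \<eta> (insert x \<alpha>)"
    \<comment> \<open>The value of the cochain at the braid-like resolution. Multiplying the whole
      cochain by it makes the value there 1 and leaves every product of two values unchanged, so the
      first alternative of the claim is obtained.\<close>
    define \<sigma> where "\<sigma> = \<eta> (braid_vertex (u @ v))"
    have "braid_vertex (u @ v) \<subseteq> crossings (u @ v)"
      by (auto simp: braid_vertex_def)
    then have \<sigma>: "\<sigma> \<in> {1, - 1}"
      unfolding \<sigma>_def by (rule \<eta>(1))
    define \<theta> where "\<theta> \<alpha> = \<sigma> * \<eta> \<alpha>" for \<alpha>
    have \<theta>1: "\<theta> \<alpha> \<in> {1, - 1}" if "\<alpha> \<subseteq> crossings (u @ v)" for \<alpha>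
      using \<eta>(1)[OF that] \<sigma> by (auto simp: \<theta>_def)
    have \<theta>2: "\<epsilon> (emb ` \<alpha>, emb x) * E.reversal_sign (A \<circ> emb) A\<^sub>0 \<alpha> x * \<epsilon>\<^sub>0 (\<alpha>, x) = \<theta> \<alpha> * \<theta> (insert x \<alpha>)"
      if "\<alpha> \<subseteq> crossings (u @ v)" "x \<in> crossings (u @ v) - \<alpha>" for \<alpha> x
      using \<eta>(2)[OF that] \<sigma> by (auto simp: \<theta>_def)
    have "\<theta> (braid_vertex (u @ v)) = 1"
      using \<sigma> by (auto simp: \<theta>_def \<sigma>_def[symmetric])
    then have psi: "deletion_map \<theta> (psi_chain b D) = (psi_chain b D\<^sub>0 :: 'r chain)"
      unfolding deletion_map_def assms(2,3) relabel_psi_chain by (auto simp: psi_chain_def fun_eq_iff)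
    have "\<exists>p :: 'r chain set \<Rightarrow> 'r chain set. Kh_module_hom b D A \<epsilon> b D\<^sub>0 A\<^sub>0 \<epsilon>\<^sub>0 p \<and>
      (\<forall>c. p (homology_class b D A \<epsilon> c) = homology_class b D\<^sub>0 A\<^sub>0 \<epsilon>\<^sub>0 (deletion_map \<theta> c))"
    proof (rule chain_map_induces)
      show "deletion_map \<theta> (c + c') = deletion_map \<theta> c + deletion_map \<theta> c'" for c c' :: "'r chain"
        by (simp add: deletion_map_def relabel_def fun_eq_iff algebra_simps)
      show "deletion_map \<theta> (\<lambda>\<alpha> S. r * c \<alpha> S) = (\<lambda>\<alpha> S. r * deletion_map \<theta> c \<alpha> S)" for r and c :: "'r chain"
        by (simp add: deletion_map_def relabel_def fun_eq_iff algebra_simps)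
      show "deletion_map \<theta> c \<in> chains b D\<^sub>0" if "c \<in> chains b D" for c :: "'r chain"
        using deletion_map_chains that unfolding assms(2,3) .
      show "differential b D\<^sub>0 A\<^sub>0 \<epsilon>\<^sub>0 (deletion_map \<theta> c) = deletion_map \<theta> (differential b D A \<epsilon> c)" for c :: "'r chain"
        unfolding assms(2,3) by (rule differential_deletion_map[OF A A\<^sub>0(1) \<theta>1 \<theta>2])
    qed
    then show ?thesis
      unfolding psi_def psi[symmetric] by blast
  qed
qed

end
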